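(* Let $\mathrm{L}$ and $\mathbf{D}$ be a spline-admissible pair of order $r>d/2$ on $\mathbb{R}^d$, and suppose that there exist $\omega_0>0$ and constants $C_1,C_2>0$ such that the symbol $\widehat L$ satisfies $$C_1|\bm{\omega}|^r\le|\widehat L(\bm{\omega})|\le C_2|\bm{\omega}|^r\qquad\text{for }|\bm{\omega}|\ge\omega_0.$$ Then there is an integer $j_0$ such that the collection $$\{\varphi_{j_0+1}(\cdot-\bm{\beta})\}_{\bm{\beta}\in\mathbf{D}^{j_0+1}\mathbb{Z}^d}\ \cup\ \bigcup_{j\le j_0}\big\{|\det(\mathbf{D})|^{(r/d-1/2)j}\,\psi_{j+1}(\cdot-\bm{\beta})\big\}_{\bm{\beta}\in\mathbf{D}^j\mathbb{Z}^d\setminus\mathbf{D}^{j+1}\mathbb{Z}^d}$$ forms a Riesz basis of $L_2(\mathbb{R}^d)$.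
   Context: Conventions: $\widehat f(\bm{\omega})=\int_{\mathbb{R}^d}f(\bm{x})e^{-i\bm{x}\cdot\bm{\omega}}\,d\bm{x}$, $g^\vee$ is the inverse Fourier transform, $z^*$ denotes the complex conjugate. A Fourier multiplier operator $\mathrm{L}$ with measurable symbol $\widehat L$ acts by $\mathrm{L}f=(\widehat L\,\widehat f)^\vee$; its adjoint $\mathrm{L}^*$ has symbol $\widehat L^*$. $\mathrm{L}$ is admissible if $\widehat L=f/g$ with $f,g$ continuous functions on $\mathbb{R}^d$ such that the set of zeros of $fg$ has Lebesgue measure zero and the zero sets of $f$ and $g$ are disjoint. An operator $\mathrm{L}$ and an integer $d\times d$ matrix $\mathbf{D}$ are a spline-admissible pair of order $r>d/2$ if: (1) $\mathrm{L}$ is an admissible Fourier multiplier operator; (2) $\mathbf{D}=a\mathbf{R}$ with $\mathbf{R}$ orthogonal and $a>1$; (3) there is $C_{\mathrm{L}}>0$ with $C_{\mathrm{L}}(1+|\widehat L(\bm{\omega})|^2)\ge|\bm{\omega}|^{2r}$ for almost every $\bm{\omega}$; (4) for every $j\in\mathbb{Z}$ there is a periodic function $\widehat L_{\mathrm{d},j}(\bm{\omega})=\sum_{\bm{k}\in\mathbb{Z}^d}p_j[\bm{k}]e^{i\bm{\omega}\cdot\mathbf{D}^j\bm{k}}$ with $p_j\in\ell_1(\mathbb{Z}^d)$ such that $\widehat\varphi_j:=\widehat L_{\mathrm{d},j}\widehat L^{-1}$ satisfies, for some real constants $A_j,B_j$ and almost every $\bm{\omega}$, $$0<A_j\le\sum_{\bm{k}\in\mathbb{Z}^d}|\widehat\varphi_j(\bm{\omega}+2\pi(\mathbf{D}^T)^{-j}\bm{k})|^2\le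 B_j<\infty.$$ The functions $\varphi_j:=(\widehat\varphi_j)^\vee\in L_2(\mathbb{R}^d)$ are the generalized B-splines for $\mathrm{L}$. The $\mathrm{L}^*\mathrm{L}$-spline interpolant $\phi_j$ is given by $\widehat\phi_j(\bm{\omega})=|\det(\mathbf{D})|^j\,|\widehat\varphi_j(\bm{\omega})|^2\big/\sum_{\bm{k}\in\mathbb{Z}^d}|\widehat\varphi_j(\bm{\omega}+2\pi(\mathbf{D}^T)^{-j}\bm{k})|^2$, and the wavelets are $\psi_{j+1}:=\mathrm{L}^*\phi_j$. *)

theory Defs
  imports "HOL-Analysis.Analysis"
begin

section \<open>Square-integrable functions and Riesz bases\<close>

text \<open>Elements of $L_2$ are handled through representatives; every notion below is insensitive
  to changes on null sets.\<close>

definition L2 :: "(real^'d \<Rightarrow> complex) set" where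
  "L2 = {f. f \<in> borel_measurable lebesgue \<and> integrable lebesgue (\<lambda>x. (cmod (f x))\<^sup>2)}"

definition L2_norm :: "(real^'d \<Rightarrow> complex) \<Rightarrow> real" where
  "L2_norm f = sqrt (LINT x|lebesgue. (cmod (f x))\<^sup>2)"

text \<open>The nonnegative integral makes this meaningful even if \<open>u n - f\<close> is not known to be
  square-integrable (a Bochner integral would be \<open>0\<close> in that case).\<close>

definition converges_L2 :: "(nat \<Rightarrow> real^'d \<Rightarrow> complex) \<Rightarrow> (real^'d \<Rightarrow> complex) \<Rightarrow> bool" where
  "converges_L2 u f \<longleftrightarrow>
     (\<lambda>n. \<integral>\<^sup>+ x. ennreal ((cmod (u n x - f x))\<^sup>2) \<partial>lebesgue) \<longlonglongrightarrow> 0"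

text \<open>Riesz basis of the whole space $L_2$: a family whose finite linear combinations are dense
  and whose synthesis map is bounded above and below on finitely supported coefficients.\<close>

definition riesz_basis_L2 :: "('i \<Rightarrow> real^'d \<Rightarrow> complex) \<Rightarrow> 'i set \<Rightarrow> bool" where
  "riesz_basis_L2 e I \<longleftrightarrow>
     (\<forall>i\<in>I. e i \<in> L2) \<and>
     (\<forall>f\<in>L2. \<forall>\<epsilon>>0. \<exists>F c. finite F \<and> F \<subseteq> I \<and> L2_norm (\<lambda>x. f x - (\<Sum>i\<in>F. c i * e i x)) < \<epsilon>) \<and>
     (\<exists>A B. 0 < A \<and>
        (\<forall>F c. finite F \<and> F \<subseteq> I \<longrightarrow>
           A * (\<Sum>i\<in>F. (cmod (c i))\<^sup>2) \<le> (L2_norm (\<lambda>x. \<Sum>i\<in>F. c i * e i x))\<^sup>2 \<and>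
           (L2_norm (\<lambda>x. \<Sum>i\<in>F. c i * e i x))\<^sup>2 \<le> B * (\<Sum>i\<in>F. (cmod (c i))\<^sup>2)))"


section \<open>Fourier transform on $L_2$ and Fourier multipliers\<close>

text \<open>The Fourier integral need not exist for $f \in L_2$; the transform is the $L_2$-limit of the
  integrals over balls of radius $n$, which determines it up to null sets.\<close>

definition fourier_L2 :: "(real^'d \<Rightarrow> complex) \<Rightarrow> real^'d \<Rightarrow> complex" where
  "fourier_L2 f = (SOME F. F \<in> L2 \<and>
     converges_L2 (\<lambda>n \<omega>. LINT x:cball 0 (real n)|lebesgue. f x * exp (- \<i> * of_real (x \<bullet> \<omega>))) F)"

definition inverse_fourier_L2 :: "(real^'d \<Rightarrow> complex) \<Rightarrow> real^'d \<Rightarrow> complex" where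
  "inverse_fourier_L2 F = (SOME f. f \<in> L2 \<and>
     converges_L2 (\<lambda>n x. (LINT \<omega>:cball 0 (real n)|lebesgue. F \<omega> * exp (\<i> * of_real (x \<bullet> \<omega>)))
                           / of_real ((2 * pi) ^ CARD('d))) f)"

text \<open>Meaningful for \<open>f \<in> L2\<close> such that the product of the symbol with the transform of \<open>f\<close>
  is again in \<open>L2\<close>.\<close>

definition fourier_multiplier ::
    "(real^'d \<Rightarrow> complex) \<Rightarrow> (real^'d \<Rightarrow> complex) \<Rightarrow> real^'d \<Rightarrow> complex" where
  "fourier_multiplier m f = inverse_fourier_L2 (\<lambda>\<omega>. m \<omega> * fourier_L2 f \<omega>)"

definition adjoint_symbol :: "(real^'d \<Rightarrow> complex) \<Rightarrow> real^'d \<Rightarrow> complex" where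
  "adjoint_symbol m = (\<lambda>\<omega>. cnj (m \<omega>))"

text \<open>The quotient is undefined on the null set where the denominator vanishes, hence the equality
  almost everywhere.\<close>

definition admissible_symbol :: "(real^'d \<Rightarrow> complex) \<Rightarrow> bool" where
  "admissible_symbol L \<longleftrightarrow>
     L \<in> borel_measurable lebesgue \<and>
     (\<exists>f g. continuous_on UNIV f \<and> continuous_on UNIV g \<and>
        {\<omega>. f \<omega> * g \<omega> = 0} \<in> null_sets lebesgue \<and>
        {\<omega>. f \<omega> = 0} \<inter> {\<omega>. g \<omega> = 0} = {} \<and>
        (AE \<omega> in lebesgue. L \<omega> = f \<omega> / g \<omega>))"


section \<open>Dilation matrices and lattices\<close>

definition mat_powi :: "real^'d^'d \<Rightarrow> int \<Rightarrow> real^'d^'d" where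
  "mat_powi D j =
     (if 0 \<le> j then (((**) D) ^^ nat j) (mat 1) else (((**) (matrix_inv D)) ^^ nat (- j)) (mat 1))"

definition of_int_vec :: "int^'d \<Rightarrow> real^'d" where
  "of_int_vec k = (\<chi> i. of_int (k $ i))"

definition lattice_pt :: "real^'d^'d \<Rightarrow> int \<Rightarrow> int^'d \<Rightarrow> real^'d" where
  "lattice_pt D j k = mat_powi D j *v of_int_vec k"

definition dilated_lattice :: "real^'d^'d \<Rightarrow> int \<Rightarrow> (real^'d) set" where
  "dilated_lattice D j = range (lattice_pt D j)"


section \<open>Generalized B-splines and operator-like wavelets\<close>

text \<open>\<open>p\<close> is the coefficient sequence at the single scale \<open>j\<close>.\<close>

definition loc_symbol :: "real^'d^'d \<Rightarrow> int \<Rightarrow> (int^'d \<Rightarrow> complex) \<Rightarrow> real^'d \<Rightarrow> complex" where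
  "loc_symbol D j p \<omega> = (\<Sum>\<^sub>\<infinity>k. p k * exp (\<i> * of_real (\<omega> \<bullet> lattice_pt D j k)))"

definition bspline_hat ::
    "(real^'d \<Rightarrow> complex) \<Rightarrow> real^'d^'d \<Rightarrow> int \<Rightarrow> (int^'d \<Rightarrow> complex) \<Rightarrow> real^'d \<Rightarrow> complex" where
  "bspline_hat L D j p \<omega> = loc_symbol D j p \<omega> * inverse (L \<omega>)"

definition bspline_period ::
    "(real^'d \<Rightarrow> complex) \<Rightarrow> real^'d^'d \<Rightarrow> int \<Rightarrow> (int^'d \<Rightarrow> complex) \<Rightarrow> real^'d \<Rightarrow> real" where
  "bspline_period L D j p \<omega> =
     (\<Sum>\<^sub>\<infinity>k. (cmod (bspline_hat L D j p (\<omega> + (2 * pi) *\<^sub>R lattice_pt (transpose D) (- j) k)))\<^sup>2)"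

text \<open>A divergent \<open>infsum\<close> is \<open>0\<close>, so the positive lower bound also forces convergence.\<close>

definition localizes ::
    "(real^'d \<Rightarrow> complex) \<Rightarrow> real^'d^'d \<Rightarrow> int \<Rightarrow> (int^'d \<Rightarrow> complex) \<Rightarrow> bool" where
  "localizes L D j p \<longleftrightarrow>
     (\<lambda>k. cmod (p k)) summable_on UNIV \<and>
     (\<exists>A B. 0 < A \<and>
        (AE \<omega> in lebesgue. A \<le> bspline_period L D j p \<omega> \<and> bspline_period L D j p \<omega> \<le> B))"

definition spline_admissible_pair :: "(real^'d \<Rightarrow> complex) \<Rightarrow> real^'d^'d \<Rightarrow> real \<Rightarrow> bool" where
  "spline_admissible_pair L D r \<longleftrightarrow>
     r > real CARD('d) / 2 \<and>
     (\<forall>i j. D $ i $ j \<in> \<int>) \<and>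
     admissible_symbol L \<and>
     (\<exists>a R. a > 1 \<and> orthogonal_matrix R \<and> D = a *\<^sub>R R) \<and>
     (\<exists>C>0. AE \<omega> in lebesgue. C * (1 + (cmod (L \<omega>))\<^sup>2) \<ge> norm \<omega> powr (2 * r)) \<and>
     (\<forall>j. \<exists>p. localizes L D j p)"

definition bspline ::
    "(real^'d \<Rightarrow> complex) \<Rightarrow> real^'d^'d \<Rightarrow> (int \<Rightarrow> int^'d \<Rightarrow> complex) \<Rightarrow> int \<Rightarrow> real^'d \<Rightarrow> complex" where
  "bspline L D p j = inverse_fourier_L2 (bspline_hat L D j (p j))"

definition interpolant ::
    "(real^'d \<Rightarrow> complex) \<Rightarrow> real^'d^'d \<Rightarrow> (int \<Rightarrow> int^'d \<Rightarrow> complex) \<Rightarrow> int \<Rightarrow> real^'d \<Rightarrow> complex" where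
  "interpolant L D p j = inverse_fourier_L2 (\<lambda>\<omega>. of_real
     (\<bar>det D\<bar> powi j * (cmod (bspline_hat L D j (p j) \<omega>))\<^sup>2 / bspline_period L D j (p j) \<omega>))"

text \<open>The wavelet with index \<open>j\<close> comes from the interpolant at the finer scale \<open>j - 1\<close>.\<close>

definition wavelet ::
    "(real^'d \<Rightarrow> complex) \<Rightarrow> real^'d^'d \<Rightarrow> (int \<Rightarrow> int^'d \<Rightarrow> complex) \<Rightarrow> int \<Rightarrow> real^'d \<Rightarrow> complex" where
  "wavelet L D p j = fourier_multiplier (adjoint_symbol L) (interpolant L D p (j - 1))"

text \<open>\<open>Inl \<beta>\<close> indexes the B-splines at scale \<open>j0 + 1\<close>, and \<open>Inr (j, \<beta>)\<close> the normalized wavelets.\<close>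

definition wavelet_index :: "real^'d^'d \<Rightarrow> int \<Rightarrow> ((real^'d) + int \<times> (real^'d)) set" where
  "wavelet_index D j0 =
     dilated_lattice D (j0 + 1) <+> (SIGMA j:{..j0}. dilated_lattice D j - dilated_lattice D (j + 1))"

definition wavelet_system ::
    "(real^'d \<Rightarrow> complex) \<Rightarrow> real^'d^'d \<Rightarrow> real \<Rightarrow> (int \<Rightarrow> int^'d \<Rightarrow> complex) \<Rightarrow> int \<Rightarrow>
     (real^'d) + int \<times> (real^'d) \<Rightarrow> real^'d \<Rightarrow> complex" where
  "wavelet_system L D r p j0 = case_sum
     (\<lambda>\<beta> x. bspline L D p (j0 + 1) (x - \<beta>))
     (\<lambda>(j, \<beta>) x. of_real (\<bar>det D\<bar> powr ((r / real CARD('d) - 1 / 2) * of_int j)) *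
                  wavelet L D p (j + 1) (x - \<beta>))"

end

theory Submission
  imports Defs
begin

text \<open>All Fourier transforms in the system are periodic multiples of $1/\hat L$. With
  $S_j(\omega) = \sum_k |\hat L(\omega + 2\pi (D^T)^{-j} k)|^{-2}$ the wavelet transform
  $\hat\psi_{j+1}$ is $|\det D|^j / (\hat L S_j)$, and the square norm of a combination of wavelets of
  scale $j$ with coefficient series $C$ is a multiple of the integral of $|C|^2 / S_j$ over a period cell.

  Fine scales see only the region where $\hat L$ grows like a power, so $S_j$ is at least of the order
  $a^{2rj}$ and, away from the dual lattice, at most of that order. Since $C$ has no frequencies in the
  coarser lattice, it averages to zero over the cosets of the dual lattices, at most one of which lies
  near the dual lattice; hence the region where $1/S_j$ degenerates does not matter. Different scales
  are orthogonal.

  If $g$ is orthogonal to the system, then the periodizations of $g$ divided by the conjugate symbol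
  vanish at every scale by descending induction, and letting the scale tend to $-\infty$ gives $g = 0$.
  By Hilbert space projection this is completeness.

  Plancherel's theorem is obtained from Parseval's identity on a cube, and the latter from the
  Stone--Weierstrass theorem on the torus.\<close>

section \<open>Square-integrable functions on a measure space\<close>

text \<open>The obstacle is the lower Riesz bound for the wavelets. Inside the ball of radius
  \<open>\<omega>\<^sub>0\<close> the symbol has no lower bound, so the weight 1/S_j may come
  arbitrarily close to 0 near the dual lattice, and no pointwise estimate can work there. The
  normalization follows from orders of magnitude: the squared multiplier is of order a^((2r+d)j),
  1/S_j contributes a^(-2rj) and the volume of a cell a^(-dj), which makes the product of order 1 at
  every scale. All these estimates are made in the variable (D^T)^j \<omega>, where the dual lattice
  is 2 pi Z^d whatever the scale; the scale then survives only as the factor a^(2rj), and one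
  lattice sum serves all fine scales. The B-splines occur at a single scale, so the constants of the
  localization condition may depend on the scale. The wavelets occur at infinitely many scales and
  need uniform constants, which only the growth of the symbol provides. Divergent sums and integrals
  have the value 0. Hence a positive lower bound on a periodization also proves its
  convergence.\<close>

definition sq_int :: "'a measure \<Rightarrow> ('a \<Rightarrow> complex) \<Rightarrow> bool" where
  "sq_int M f \<longleftrightarrow> f \<in> borel_measurable M \<and> integrable M (\<lambda>x. (cmod (f x))\<^sup>2)"

text \<open>The square root is left out so that polarization, Pythagoras and the parallelogram law
  are polynomial identities. The measure is a parameter because Lebesgue measure, its restriction to
  a cell and counting measure on Z^d are all used.\<close>

definition sq_norm :: "'a measure \<Rightarrow> ('a \<Rightarrow> complex) \<Rightarrow> real" where
  "sq_norm M f = (\<integral>x. (cmod (f x))\<^sup>2 \<partial>M)"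

definition ip :: "'a measure \<Rightarrow> ('a \<Rightarrow> complex) \<Rightarrow> ('a \<Rightarrow> complex) \<Rightarrow> complex" where
  "ip M f g = (\<integral>x. f x * cnj (g x) \<partial>M)"

lemma borel_measurable_cnj[measurable (raw)]:
  "f \<in> borel_measurable M \<Longrightarrow> (\<lambda>x. cnj (f x)) \<in> borel_measurable M"
  by (rule borel_measurable_continuous_on[OF continuous_on_cnj[OF continuous_on_id]])

lemma sq_norm_nonneg[simp]: "0 \<le> sq_norm M f"
  by (simp add: sq_norm_def)

lemma cmod_add_square_le: "(cmod (a + b))\<^sup>2 \<le> 2 * (cmod a)\<^sup>2 + 2 * (cmod b)\<^sup>2"
proof -
  have "(cmod (a + b))\<^sup>2 \<le> (cmod a + cmod b)\<^sup>2"
    by (intro power_mono norm_triangle_ineq) auto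
  also have "\<dots> \<le> 2 * (cmod a)\<^sup>2 + 2 * (cmod b)\<^sup>2"
    using sum_squares_bound[of "cmod a" "cmod b"] by (simp add: power2_sum)
  finally show ?thesis .
qed

lemma sq_int_bound:
  assumes "f \<in> borel_measurable M" "sq_int M g" "AE x in M. cmod (f x) \<le> C * cmod (g x)"
  shows "sq_int M f"
  unfolding sq_int_def
proof
  show "integrable M (\<lambda>x. (cmod (f x))\<^sup>2)"
  proof (rule Bochner_Integration.integrable_bound)
    show "integrable M (\<lambda>x. C\<^sup>2 * (cmod (g x))\<^sup>2)" using assms by (simp add: sq_int_def)
    show "AE x in M. norm ((cmod (f x))\<^sup>2) \<le> norm (C\<^sup>2 * (cmod (g x))\<^sup>2)"
      using assms(3)
    proof eventually_elim
      case (elim x)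
      then have "(cmod (f x))\<^sup>2 \<le> (C * cmod (g x))\<^sup>2" by (intro power_mono) auto
      then show ?case by (simp add: power_mult_distrib)
    qed
  qed (use assms in measurable)
qed (fact assms)

lemma sq_int_cong_AE:
  assumes "sq_int M f" "g \<in> borel_measurable M" "AE x in M. f x = g x"
  shows "sq_int M g"
  by (rule sq_int_bound[where C=1 and g=f]) (use assms in auto)

lemma sq_norm_cong_AE:
  assumes "f \<in> borel_measurable M" "g \<in> borel_measurable M" "AE x in M. f x = g x"
  shows "sq_norm M f = sq_norm M g"
  unfolding sq_norm_def by (rule integral_cong_AE) (use assms in auto)

lemma sq_int_add:
  assumes "sq_int M f" "sq_int M g" shows "sq_int M (\<lambda>x. f x + g x)"
  unfolding sq_int_def
proof
  have [measurable]: "f \<in> borel_measurable M" "g \<in> borel_measurable M" using assms by (auto simp: sq_int_def)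
  show "integrable M (\<lambda>x. (cmod (f x + g x))\<^sup>2)"
  proof (rule Bochner_Integration.integrable_bound)
    show "integrable M (\<lambda>x. 2 * (cmod (f x))\<^sup>2 + 2 * (cmod (g x))\<^sup>2)" using assms by (simp add: sq_int_def)
    show "AE x in M. norm ((cmod (f x + g x))\<^sup>2) \<le> norm (2 * (cmod (f x))\<^sup>2 + 2 * (cmod (g x))\<^sup>2)"
      using cmod_add_square_le by (auto simp: abs_of_nonneg)
  qed measurable
  show "(\<lambda>x. f x + g x) \<in> borel_measurable M" by measurable
qed

lemma sq_int_scale: "sq_int M f \<Longrightarrow> sq_int M (\<lambda>x. c * f x)"
  by (rule sq_int_bound[where C="cmod c" and g=f]) (auto simp: sq_int_def norm_mult)

lemma sq_int_uminus: "sq_int M f \<Longrightarrow> sq_int M (\<lambda>x. - f x)"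
  using sq_int_scale[of M f "-1"] by simp

lemma sq_int_diff: "sq_int M f \<Longrightarrow> sq_int M g \<Longrightarrow> sq_int M (\<lambda>x. f x - g x)"
  using sq_int_add[OF _ sq_int_uminus, of M f g] by simp

lemma sq_int_zero[simp]: "sq_int M (\<lambda>x. 0)"
  by (simp add: sq_int_def)

lemma sq_int_sum: "(\<And>i. i \<in> F \<Longrightarrow> sq_int M (f i)) \<Longrightarrow> sq_int M (\<lambda>x. \<Sum>i\<in>F. f i x)"
  by (induction F rule: infinite_finite_induct) (auto intro: sq_int_add)

lemma sq_int_cnj: "sq_int M f \<Longrightarrow> sq_int M (\<lambda>x. cnj (f x))"
  by (auto simp: sq_int_def)

lemma integrable_mult_cnj:
  assumes "sq_int M f" "sq_int M g" shows "integrable M (\<lambda>x. f x * cnj (g x))"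
proof (rule Bochner_Integration.integrable_bound)
  show "integrable M (\<lambda>x. (cmod (f x))\<^sup>2 + (cmod (g x))\<^sup>2)" using assms by (simp add: sq_int_def)
  have "cmod a * cmod b \<le> (cmod a)\<^sup>2 + (cmod b)\<^sup>2" for a b
    using sum_squares_bound[of "cmod a" "cmod b"] by (simp add: mult.assoc) (smt (verit) mult_nonneg_nonneg norm_ge_zero)
  then show "AE x in M. norm (f x * cnj (g x)) \<le> norm ((cmod (f x))\<^sup>2 + (cmod (g x))\<^sup>2)"
    by (auto simp: norm_mult abs_of_nonneg)
qed (use assms in \<open>auto simp: sq_int_def\<close>)

lemma integrable_mult_sq_int: "sq_int M f \<Longrightarrow> sq_int M g \<Longrightarrow> integrable M (\<lambda>x. f x * g x)"
  using integrable_mult_cnj[of M f "\<lambda>x. cnj (g x)"] sq_int_cnj[of M g] by simp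

lemma ip_add_left: "sq_int M f \<Longrightarrow> sq_int M g \<Longrightarrow> sq_int M h \<Longrightarrow> ip M (\<lambda>x. f x + g x) h = ip M f h + ip M g h"
  unfolding ip_def by (simp add: integrable_mult_cnj algebra_simps)

lemma ip_diff_left: "sq_int M f \<Longrightarrow> sq_int M g \<Longrightarrow> sq_int M h \<Longrightarrow> ip M (\<lambda>x. f x - g x) h = ip M f h - ip M g h"
  unfolding ip_def by (simp add: integrable_mult_cnj algebra_simps)

lemma ip_add_right: "sq_int M f \<Longrightarrow> sq_int M g \<Longrightarrow> sq_int M h \<Longrightarrow> ip M h (\<lambda>x. f x + g x) = ip M h f + ip M h g"
  unfolding ip_def by (simp add: integrable_mult_cnj algebra_simps)

lemma ip_diff_right: "sq_int M f \<Longrightarrow> sq_int M g \<Longrightarrow> sq_int M h \<Longrightarrow> ip M h (\<lambda>x. f x - g x) = ip M h f - ip M h g"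
  unfolding ip_def by (simp add: integrable_mult_cnj algebra_simps)

lemma ip_scale_left: "ip M (\<lambda>x. c * f x) h = c * ip M f h"
  unfolding ip_def by (simp add: mult.assoc)

lemma ip_scale_right: "ip M h (\<lambda>x. c * f x) = cnj c * ip M h f"
  unfolding ip_def by (simp add: mult.left_commute)

lemma ip_commute: "ip M f g = cnj (ip M g f)"
  using Bochner_Integration.integral_cnj[of M "\<lambda>x. g x * cnj (f x)"] by (simp add: ip_def mult.commute)

lemma ip_sum_right:
  "sq_int M h \<Longrightarrow> (\<And>i. i \<in> F \<Longrightarrow> sq_int M (f i)) \<Longrightarrow> ip M h (\<lambda>x. \<Sum>i\<in>F. f i x) = (\<Sum>i\<in>F. ip M h (f i))"
  by (induction F rule: infinite_finite_induct) (auto simp: ip_add_right sq_int_sum, simp_all add: ip_def)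

lemma ip_sum_left:
  "sq_int M h \<Longrightarrow> (\<And>i. i \<in> F \<Longrightarrow> sq_int M (f i)) \<Longrightarrow> ip M (\<lambda>x. \<Sum>i\<in>F. f i x) h = (\<Sum>i\<in>F. ip M (f i) h)"
  by (induction F rule: infinite_finite_induct) (auto simp: ip_add_left sq_int_sum, simp_all add: ip_def)

lemma ip_self: "ip M f f = of_real (sq_norm M f)"
proof -
  have "ip M f f = (\<integral>x. complex_of_real ((cmod (f x))\<^sup>2) \<partial>M)"
    unfolding ip_def by (simp add: complex_norm_square[symmetric] del: of_real_power)
  then show ?thesis by (simp only: integral_complex_of_real sq_norm_def)
qed

lemma sq_norm_scale: "sq_norm M (\<lambda>x. c * f x) = (cmod c)\<^sup>2 * sq_norm M f"
  unfolding sq_norm_def by (simp add: norm_mult power_mult_distrib)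

lemma sq_norm_minus_commute: "sq_norm M (\<lambda>x. f x - g x) = sq_norm M (\<lambda>x. g x - f x)"
  unfolding sq_norm_def by (simp add: norm_minus_commute)

lemma sq_norm_add:
  assumes "sq_int M f" "sq_int M g"
  shows "sq_norm M (\<lambda>x. f x + g x) = sq_norm M f + 2 * Re (ip M f g) + sq_norm M g"
proof -
  have "complex_of_real (sq_norm M (\<lambda>x. f x + g x)) = ip M f f + ip M f g + ip M g f + ip M g g"
    using assms by (simp add: ip_self[symmetric] ip_add_left ip_add_right sq_int_add)
  also have "ip M g f = cnj (ip M f g)" by (rule ip_commute)
  finally have "complex_of_real (sq_norm M (\<lambda>x. f x + g x)) = of_real (sq_norm M f + 2 * Re (ip M f g) + sq_norm M g)"
    by (simp add: ip_self complex_add_cnj algebra_simps complex_eq_iff)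
  then show ?thesis by (simp only: of_real_eq_iff)
qed

lemma sq_norm_diff:
  assumes "sq_int M f" "sq_int M g"
  shows "sq_norm M (\<lambda>x. f x - g x) = sq_norm M f - 2 * Re (ip M f g) + sq_norm M g"
  using sq_norm_add[OF assms(1) sq_int_uminus[OF assms(2)]] ip_scale_right[of M f "-1" g] sq_norm_scale[of M "-1" g]
  by simp

lemma sq_norm_add_le: "sq_int M f \<Longrightarrow> sq_int M g \<Longrightarrow> sq_norm M (\<lambda>x. f x + g x) \<le> 2 * sq_norm M f + 2 * sq_norm M g"
  using sq_norm_add[of M f g] sq_norm_diff[of M f g] sq_norm_nonneg[of M "\<lambda>x. f x - g x"] by linarith

lemma sq_norm_parallelogram:
  "sq_int M f \<Longrightarrow> sq_int M g \<Longrightarrow> sq_norm M (\<lambda>x. f x + g x) + sq_norm M (\<lambda>x. f x - g x) = 2 * sq_norm M f + 2 * sq_norm M g"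
  using sq_norm_add[of M f g] sq_norm_diff[of M f g] by linarith

lemma sq_norm_eq_0_iff:
  assumes "sq_int M f" shows "sq_norm M f = 0 \<longleftrightarrow> (AE x in M. f x = 0)"
  unfolding sq_norm_def
  by (subst integral_nonneg_eq_0_iff_AE) (use assms in \<open>auto simp: sq_int_def\<close>)

lemma ip_cauchy_schwarz:
  assumes f: "sq_int M f" and g: "sq_int M g"
  shows "(cmod (ip M f g))\<^sup>2 \<le> sq_norm M f * sq_norm M g"
proof (cases "sq_norm M g = 0")
  case True
  then have "AE x in M. g x = 0" using sq_norm_eq_0_iff[OF g] by simp
  then have "ip M f g = (\<integral>x. 0 \<partial>M)"
    unfolding ip_def by (intro integral_cong_AE) (use f g in \<open>auto simp: sq_int_def\<close>)
  then show ?thesis by simp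
next
  case False
  define G where "G = sq_norm M g"
  have G: "G > 0" using False sq_norm_nonneg[of M g] unfolding G_def by linarith
  define z where "z = ip M f g"
  \<comment> \<open>\<open>c * g\<close> is the orthogonal projection of \<open>f\<close> onto the
    line of \<open>g\<close>.\<close>
  define c where "c = z / G"
  have "0 \<le> sq_norm M (\<lambda>x. f x - c * g x)" by simp
  also have "\<dots> = sq_norm M f - 2 * Re (cnj c * z) + (cmod c)\<^sup>2 * G"
    by (subst sq_norm_diff[OF f sq_int_scale[OF g]]) (simp add: ip_scale_right sq_norm_scale z_def G_def)
  finally have "0 \<le> sq_norm M f - 2 * Re (cnj (z / G) * z) + (cmod (z / G))\<^sup>2 * G"
    unfolding c_def .
  also have "cnj (z / G) * z = of_real ((cmod z)\<^sup>2 / G)"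
    using complex_norm_square[of z] by (simp add: mult.commute)
  also have "(cmod (z / G))\<^sup>2 * G = (cmod z)\<^sup>2 / G"
    using G by (simp add: norm_divide power_divide power2_eq_square field_simps)
  finally have "(cmod z)\<^sup>2 / G \<le> sq_norm M f" by simp
  then show ?thesis using G by (simp add: z_def G_def field_simps)
qed

lemma sq_norm_sum_orthogonal:
  assumes "finite F" "\<And>i. i \<in> F \<Longrightarrow> sq_int M (f i)"
    and "\<And>i j. i \<in> F \<Longrightarrow> j \<in> F \<Longrightarrow> i \<noteq> j \<Longrightarrow> ip M (f i) (f j) = 0"
  shows "sq_norm M (\<lambda>x. \<Sum>i\<in>F. f i x) = (\<Sum>i\<in>F. sq_norm M (f i))"
  using assms
proof (induction F)
  case empty then show ?case by (simp add: sq_norm_def)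
next
  case (insert a F)
  have "ip M (f a) (\<lambda>x. \<Sum>i\<in>F. f i x) = 0"
    using insert by (subst ip_sum_right) (auto intro!: sum.neutral)
  then show ?case using insert by (simp add: sq_norm_add sq_int_sum)
qed

lemma sq_norm_eq_nn_integral:
  assumes "sq_int M f" shows "ennreal (sq_norm M f) = (\<integral>\<^sup>+x. ennreal ((cmod (f x))\<^sup>2) \<partial>M)"
  unfolding sq_norm_def using assms by (subst nn_integral_eq_integral) (auto simp: sq_int_def)

lemma sq_int_if_nn_integral:
  assumes "f \<in> borel_measurable M" "(\<integral>\<^sup>+x. ennreal ((cmod (f x))\<^sup>2) \<partial>M) < \<infinity>"
  shows "sq_int M f"
  unfolding sq_int_def using assms by (auto intro!: integrableI_nonneg)

section \<open>Subspaces spanned by a family of functions\<close>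

definition lincomb :: "('i \<Rightarrow> 'a \<Rightarrow> complex) \<Rightarrow> 'i set \<Rightarrow> ('a \<Rightarrow> complex) set" where
  "lincomb E I = {q. \<exists>F c. finite F \<and> F \<subseteq> I \<and> q = (\<lambda>x. \<Sum>k\<in>F. c k * E k x)}"

lemma lincomb_zero: "(\<lambda>x. 0) \<in> lincomb E I"
  unfolding lincomb_def by (intro CollectI exI[of _ "{}"]) simp

lemma lincomb_add:
  assumes "p \<in> lincomb E I" "q \<in> lincomb E I" shows "(\<lambda>x. p x + q x) \<in> lincomb E I"
proof -
  obtain F c where p: "finite F" "F \<subseteq> I" "p = (\<lambda>x. \<Sum>k\<in>F. c k * E k x)"
    using assms(1) by (auto simp: lincomb_def)
  obtain G d where q: "finite G" "G \<subseteq> I" "q = (\<lambda>x. \<Sum>k\<in>G. d k * E k x)"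
    using assms(2) by (auto simp: lincomb_def)
  have "p x + q x = (\<Sum>k\<in>F\<union>G. ((if k \<in> F then c k else 0) + (if k \<in> G then d k else 0)) * E k x)" for x
  proof -
    have "p x = (\<Sum>k\<in>F\<union>G. (if k \<in> F then c k else 0) * E k x)"
      unfolding p(3) using p(1) q(1) by (intro sum.mono_neutral_cong_left) auto
    moreover have "q x = (\<Sum>k\<in>F\<union>G. (if k \<in> G then d k else 0) * E k x)"
      unfolding q(3) using p(1) q(1) by (intro sum.mono_neutral_cong_left) auto
    ultimately show ?thesis by (simp only: distrib_right sum.distrib)
  qed
  then have "(\<lambda>x. p x + q x) = (\<lambda>x. \<Sum>k\<in>F\<union>G. ((if k \<in> F then c k else 0) + (if k \<in> G then d k else 0)) * E k x)"
    by (rule ext)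
  moreover have "finite (F \<union> G)" "F \<union> G \<subseteq> I" using p q by auto
  ultimately show ?thesis unfolding lincomb_def by (intro CollectI exI conjI)
qed

lemma lincomb_scale:
  assumes "q \<in> lincomb E I" shows "(\<lambda>x. c * q x) \<in> lincomb E I"
proof -
  obtain G d where "finite G" "G \<subseteq> I" "q = (\<lambda>x. \<Sum>k\<in>G. d k * E k x)"
    using assms by (auto simp: lincomb_def)
  then show ?thesis unfolding lincomb_def
    by (intro CollectI exI[of _ G] exI[of _ "\<lambda>k. c * d k"]) (simp only: sum_distrib_left mult.assoc simp_thms)
qed

lemma lincomb_sq_int:
  assumes "q \<in> lincomb E I" "\<And>i. i \<in> I \<Longrightarrow> sq_int M (E i)" shows "sq_int M q"
  using assms by (auto simp: lincomb_def intro!: sq_int_sum sq_int_scale)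

subsection \<open>Completeness and projections\<close>

text \<open>Riesz-Fischer. A fast subsequence converges almost everywhere, and Fatou's lemma carries
  the Cauchy estimate over to its pointwise limit.\<close>

lemma sq_int_complete:
  assumes u: "\<And>n. sq_int M (u n)"
    and cauchy: "\<And>e. e > 0 \<Longrightarrow> \<exists>N. \<forall>m\<ge>N. \<forall>n\<ge>N. sq_norm M (\<lambda>x. u m x - u n x) < e"
  shows "\<exists>f. sq_int M f \<and> (\<lambda>n. sq_norm M (\<lambda>x. u n x - f x)) \<longlonglongrightarrow> 0"
proof -
  have [measurable]: "u n \<in> borel_measurable M" for n using u by (auto simp: sq_int_def)
  \<comment> \<open>The rate 1/8 leaves (1/4)^k after the weight 2^k that is put on the squared
    increments below.\<close>
  have "\<exists>N. \<forall>m\<ge>N. \<forall>n\<ge>N. sq_norm M (\<lambda>x. u m x - u n x) < (1/8)^k" for k :: nat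
    by (intro cauchy) simp
  then obtain N where N: "\<And>k m n. m \<ge> N k \<Longrightarrow> n \<ge> N k \<Longrightarrow> sq_norm M (\<lambda>x. u m x - u n x) < (1/8)^k" by metis
  \<comment> \<open>The partial sums make \<open>r\<close> increase and dominate every
    \<open>N k\<close>; the summand \<open>k\<close> makes it tend to infinity.\<close>
  define r where "r k = k + (\<Sum>i\<le>k. N i)" for k
  have r: "r k \<ge> N k" "r k \<ge> k" "r (Suc k) \<ge> r k" for k
    unfolding r_def by (auto simp: member_le_sum trans_le_add2)
  have r2: "r (Suc k) \<ge> N k" for k using r by (meson order_trans)
  define d where "d k x = cmod (u (r (Suc k)) x - u (r k) x)" for k x
  have [measurable]: "d k \<in> borel_measurable M" for k unfolding d_def by measurable
  have "(\<integral>\<^sup>+x. (\<Sum>k. ennreal (2^k * (d k x)\<^sup>2)) \<partial>M) = (\<Sum>k. \<integral>\<^sup>+x. ennreal (2^k * (d k x)\<^sup>2) \<partial>M)"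
    by (intro nn_integral_suminf) measurable
  also have "\<dots> \<le> (\<Sum>k. ennreal ((1/4)^k))"
  proof (intro suminf_le)
    fix k
    have "(\<integral>\<^sup>+x. ennreal (2^k * (d k x)\<^sup>2) \<partial>M) = ennreal (2^k) * ennreal (sq_norm M (\<lambda>x. u (r (Suc k)) x - u (r k) x))"
      unfolding d_def by (subst sq_norm_eq_nn_integral)
        (auto intro!: sq_int_diff u simp: ennreal_mult nn_integral_cmult)
    also have "\<dots> \<le> ennreal (2^k) * ennreal ((1/8)^k)"
      by (intro mult_left_mono ennreal_leI) (use N[OF r2 r(1), of k] in \<open>auto simp: less_imp_le\<close>)
    also have "\<dots> = ennreal ((1/4)^k)"
      by (subst ennreal_mult[symmetric]) (auto simp: power_mult_distrib[symmetric])
    finally show "(\<integral>\<^sup>+x. ennreal (2^k * (d k x)\<^sup>2) \<partial>M) \<le> ennreal ((1/4)^k)" .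
  qed auto
  also have "\<dots> < \<infinity>"
    by (subst suminf_ennreal2) (auto intro: summable_geometric)
  finally have "AE x in M. (\<Sum>k. ennreal (2^k * (d k x)\<^sup>2)) \<noteq> \<infinity>"
    by (intro nn_integral_PInf_AE) auto
  then have conv: "AE x in M. convergent (\<lambda>k. u (r k) x)"
  proof eventually_elim
    case (elim x)
    then have "summable (\<lambda>k. 2^k * (d k x)\<^sup>2)"
      by (intro summable_suminf_not_top) auto
    then have "summable (\<lambda>k. 2^k * (d k x)\<^sup>2 + (1/2)^k)"
      by (intro summable_add summable_geometric) auto
    then have "summable (\<lambda>k. u (r (Suc k)) x - u (r k) x)"
    proof (rule summable_comparison_test'[where N=0])
      fix k :: nat
      \<comment> \<open>This square yields 2 d \<le> 2^k d^2 + 2^(-k). Summability of the weighted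
        squares thus gives absolute convergence of the telescoping series at \<open>x\<close>,
        without a triangle inequality for the norm.\<close>
      have "0 \<le> (1/2)^k * (2^k * d k x - 1)\<^sup>2" by simp
      also have "\<dots> = 2^k * (d k x)\<^sup>2 + (1/2)^k - 2 * d k x"
        by (simp add: power2_eq_square field_simps power_one_over)
      finally have "2 * d k x \<le> 2^k * (d k x)\<^sup>2 + (1/2)^k" by simp
      moreover have "d k x \<ge> 0" by (simp add: d_def)
      ultimately show "norm (u (r (Suc k)) x - u (r k) x) \<le> 2^k * (d k x)\<^sup>2 + (1/2)^k"
        unfolding d_def by linarith
    qed
    then have "convergent (\<lambda>n. \<Sum>k<n. u (r (Suc k)) x - u (r k) x)"
      by (simp add: summable_iff_convergent)
    then have "convergent (\<lambda>n. u (r n) x - u (r 0) x)" 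
      by (simp add: sum_lessThan_telescope[of "\<lambda>k. u (r k) x"])
    then have "convergent (\<lambda>n. (u (r n) x - u (r 0) x) + u (r 0) x)"
      by (intro convergent_add convergent_const)
    then show ?case by simp
  qed
  define f where "f x = lim (\<lambda>k. u (r k) x)" for x
  have [measurable]: "f \<in> borel_measurable M" unfolding f_def by measurable
  have lim: "AE x in M. (\<lambda>k. u (r k) x) \<longlonglongrightarrow> f x"
    using conv by eventually_elim (simp add: f_def convergent_LIMSEQ_iff)
  \<comment> \<open>A bound for \<open>m \<ge> K\<close> is enough, because
    \<open>r k \<ge> k\<close> puts all but finitely many members of the subsequence beyond
    \<open>K\<close>.\<close>
  have fatou: "(\<integral>\<^sup>+x. ennreal ((cmod (u n x - f x))\<^sup>2) \<partial>M) \<le> ennreal e"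
    if "\<And>m. m \<ge> K \<Longrightarrow> sq_norm M (\<lambda>x. u n x - u m x) \<le> e" for n K e
  proof -
    have "(\<integral>\<^sup>+x. ennreal ((cmod (u n x - f x))\<^sup>2) \<partial>M)
        = (\<integral>\<^sup>+x. liminf (\<lambda>k. ennreal ((cmod (u n x - u (r k) x))\<^sup>2)) \<partial>M)"
    proof (intro nn_integral_cong_AE)
      show "AE x in M. ennreal ((cmod (u n x - f x))\<^sup>2) = liminf (\<lambda>k. ennreal ((cmod (u n x - u (r k) x))\<^sup>2))"
        using lim
      proof eventually_elim
        case (elim x)
        then have "(\<lambda>k. ennreal ((cmod (u n x - u (r k) x))\<^sup>2)) \<longlonglongrightarrow> ennreal ((cmod (u n x - f x))\<^sup>2)"
          by (intro tendsto_intros)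
        then show ?case by (intro lim_imp_Liminf[symmetric] sequentially_bot)
      qed
    qed
    also have "\<dots> \<le> liminf (\<lambda>k. \<integral>\<^sup>+x. ennreal ((cmod (u n x - u (r k) x))\<^sup>2) \<partial>M)"
      by (rule nn_integral_liminf) measurable
    also have "\<dots> = liminf (\<lambda>k. ennreal (sq_norm M (\<lambda>x. u n x - u (r k) x)))"
      by (simp add: sq_norm_eq_nn_integral sq_int_diff u)
    also have "\<dots> \<le> ennreal e"
    proof -
      have "eventually (\<lambda>k. ennreal (sq_norm M (\<lambda>x. u n x - u (r k) x)) \<le> ennreal e) sequentially"
        using r(2) that by (intro eventually_sequentiallyI[of K] ennreal_leI) (meson order_trans)
      then have "liminf (\<lambda>k. ennreal (sq_norm M (\<lambda>x. u n x - u (r k) x))) \<le> liminf (\<lambda>k. ennreal e)"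
        by (rule Liminf_mono)
      then show ?thesis by (simp add: Liminf_const)
    qed
    finally show ?thesis .
  qed
  obtain K where K: "\<And>m n. m \<ge> K \<Longrightarrow> n \<ge> K \<Longrightarrow> sq_norm M (\<lambda>x. u m x - u n x) < 1"
    using cauchy[of 1] by auto
  have "(\<integral>\<^sup>+x. ennreal ((cmod (u K x - f x))\<^sup>2) \<partial>M) \<le> ennreal 1"
    by (rule fatou[of K]) (use K in \<open>auto simp: less_imp_le\<close>)
  also have "\<dots> < \<infinity>" by simp
  finally have "sq_int M (\<lambda>x. u K x - f x)" by (intro sq_int_if_nn_integral) auto
  from sq_int_diff[OF u this, of K] have f: "sq_int M f" by simp
  have "(\<lambda>n. sq_norm M (\<lambda>x. u n x - f x)) \<longlonglongrightarrow> 0"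
  proof (rule LIMSEQ_I)
    fix e :: real assume e: "e > 0"
    then obtain K where K: "\<And>m n. m \<ge> K \<Longrightarrow> n \<ge> K \<Longrightarrow> sq_norm M (\<lambda>x. u m x - u n x) < e/2"
      using cauchy[of "e/2"] by auto
    have "ennreal (sq_norm M (\<lambda>x. u n x - f x)) \<le> ennreal (e/2)" if "n \<ge> K" for n
      by (subst sq_norm_eq_nn_integral, intro sq_int_diff u f, rule fatou[of K])
        (use K that in \<open>auto simp: less_imp_le\<close>)
    then have "norm (sq_norm M (\<lambda>x. u n x - f x) - 0) < e" if "n \<ge> K" for n
      using that e by (fastforce simp: ennreal_le_iff2)
    then show "\<exists>no. \<forall>n\<ge>no. norm (sq_norm M (\<lambda>x. u n x - f x) - 0) < e" by blast
  qed
  with f show ?thesis by blast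
qed

lemma ip_tendsto:
  assumes "\<And>n. sq_int M (u n)" "sq_int M f" "sq_int M g" "(\<lambda>n. sq_norm M (\<lambda>x. u n x - f x)) \<longlonglongrightarrow> 0"
  shows "(\<lambda>n. ip M (u n) g) \<longlonglongrightarrow> ip M f g"
proof -
  have "(\<lambda>n. (cmod (ip M (u n) g - ip M f g))\<^sup>2) \<longlonglongrightarrow> 0"
  proof (rule tendsto_sandwich[where f="\<lambda>_. 0" and h="\<lambda>n. sq_norm M (\<lambda>x. u n x - f x) * sq_norm M g"])
    have "(\<lambda>n. sq_norm M (\<lambda>x. u n x - f x) * sq_norm M g) \<longlonglongrightarrow> 0 * sq_norm M g"
      by (intro tendsto_intros assms)
    then show "(\<lambda>n. sq_norm M (\<lambda>x. u n x - f x) * sq_norm M g) \<longlonglongrightarrow> 0" by simp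
    have "(cmod (ip M (u n) g - ip M f g))\<^sup>2 \<le> sq_norm M (\<lambda>x. u n x - f x) * sq_norm M g" for n
      using ip_cauchy_schwarz[of M "\<lambda>x. u n x - f x" g] assms by (simp add: ip_diff_left sq_int_diff)
    then show "\<forall>\<^sub>F n in sequentially. (cmod (ip M (u n) g - ip M f g))\<^sup>2 \<le> sq_norm M (\<lambda>x. u n x - f x) * sq_norm M g"
      by simp
  qed auto
  then have "(\<lambda>n. sqrt ((cmod (ip M (u n) g - ip M f g))\<^sup>2)) \<longlonglongrightarrow> sqrt 0"
    by (rule tendsto_real_sqrt)
  then have "(\<lambda>n. ip M (u n) g - ip M f g) \<longlonglongrightarrow> 0" by (simp add: tendsto_norm_zero_iff)
  then show ?thesis by (simp add: LIM_zero_iff)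
qed

lemma sq_norm_tendsto:
  assumes "\<And>n. sq_int M (u n)" "sq_int M f" "(\<lambda>n. sq_norm M (\<lambda>x. u n x - f x)) \<longlonglongrightarrow> 0"
  shows "(\<lambda>n. sq_norm M (u n)) \<longlonglongrightarrow> sq_norm M f"
proof -
  have "sq_norm M (u n) = sq_norm M (\<lambda>x. u n x - f x) + 2 * Re (ip M (u n) f) - sq_norm M f" for n
    using assms by (simp add: sq_norm_diff)
  moreover have "(\<lambda>n. sq_norm M (\<lambda>x. u n x - f x) + 2 * Re (ip M (u n) f) - sq_norm M f) \<longlonglongrightarrow>
      0 + 2 * Re (ip M f f) - sq_norm M f"
    by (intro tendsto_intros assms ip_tendsto)
  ultimately show ?thesis by (simp add: ip_self)
qed

text \<open>The projection theorem, applied to residuals: for a minimizing sequence in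
  \<open>S\<close> the residuals are Cauchy by the parallelogram law, and their limit is orthogonal
  to \<open>S\<close> because no direction in \<open>S\<close> shortens it. Working with residuals
  avoids passing to the closure of \<open>S\<close>.\<close>

lemma exists_orthogonal_if_not_dense:
  assumes S: "\<And>s. s \<in> S \<Longrightarrow> sq_int M s" "(\<lambda>x. 0) \<in> S"
    and add: "\<And>s t. s \<in> S \<Longrightarrow> t \<in> S \<Longrightarrow> (\<lambda>x. s x + t x) \<in> S"
    and scale: "\<And>c s. s \<in> S \<Longrightarrow> (\<lambda>x. c * s x) \<in> S"
    and f: "sq_int M f" and \<delta>: "\<delta> > 0" "\<And>s. s \<in> S \<Longrightarrow> sq_norm M (\<lambda>x. f x - s x) \<ge> \<delta>"
  shows "\<exists>g. sq_int M g \<and> sq_norm M g > 0 \<and> (\<forall>s\<in>S. ip M g s = 0)"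
proof -
  define d where "d = (INF s\<in>S. sq_norm M (\<lambda>x. f x - s x))"
  have bdd: "bdd_below ((\<lambda>s. sq_norm M (\<lambda>x. f x - s x)) ` S)"
    by (rule bdd_belowI[of _ 0]) auto
  have d: "d \<le> sq_norm M (\<lambda>x. f x - s x)" if "s \<in> S" for s
    unfolding d_def using that bdd by (intro cINF_lower) auto
  have "\<exists>s\<in>S. sq_norm M (\<lambda>x. f x - s x) < d + 1 / real (Suc n)" for n
  proof -
    have "Inf ((\<lambda>s. sq_norm M (\<lambda>x. f x - s x)) ` S) < d + 1 / real (Suc n)"
      unfolding d_def[symmetric] by simp
    then show ?thesis using cInf_lessD[of "(\<lambda>s. sq_norm M (\<lambda>x. f x - s x)) ` S"] S(2) by blast
  qed
  then obtain s where s: "\<And>n. s n \<in> S" "\<And>n. sq_norm M (\<lambda>x. f x - s n x) < d + 1 / real (Suc n)"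
    by metis
  define u where "u n x = f x - s n x" for n x
  have u: "sq_int M (u n)" for n unfolding u_def using f S s by (intro sq_int_diff) auto
  have par: "sq_norm M (\<lambda>x. u m x - u n x) \<le> 2 / real (Suc m) + 2 / real (Suc n)" for m n
  proof -
    \<comment> \<open>The midpoint lies in \<open>S\<close>, so the mean of two residuals has
      squared norm at least \<open>d\<close>.\<close>
    have "(\<lambda>x. (1/2) * (s m x + s n x)) \<in> S" 
      by (rule scale[OF add[OF s(1) s(1)]])
    from d[OF this] have "d \<le> sq_norm M (\<lambda>x. (1/2) * (u m x + u n x))"
      unfolding u_def by (simp add: algebra_simps)
    also have "\<dots> = sq_norm M (\<lambda>x. u m x + u n x) / 4" by (subst sq_norm_scale) (simp add: power2_eq_square)
    finally have "4 * d \<le> sq_norm M (\<lambda>x. u m x + u n x)" by simp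
    moreover have "sq_norm M (u m) < d + 1 / real (Suc m)" "sq_norm M (u n) < d + 1 / real (Suc n)"
      using s(2) unfolding u_def by auto
    moreover have "2 / real (Suc m) = 2 * (1 / real (Suc m))" "2 / real (Suc n) = 2 * (1 / real (Suc n))"
      by simp_all
    ultimately show ?thesis using sq_norm_parallelogram[OF u u, of m n] by linarith
  qed
  have "\<exists>g. sq_int M g \<and> (\<lambda>n. sq_norm M (\<lambda>x. u n x - g x)) \<longlonglongrightarrow> 0"
  proof (rule sq_int_complete[OF u])
    fix e :: real assume "e > 0"
    then obtain N where N: "inverse (real (Suc N)) < e/4" using reals_Archimedean[of "e/4"] by auto
    have "sq_norm M (\<lambda>x. u m x - u n x) < e" if "m \<ge> N" "n \<ge> N" for m n
    proof -
      have "1 / real (Suc m) \<le> 1 / real (Suc N)" "1 / real (Suc n) \<le> 1 / real (Suc N)"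
        using that by (auto intro!: divide_left_mono)
      then show ?thesis using par[of m n] N by (simp add: inverse_eq_divide)
    qed
    then show "\<exists>N. \<forall>m\<ge>N. \<forall>n\<ge>N. sq_norm M (\<lambda>x. u m x - u n x) < e" by blast
  qed
  then obtain g where g: "sq_int M g" and lim: "(\<lambda>n. sq_norm M (\<lambda>x. u n x - g x)) \<longlonglongrightarrow> 0" by blast
  have "(\<lambda>n. sq_norm M (u n)) \<longlonglongrightarrow> sq_norm M g" by (rule sq_norm_tendsto[OF u g lim])
  moreover have "sq_norm M (u n) \<ge> \<delta>" for n unfolding u_def using \<delta> s by auto
  ultimately have "sq_norm M g \<ge> \<delta>" by (intro LIMSEQ_le_const[of _ _ \<delta>]) auto
  moreover have "ip M g t = 0" if t: "t \<in> S" for t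
  proof -
    define z where "z = ip M g t"
    define G where "G = sq_norm M t"
    have tq: "sq_int M t" using t S by simp
    have ge: "0 \<le> 2 * Re (cnj c * z) + (cmod c)\<^sup>2 * G" for c
    proof -
      have "0 \<le> 1 / real (Suc n) + (2 * Re (cnj c * ip M (u n) t) + (cmod c)\<^sup>2 * G)" for n
      proof -
        have "(\<lambda>x. s n x + (-c) * t x) \<in> S" using s t add scale[OF t, of "-c"] by blast
        from d[OF this] have "d \<le> sq_norm M (\<lambda>x. u n x + c * t x)" unfolding u_def by (simp add: algebra_simps)
        also have "\<dots> = sq_norm M (u n) + 2 * Re (cnj c * ip M (u n) t) + (cmod c)\<^sup>2 * G"
          by (subst sq_norm_add[OF u sq_int_scale[OF tq]]) (simp add: ip_scale_right sq_norm_scale G_def)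
        finally show ?thesis using s(2)[of n] unfolding u_def by simp
      qed
      moreover have "(\<lambda>n. 1 / real (Suc n) + (2 * Re (cnj c * ip M (u n) t) + (cmod c)\<^sup>2 * G)) \<longlonglongrightarrow>
          0 + (2 * Re (cnj c * z) + (cmod c)\<^sup>2 * G)"
        unfolding z_def by (intro tendsto_add LIMSEQ_Suc[OF lim_1_over_n] tendsto_mult tendsto_const
            tendsto_Re ip_tendsto[OF u g tq lim])
      ultimately show ?thesis by (intro LIMSEQ_le_const[of _ _ 0]) auto
    qed
    have G0: "G \<ge> 0" by (simp add: G_def)
    \<comment> \<open>The linear term must win over the quadratic one, which holds as soon as 0 <
      \<tau> and \<tau> G < 2; adding 1 keeps the quotient defined when \<open>t\<close> has norm
      0.\<close>
    define \<tau> where "\<tau> = 1 / (G + 1)"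
    have "0 \<le> 2 * Re (cnj (- of_real \<tau> * z) * z) + (cmod (- of_real \<tau> * z))\<^sup>2 * G" by (rule ge)
    also have "cnj (- of_real \<tau> * z) * z = of_real (- \<tau> * (cmod z)\<^sup>2)"
      using complex_norm_square[of z] by (simp add: mult.commute)
    also have "2 * Re (of_real (- \<tau> * (cmod z)\<^sup>2)) + (cmod (- of_real \<tau> * z))\<^sup>2 * G
        = (cmod z)\<^sup>2 * \<tau> * (\<tau> * G - 2)"
      by (simp add: norm_mult power_mult_distrib algebra_simps power2_eq_square)
    finally have "0 \<le> (cmod z)\<^sup>2 * \<tau> * (\<tau> * G - 2)" .
    moreover have "\<tau> > 0" "\<tau> * G - 2 < 0" using G0 by (auto simp: \<tau>_def field_simps)
    ultimately have "(cmod z)\<^sup>2 \<le> 0" by (auto simp: zero_le_mult_iff mult_le_0_iff)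
    then show ?thesis by (simp add: z_def)
  qed
  ultimately show ?thesis using g \<delta>(1) by force
qed

section \<open>Preliminaries on sums and on Lebesgue measure\<close>

lemma nn_integral_count_space_infsum:
  fixes f :: "'a \<Rightarrow> real"
  assumes "f summable_on UNIV" "\<And>k. f k \<ge> 0"
  shows "(\<integral>\<^sup>+k. ennreal (f k) \<partial>count_space UNIV) = ennreal (infsum f UNIV)"
proof -
  have "Infinite_Set_Sum.abs_summable_on f UNIV"
    using assms by (subst abs_summable_equivalent[symmetric]) (simp add: summable_on_iff_abs_summable_on_real[symmetric])
  then show ?thesis using assms by (simp add: nn_integral_conv_infsetsum infsetsum_infsum)
qed

lemma nn_integral_count_space_le:
  fixes f :: "'a \<Rightarrow> real"
  assumes "\<And>F. finite F \<Longrightarrow> (\<Sum>k\<in>F. f k) \<le> B" "\<And>k. f k \<ge> 0"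
  shows "(\<integral>\<^sup>+k. ennreal (f k) \<partial>count_space UNIV) \<le> ennreal B"
proof -
  have "f summable_on UNIV"
    using assms by (intro nonneg_bdd_above_summable_on bdd_aboveI2[where M=B]) auto
  then show ?thesis
    using assms by (simp add: nn_integral_count_space_infsum ennreal_leI infsum_le_finite_sums)
qed

lemma sum_le_nn_integral_count_space:
  fixes f :: "'a \<Rightarrow> ennreal"
  assumes "finite F"
  shows "(\<Sum>k\<in>F. f k) \<le> (\<integral>\<^sup>+k. f k \<partial>count_space UNIV)"
proof -
  have "(\<Sum>k\<in>F. f k) = (\<integral>\<^sup>+k. f k * indicator F k \<partial>count_space UNIV)"
    using assms by (subst nn_integral_count_space'[of F]) auto
  also have "\<dots> \<le> (\<integral>\<^sup>+k. f k \<partial>count_space UNIV)"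
    by (intro nn_integral_mono) (auto split: split_indicator)
  finally show ?thesis .
qed

section \<open>Translation invariance of Lebesgue measure\<close>

lemma lebesgue_translation:
  fixes t :: "'a::euclidean_space"
  shows lebesgue_translation_measurable: "(\<lambda>x. x + t) \<in> lebesgue \<rightarrow>\<^sub>M lebesgue"
    and lebesgue_translation_distr: "distr lebesgue lebesgue (\<lambda>x. x + t) = lebesgue"
proof -
  have eq: "(\<lambda>x. t + (\<Sum>j\<in>Basis. (1 * (x \<bullet> j)) *\<^sub>R j)) = (\<lambda>x. x + t)"
    by (simp add: euclidean_representation add.commute)
  show "(\<lambda>x. x + t) \<in> lebesgue \<rightarrow>\<^sub>M lebesgue"
    using lebesgue_affine_measurable[of "\<lambda>_. 1" t] unfolding eq by simp
  show "distr lebesgue lebesgue (\<lambda>x. x + t) = lebesgue"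
    using lebesgue_affine_euclidean[of "\<lambda>_. 1" t] unfolding eq by (simp add: density_1)
qed

lemma borel_measurable_translation:
  fixes f :: "'a::euclidean_space \<Rightarrow> 'b::topological_space"
  shows "f \<in> borel_measurable lebesgue \<Longrightarrow> (\<lambda>x. f (x + t)) \<in> borel_measurable lebesgue"
  by (rule measurable_compose[OF lebesgue_translation_measurable])

lemma nn_integral_translation:
  fixes f :: "'a::euclidean_space \<Rightarrow> ennreal"
  assumes "f \<in> borel_measurable lebesgue"
  shows "(\<integral>\<^sup>+x. f (x + t) \<partial>lebesgue) = (\<integral>\<^sup>+x. f x \<partial>lebesgue)"
proof -
  have "(\<integral>\<^sup>+x. f x \<partial>lebesgue) = (\<integral>\<^sup>+x. f x \<partial>distr lebesgue lebesgue (\<lambda>x. x + t))"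
    by (simp only: lebesgue_translation_distr)
  also have "\<dots> = (\<integral>\<^sup>+x. f (x + t) \<partial>lebesgue)"
    using assms by (intro nn_integral_distr lebesgue_translation_measurable) auto
  finally show ?thesis ..
qed

lemma integral_translation:
  fixes f :: "'a::euclidean_space \<Rightarrow> 'b::{banach, second_countable_topology}"
  assumes "f \<in> borel_measurable lebesgue"
  shows "(\<integral>x. f (x + t) \<partial>lebesgue) = (\<integral>x. f x \<partial>lebesgue)"
proof -
  have "(\<integral>x. f x \<partial>lebesgue) = (\<integral>x. f x \<partial>distr lebesgue lebesgue (\<lambda>x. x + t))"
    by (simp only: lebesgue_translation_distr)
  also have "\<dots> = (\<integral>x. f (x + t) \<partial>lebesgue)"
    using assms by (intro integral_distr lebesgue_translation_measurable)
  finally show ?thesis ..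
qed

lemma AE_translation:
  fixes t :: "'a::euclidean_space"
  assumes "AE x in lebesgue. P x" shows "AE x in lebesgue. P (x + t)"
proof -
  have "AE x in distr lebesgue lebesgue (\<lambda>x. x + t). P x"
    using assms by (simp only: lebesgue_translation_distr)
  from AE_distrD[OF lebesgue_translation_measurable this] show ?thesis .
qed

lemma sigma_finite_lebesgue: "sigma_finite_measure (lebesgue :: 'a::euclidean_space measure)"
proof
  let ?A = "range (\<lambda>n. cball (0::'a) (real n))"
  have "x \<in> \<Union>?A" for x :: 'a using real_arch_simple[of "norm x"] by auto
  moreover have fin: "emeasure lborel (cball (0::'a) (real n)) \<noteq> top" for n
    using emeasure_lborel_cball_finite[of "0::'a" "real n"] by (auto simp: less_top[symmetric])
  ultimately show "\<exists>A. countable A \<and> A \<subseteq> sets lebesgue \<and> \<Union>A = space lebesgue \<and> (\<forall>a\<in>A. emeasure (lebesgue :: 'a measure) a \<noteq> \<infinity>)"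
    by (intro exI[of _ ?A]) (auto simp: fin)
qed

lemma of_int_vec_add[simp]: "of_int_vec (k + l) = of_int_vec k + of_int_vec l"
  and of_int_vec_diff[simp]: "of_int_vec (k - l) = of_int_vec k - of_int_vec l"
  and of_int_vec_uminus[simp]: "of_int_vec (- k) = - of_int_vec k"
  and of_int_vec_0[simp]: "of_int_vec 0 = 0"
  and of_int_vec_nth[simp]: "of_int_vec k $ i = of_int (k $ i)"
  by (simp_all add: of_int_vec_def vec_eq_iff)

lemma of_int_vec_eq_iff[simp]: "of_int_vec k = of_int_vec l \<longleftrightarrow> k = l"
  by (simp add: vec_eq_iff)

lemma of_int_vec_inner_int: "\<exists>n::int. of_int_vec k \<bullet> of_int_vec l = of_int n"
  by (rule exI[of _ "\<Sum>i\<in>UNIV. k $ i * l $ i"]) (simp add: inner_vec_def)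

lemma cis_2pi_int: "cis (2 * pi * of_int n) = 1"
  by (simp add: cis.ctr complex_eq_iff cos_int_2pin sin_int_2pin)

section \<open>Lattices and Fourier series\<close>

text \<open>The matrix \<open>M\<close> turns the lattice \<open>2 \<pi> N \<int>\<^sup>d\<close> into the standard one, so that
  \<open>cell\<close> is a fundamental domain and the functions \<open>chr k\<close> are the characters of the quotient.\<close>

locale lattice_torus =
  fixes M N :: "real^'d^'d"
  assumes MN: "M ** N = mat 1"
begin

lemma NM: "N ** M = mat 1" using MN by (simp add: matrix_left_right_inverse)

lemma M_N[simp]: "M *v (N *v x) = x" and N_M[simp]: "N *v (M *v x) = x"
  using MN NM by (simp_all add: matrix_vector_mul_assoc)

definition cell :: "(real^'d) set" where
  "cell = {x. \<forall>i. - pi \<le> (M *v x) $ i \<and> (M *v x) $ i < pi}"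

definition dual_pt :: "int^'d \<Rightarrow> real^'d" where
  "dual_pt k = (2 * pi) *\<^sub>R (N *v of_int_vec k)"

definition chr :: "int^'d \<Rightarrow> real^'d \<Rightarrow> complex" where
  "chr k x = cis ((M *v x) \<bullet> of_int_vec k)"

abbreviation T :: "(real^'d) measure" where "T \<equiv> lebesgue_on cell"

definition periodic :: "(real^'d \<Rightarrow> 'b) \<Rightarrow> bool" where
  "periodic g \<longleftrightarrow> (\<forall>x k. g (x + dual_pt k) = g x)"

lemma periodicD: "periodic g \<Longrightarrow> g (x + dual_pt k) = g x"
  by (simp add: periodic_def)

lemma dual_pt_add: "dual_pt (k + l) = dual_pt k + dual_pt l" and dual_pt_uminus: "dual_pt (- k) = - dual_pt k" and dual_pt_0[simp]: "dual_pt 0 = 0"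
  by (simp_all add: dual_pt_def matrix_vector_right_distrib scaleR_add_right linear_neg[OF matrix_vector_mul_linear])

lemma M_dual_pt: "M *v dual_pt k = (2 * pi) *\<^sub>R of_int_vec k"
  by (simp add: dual_pt_def matrix_vector_mult_scaleR)

lemma continuous_on_M[continuous_intros]: "continuous_on S ((*v) M)"
  by (intro linear_continuous_on matrix_vector_mul_bounded_linear)

lemma cell_sets[measurable, simp]: "cell \<in> sets lebesgue" "cell \<in> sets borel"
proof -
  have "(\<lambda>x. (M *v x) $ i) \<in> borel_measurable borel" for i
    by (intro borel_measurable_continuous_onI continuous_intros)
  then have [measurable]: "(\<lambda>x. (M *v x) $ i) \<in> borel_measurable borel" for i .
  show "cell \<in> sets borel" unfolding cell_def by measurable
  then show "cell \<in> sets lebesgue" by auto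
qed

text \<open>The half-open cell is a fundamental domain: in each coordinate of \<open>M *v x\<close>
  the admissible integer is forced to be a floor.\<close>

lemma ex1_cell_minus: "\<exists>!k. x - dual_pt k \<in> cell"
proof -
  have iff: "x - dual_pt k \<in> cell \<longleftrightarrow> (\<forall>i. k $ i = \<lfloor>((M *v x) $ i + pi) / (2 * pi)\<rfloor>)" for k
  proof -
    have "(- pi \<le> (M *v x) $ i - 2 * pi * of_int m \<and> (M *v x) $ i - 2 * pi * of_int m < pi)
        \<longleftrightarrow> m = \<lfloor>((M *v x) $ i + pi) / (2 * pi)\<rfloor>" for i m
      by (auto simp: eq_commute[of m] floor_eq_iff field_simps)
    then show ?thesis by (simp add: cell_def matrix_vector_mult_diff_distrib M_dual_pt)
  qed
  show ?thesis
    by (rule ex1I[of _ "\<chi> i. \<lfloor>((M *v x) $ i + pi) / (2 * pi)\<rfloor>"]) (auto simp: iff vec_eq_iff)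
qed

lemma ex1_cell_plus: "\<exists>!k. x + dual_pt k \<in> cell"
proof -
  obtain k where k: "x - dual_pt k \<in> cell" "\<And>l. x - dual_pt l \<in> cell \<Longrightarrow> l = k" using ex1_cell_minus by blast
  have "l = - k" if "x + dual_pt l \<in> cell" for l
    using k(2)[of "- l"] that by (auto simp: dual_pt_uminus)
  then show ?thesis using k(1) by (intro ex1I[of _ "-k"]) (auto simp: dual_pt_uminus)
qed

text \<open>A partition of unity by translated cells, to be inserted under an integral. The variant
  with a plus sign serves sums over the orbit of a fixed point.\<close>

lemma nn_sum_cell_minus: "(\<integral>\<^sup>+k. c * indicator cell (x - dual_pt k) \<partial>count_space UNIV) = (c::ennreal)"
proof -
  obtain k where k: "x - dual_pt k \<in> cell" "\<And>l. x - dual_pt l \<in> cell \<Longrightarrow> l = k" using ex1_cell_minus by blast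
  have ind: "indicator cell (x - dual_pt l) = (if l = k then 1 else 0 :: ennreal)" for l
    using k by (metis indicator_simps)
  have "(\<integral>\<^sup>+k. c * indicator cell (x - dual_pt k) \<partial>count_space UNIV)
      = (\<Sum>k\<in>{k}. c * indicator cell (x - dual_pt k))"
    by (rule nn_integral_count_space') (simp_all add: ind)
  then show ?thesis using k(1) by simp
qed

lemma nn_sum_cell_plus: "(\<integral>\<^sup>+k. c * indicator cell (x + dual_pt k) \<partial>count_space UNIV) = (c::ennreal)"
proof -
  obtain k where k: "x + dual_pt k \<in> cell" "\<And>l. x + dual_pt l \<in> cell \<Longrightarrow> l = k" using ex1_cell_plus by blast
  have ind: "indicator cell (x + dual_pt l) = (if l = k then 1 else 0 :: ennreal)" for l
    using k by (metis indicator_simps)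
  have "(\<integral>\<^sup>+k. c * indicator cell (x + dual_pt k) \<partial>count_space UNIV)
      = (\<Sum>k\<in>{k}. c * indicator cell (x + dual_pt k))"
    by (rule nn_integral_count_space') (simp_all add: ind)
  then show ?thesis using k(1) by simp
qed

lemma measurable_shift_indicator[measurable]:
  "(\<lambda>x. indicator cell (x + t) :: 'b::{zero_neq_one, topological_space}) \<in> borel_measurable lebesgue"
  by (rule borel_measurable_translation[of "indicator cell"]) simp

lemma measurable_shift_indicator'[measurable]:
  "(\<lambda>x. indicator cell (x - t) :: 'b::{zero_neq_one, topological_space}) \<in> borel_measurable lebesgue"
  using measurable_shift_indicator[of "-t"] by simp

text \<open>Tonelli, after the partition of unity has cut space into cells and each piece has been
  translated back to the base cell.\<close>

lemma nn_integral_unfold: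
  fixes f :: "real^'d \<Rightarrow> ennreal"
  assumes [measurable]: "f \<in> borel_measurable lebesgue"
  shows "(\<integral>\<^sup>+x. f x \<partial>lebesgue) = (\<integral>\<^sup>+x. (\<integral>\<^sup>+k. f (x + dual_pt k) \<partial>count_space UNIV) \<partial>T)"
proof -
  have [measurable]: "(\<lambda>x. f (x + dual_pt k)) \<in> borel_measurable lebesgue" for k
    by (rule borel_measurable_translation) fact
  have "(\<integral>\<^sup>+x. f x \<partial>lebesgue)
      = (\<integral>\<^sup>+x. (\<integral>\<^sup>+k. f x * indicator cell (x - dual_pt k) \<partial>count_space UNIV) \<partial>lebesgue)"
    by (simp only: nn_sum_cell_minus)
  also have "\<dots> = (\<integral>\<^sup>+k. (\<integral>\<^sup>+x. f x * indicator cell (x - dual_pt k) \<partial>lebesgue) \<partial>count_space UNIV)"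
    by (rule nn_integral_count_space_nn_integral) auto
  also have "\<dots> = (\<integral>\<^sup>+k. (\<integral>\<^sup>+x. f (x + dual_pt k) * indicator cell x \<partial>lebesgue) \<partial>count_space UNIV)"
    using nn_integral_translation[of "\<lambda>x. f x * indicator cell (x - dual_pt k)" "dual_pt k" for k] by simp
  also have "\<dots> = (\<integral>\<^sup>+k. (\<integral>\<^sup>+x. f (x + dual_pt k) \<partial>T) \<partial>count_space UNIV)"
    by (simp add: nn_integral_restrict_space)
  also have "\<dots> = (\<integral>\<^sup>+x. (\<integral>\<^sup>+k. f (x + dual_pt k) \<partial>count_space UNIV) \<partial>T)"
    by (rule nn_integral_count_space_nn_integral[symmetric]) (auto intro!: measurable_restrict_space1)
  finally show ?thesis .
qed

text \<open>The cell meets every orbit, and countably many translates of a null set still form a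
  null set.\<close>

lemma AE_periodic:
  assumes "AE x in T. P x" "periodic P"
  shows "AE x in lebesgue. P x"
proof -
  have "AE x in lebesgue. x \<in> cell \<longrightarrow> P x" using assms(1) by (simp add: AE_restrict_space_iff)
  then have "AE x in lebesgue. x + dual_pt k \<in> cell \<longrightarrow> P (x + dual_pt k)" for k by (rule AE_translation)
  then have "AE x in lebesgue. \<forall>k. x + dual_pt k \<in> cell \<longrightarrow> P (x + dual_pt k)" by (simp add: AE_all_countable)
  then show ?thesis
    by eventually_elim (use ex1_cell_plus periodicD[OF assms(2)] in blast)
qed

lemma AE_T: "AE x in lebesgue. P x \<Longrightarrow> AE x in T. P x"
  by (auto simp: AE_restrict_space_iff elim: eventually_mono)

text \<open>The translated cell is another fundamental domain: cutting \<open>g\<close> off to it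
  and unfolding meets each orbit exactly once.\<close>

lemma nn_integral_periodic_translation:
  fixes g :: "real^'d \<Rightarrow> ennreal"
  assumes [measurable]: "g \<in> borel_measurable lebesgue" and per: "periodic g"
  shows "(\<integral>\<^sup>+x. g (x + t) \<partial>T) = (\<integral>\<^sup>+x. g x \<partial>T)"
proof -
  have [measurable]: "(\<lambda>x. g (x + t)) \<in> borel_measurable lebesgue"
    by (rule borel_measurable_translation) fact
  have "(\<integral>\<^sup>+x. g (x + t) \<partial>T) = (\<integral>\<^sup>+x. g (x + t) * indicator cell x \<partial>lebesgue)"
    by (simp add: nn_integral_restrict_space)
  also have "\<dots> = (\<integral>\<^sup>+x. g x * indicator cell (x - t) \<partial>lebesgue)"
    using nn_integral_translation[of "\<lambda>x. g x * indicator cell (x - t)" t] by simp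
  also have "\<dots> = (\<integral>\<^sup>+x. (\<integral>\<^sup>+k. g (x + dual_pt k) * indicator cell (x + dual_pt k - t) \<partial>count_space UNIV) \<partial>T)"
    by (rule nn_integral_unfold) measurable
  also have "\<dots> = (\<integral>\<^sup>+x. g x \<partial>T)"
  proof (rule nn_integral_cong)
    fix x
    show "(\<integral>\<^sup>+k. g (x + dual_pt k) * indicator cell (x + dual_pt k - t) \<partial>count_space UNIV) = g x"
      using nn_sum_cell_plus[of "g x" "x - t"] by (simp add: periodicD[OF per] algebra_simps)
  qed
  finally show ?thesis .
qed

text \<open>The lattice sum is an integral over counting measure, so that Fubini applies to it;
  where the series does not converge absolutely its value is 0.\<close>

definition fold :: "(real^'d \<Rightarrow> complex) \<Rightarrow> real^'d \<Rightarrow> complex" where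
  "fold f x = (\<integral>k. f (x + dual_pt k) \<partial>count_space UNIV)"

lemma fold_periodic: "periodic (fold f)"
  unfolding periodic_def
proof (intro allI)
  fix x l
  have "bij_betw (\<lambda>k. l + k) UNIV (UNIV :: (int^'d) set)" by (rule bij_betwI[where g="\<lambda>k. k - l"]) auto
  from integral_bij_count_space[OF this, of "\<lambda>k. f (x + dual_pt k)"]
  show "fold f (x + dual_pt l) = fold f x" by (simp add: fold_def dual_pt_add add.assoc)
qed

text \<open>Fubini on the product of counting and Lebesgue measure, in two arrangements: the pieces
  of \<open>f\<close> left in place, and the same pieces moved to the base cell.\<close>

lemma fold_unfold:
  assumes f: "integrable lebesgue f"
  shows integrable_fold: "integrable T (fold f)"
    and AE_fold: "AE x in lebesgue. integrable (count_space UNIV) (\<lambda>k. f (x + dual_pt k))"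
    and integral_fold: "(\<integral>x. fold f x \<partial>T) = (\<integral>x. f x \<partial>lebesgue)"
proof -
  let ?K = "count_space (UNIV :: (int^'d) set)"
  interpret K: sigma_finite_measure ?K by (rule sigma_finite_measure_count_space)
  interpret L: sigma_finite_measure "lebesgue :: (real^'d) measure"
    by (rule sigma_finite_lebesgue)
  interpret P: pair_sigma_finite ?K "lebesgue :: (real^'d) measure" ..
  have fm[measurable]: "f \<in> borel_measurable lebesgue" using f by simp
  have [measurable]: "(\<lambda>x. f (x + dual_pt k)) \<in> borel_measurable lebesgue" for k
    by (rule borel_measurable_translation) fact
  \<comment> \<open>\<open>h1 k\<close> is the piece of \<open>f\<close> on the \<open>k\<close>-th
    cell and \<open>h2 k\<close> its translate to the base cell. Their integrals agree for each
    \<open>k\<close>, but summation over \<open>k\<close> gives \<open>f\<close> in the one case and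
    \<open>fold f\<close> cut off to \<open>cell\<close> in the other.\<close>
  define h1 where "h1 k x = indicator cell (x - dual_pt k) *\<^sub>R f x" for k x
  define h2 where "h2 k x = indicator cell x *\<^sub>R f (x + dual_pt k)" for k x
  have m1: "case_prod h1 \<in> borel_measurable (?K \<Otimes>\<^sub>M lebesgue)"
    by (rule measurable_pair_measure_countable1) (simp_all add: h1_def)
  have m2: "case_prod h2 \<in> borel_measurable (?K \<Otimes>\<^sub>M lebesgue)"
    by (rule measurable_pair_measure_countable1) (simp_all add: h2_def)
  have fin: "(\<integral>\<^sup>+x. ennreal (norm (f x)) \<partial>lebesgue) < \<infinity>" using f by (simp add: integrable_iff_bounded)
  have n1: "(\<integral>\<^sup>+k. (\<integral>\<^sup>+x. ennreal (norm (h1 k x)) \<partial>lebesgue) \<partial>?K) = (\<integral>\<^sup>+x. ennreal (norm (f x)) \<partial>lebesgue)"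
  proof -
    have "(\<integral>\<^sup>+k. (\<integral>\<^sup>+x. ennreal (norm (h1 k x)) \<partial>lebesgue) \<partial>?K)
        = (\<integral>\<^sup>+k. (\<integral>\<^sup>+x. ennreal (norm (f x)) * indicator cell (x - dual_pt k) \<partial>lebesgue) \<partial>?K)"
      by (intro nn_integral_cong) (auto simp: h1_def split: split_indicator)
    also have "\<dots> = (\<integral>\<^sup>+x. (\<integral>\<^sup>+k. ennreal (norm (f x)) * indicator cell (x - dual_pt k) \<partial>?K) \<partial>lebesgue)"
      by (rule nn_integral_count_space_nn_integral[symmetric]) auto
    finally show ?thesis by (simp only: nn_sum_cell_minus)
  qed
  have n2: "(\<integral>\<^sup>+k. (\<integral>\<^sup>+x. ennreal (norm (h2 k x)) \<partial>lebesgue) \<partial>?K) = (\<integral>\<^sup>+x. ennreal (norm (f x)) \<partial>lebesgue)"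
  proof -
    have "(\<integral>\<^sup>+x. ennreal (norm (h2 k x)) \<partial>lebesgue) = (\<integral>\<^sup>+x. ennreal (norm (h1 k x)) \<partial>lebesgue)" for k
      using nn_integral_translation[of "\<lambda>x. ennreal (norm (h1 k x))" "dual_pt k"] by (simp add: h1_def h2_def)
    then show ?thesis using n1 by simp
  qed
  have i1: "integrable (?K \<Otimes>\<^sub>M lebesgue) (case_prod h1)"
    using m1 n1 fin by (auto intro!: integrableI_bounded simp: L.nn_integral_fst[symmetric] split_beta)
  have i2: "integrable (?K \<Otimes>\<^sub>M lebesgue) (case_prod h2)"
    using m2 n2 fin by (auto intro!: integrableI_bounded simp: L.nn_integral_fst[symmetric] split_beta)
  have eq2: "(\<integral>k. h2 k x \<partial>?K) = indicator cell x *\<^sub>R fold f x" for x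
    by (simp add: h2_def fold_def)
  have "AE x in lebesgue. integrable ?K (\<lambda>k. h2 k x)"
    by (rule P.AE_integrable_snd[OF i2])
  then have "AE x in T. integrable ?K (\<lambda>k. f (x + dual_pt k))"
    by (simp add: AE_restrict_space_iff h2_def) (auto elim!: eventually_mono)
  moreover have "periodic (\<lambda>x. integrable ?K (\<lambda>k. f (x + dual_pt k)))"
    unfolding periodic_def
  proof (intro allI)
    fix x l
    have "bij_betw (\<lambda>k. l + k) UNIV (UNIV :: (int^'d) set)" by (rule bij_betwI[where g="\<lambda>k. k - l"]) auto
    from integrable_bij_count_space[OF this, of "\<lambda>k. f (x + dual_pt k)"]
    show "integrable ?K (\<lambda>k. f (x + dual_pt l + dual_pt k)) = integrable ?K (\<lambda>k. f (x + dual_pt k))"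
      by (simp add: dual_pt_add add.assoc)
  qed
  ultimately show "AE x in lebesgue. integrable ?K (\<lambda>k. f (x + dual_pt k))" by (rule AE_periodic)
  have "integrable lebesgue (\<lambda>x. \<integral>k. h2 k x \<partial>?K)" by (rule P.integrable_snd[OF i2])
  then show "integrable T (fold f)" by (simp add: eq2 integrable_restrict_space)
  have one: "(\<integral>k. h1 k x \<partial>?K) = f x" for x
  proof -
    obtain k where k: "x - dual_pt k \<in> cell" "\<And>l. x - dual_pt l \<in> cell \<Longrightarrow> l = k" using ex1_cell_minus by blast
    have "indicator cell (x - dual_pt l) = (indicator {k} l :: real)" for l
      using k by (metis indicator_simps singletonD singletonI)
    then have "(\<integral>l. h1 l x \<partial>?K) = (\<integral>l. indicator {k} l *\<^sub>R f x \<partial>?K)"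
      by (simp add: h1_def)
    then show ?thesis by simp
  qed
  have "(\<integral>x. fold f x \<partial>T) = (\<integral>x. (\<integral>k. h2 k x \<partial>?K) \<partial>lebesgue)"
    by (simp add: eq2 integral_restrict_space)
  also have "\<dots> = (\<integral>k. (\<integral>x. h2 k x \<partial>lebesgue) \<partial>?K)" by (rule P.Fubini_integral[OF i2])
  also have "\<dots> = (\<integral>k. (\<integral>x. h1 k x \<partial>lebesgue) \<partial>?K)"
    using integral_translation[of "\<lambda>x. h1 k x" "dual_pt k" for k] by (simp add: h1_def h2_def)
  also have "\<dots> = (\<integral>x. (\<integral>k. h1 k x \<partial>?K) \<partial>lebesgue)" by (rule P.Fubini_integral[OF i1, symmetric])
  finally show "(\<integral>x. fold f x \<partial>T) = (\<integral>x. f x \<partial>lebesgue)" by (simp only: one)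
qed

lemma integrable_T_iff:
  "integrable T f \<longleftrightarrow> integrable lebesgue (\<lambda>x. indicator cell x *\<^sub>R f x)"
  for f :: "real^'d \<Rightarrow> 'b::{banach, second_countable_topology}"
  by (simp add: integrable_restrict_space)

text \<open>As for the nonnegative integral: \<open>g\<close> cut off to the translated cell has
  \<open>g\<close> itself as its periodization.\<close>

lemma integral_periodic_translation:
  fixes g :: "real^'d \<Rightarrow> complex"
  assumes gm[measurable]: "g \<in> borel_measurable lebesgue" and per: "periodic g" and int: "integrable T g"
  shows "(\<integral>x. g (x + t) \<partial>T) = (\<integral>x. g x \<partial>T)"
proof -
  have [measurable]: "(\<lambda>x. g (x + t)) \<in> borel_measurable lebesgue"
    by (rule borel_measurable_translation) fact
  define f where "f x = indicator cell (x - t) *\<^sub>R g x" for x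
  have fm[measurable]: "f \<in> borel_measurable lebesgue" unfolding f_def by measurable
  have "(\<integral>\<^sup>+x. ennreal (norm (f x)) \<partial>lebesgue) = (\<integral>\<^sup>+x. ennreal (norm (g (x + t))) \<partial>T)"
    using nn_integral_translation[of "\<lambda>x. ennreal (norm (f x))" t]
    by (simp add: f_def nn_integral_restrict_space indicator_mult_ennreal[symmetric] mult.commute)
  also have "\<dots> = (\<integral>\<^sup>+x. ennreal (norm (g x)) \<partial>T)"
    by (rule nn_integral_periodic_translation[of "\<lambda>x. ennreal (norm (g x))"])
      (use per in \<open>auto simp: periodic_def\<close>)
  also have "\<dots> < \<infinity>" using int by (simp add: integrable_iff_bounded)
  finally have fi: "integrable lebesgue f" by (intro integrableI_bounded fm)
  have foldf: "fold f x = g x" for x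
  proof -
    obtain k where k: "(x - t) + dual_pt k \<in> cell" "\<And>l. (x - t) + dual_pt l \<in> cell \<Longrightarrow> l = k" using ex1_cell_plus by blast
    have "indicator cell (x + dual_pt l - t) = (indicator {k} l :: real)" for l
      using k by (metis indicator_simps singletonD singletonI diff_add_eq)
    then have "fold f x = (\<integral>l. indicator {k} l *\<^sub>R g x \<partial>count_space UNIV)"
      by (simp add: fold_def f_def periodicD[OF per])
    then show ?thesis by simp
  qed
  have "(\<integral>x. g (x + t) \<partial>T) = (\<integral>x. f (x + t) \<partial>lebesgue)"
    by (simp add: f_def integral_restrict_space)
  also have "\<dots> = (\<integral>x. f x \<partial>lebesgue)" by (rule integral_translation) fact
  also have "\<dots> = (\<integral>x. fold f x \<partial>T)" by (rule integral_fold[OF fi, symmetric])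
  finally show ?thesis by (simp add: foldf)
qed

end

section \<open>The cell, its volume and the characters\<close>

context lattice_torus
begin

text \<open>Open and closed variants of \<open>cell\<close>: \<open>torus_map\<close> is injective
  on the open one, whereas Stone-Weierstrass and Urysohn's lemma are applied to images of compact
  subsets of the closed one.\<close>

definition icell :: "(real^'d) set" where "icell = {x. \<forall>i. \<bar>(M *v x) $ i\<bar> < pi}"

definition ccell :: "(real^'d) set" where "ccell = {x. \<forall>i. \<bar>(M *v x) $ i\<bar> \<le> pi}"

lemma cell_subsets: "icell \<subseteq> cell" "cell \<subseteq> ccell"
  by (auto simp: icell_def cell_def ccell_def abs_less_iff abs_le_iff less_imp_le)
    (metis less_imp_le minus_le_iff neg_less_iff_less)+

lemma open_icell: "open icell"
proof -
  have "icell = (\<Inter>i. {x. \<bar>(M *v x) $ i\<bar> < pi})" by (auto simp: icell_def)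
  also have "open \<dots>" by (intro open_INT finite ballI open_Collect_less continuous_intros)
  finally show ?thesis .
qed

lemma closed_ccell: "closed ccell"
proof -
  have "ccell = (\<Inter>i. {x. \<bar>(M *v x) $ i\<bar> \<le> pi})" by (auto simp: ccell_def)
  also have "closed \<dots>" by (intro closed_INT ballI closed_Collect_le continuous_intros)
  finally show ?thesis .
qed

lemma norm_M_le_ccell: "x \<in> ccell \<Longrightarrow> norm (M *v x) \<le> pi * CARD('d)"
proof -
  assume x: "x \<in> ccell"
  have "norm (M *v x) \<le> (\<Sum>i\<in>UNIV. \<bar>(M *v x) $ i\<bar>)" by (rule norm_le_l1_cart)
  also have "\<dots> \<le> (\<Sum>i\<in>(UNIV::'d set). pi)" using x by (intro sum_mono) (auto simp: ccell_def)
  finally show ?thesis by (simp add: mult.commute)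
qed

lemma bounded_ccell: "bounded ccell"
proof -
  obtain K where K: "\<And>y. norm (N *v y) \<le> norm y * K" "K > 0"
    using bounded_linear.pos_bounded[OF matrix_vector_mul_bounded_linear[of N]] by auto
  have "norm x \<le> pi * CARD('d) * K" if "x \<in> ccell" for x
    using K(1)[of "M *v x"] mult_right_mono[OF norm_M_le_ccell[OF that] less_imp_le[OF K(2)]]
    by (simp only: N_M)
  then show ?thesis by (auto simp: bounded_iff)
qed

lemma compact_ccell: "compact ccell"
  using bounded_ccell closed_ccell compact_eq_bounded_closed by blast

lemma cell_lmeasurable: "cell \<in> lmeasurable"
  by (rule bounded_set_imp_lmeasurable) (use bounded_ccell cell_subsets bounded_subset in auto)

definition vol :: real where "vol = measure lebesgue cell"

lemma emeasure_cell: "emeasure lebesgue cell = ennreal vol"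
  using cell_lmeasurable by (simp add: vol_def emeasure_eq_measure2)

lemma emeasure_T: "emeasure T (space T) = ennreal vol"
  using emeasure_cell by (simp add: space_restrict_space emeasure_restrict_space)

lemma finite_measure_T: "finite_measure T"
  by (rule finite_measureI) (simp only: emeasure_T infinity_ennreal_def ennreal_neq_top not_False_eq_True)

lemma vol_pos: "vol > 0"
proof -
  have "0 \<in> icell" by (simp add: icell_def)
  then obtain e where e: "e > 0" "ball 0 e \<subseteq> icell" using open_icell openE by blast
  have "0 < measure lebesgue (ball (0::real^'d) e)" using e by simp
  also have "\<dots> \<le> vol" unfolding vol_def
    using e cell_subsets by (intro measure_mono_fmeasurable cell_lmeasurable) auto
  finally show ?thesis .
qed

text \<open>Comparison with balls, here and in the reverse estimate, determines the volume up to
  constants depending only on the dimension. This suffices for bounds that are uniform in the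
  scale.\<close>

lemma vol_le: assumes "\<And>x. norm (M *v x) \<ge> c * norm x" "c > 0"
  shows "vol \<le> unit_ball_vol CARD('d) * (pi * CARD('d) / c) ^ CARD('d)"
proof -
  have "ccell \<subseteq> cball 0 (pi * CARD('d) / c)"
  proof
    fix x assume "x \<in> ccell"
    then have "c * norm x \<le> pi * CARD('d)" using norm_M_le_ccell assms(1) order_trans by blast
    then show "x \<in> cball 0 (pi * CARD('d) / c)" using assms(2) by (simp add: field_simps)
  qed
  then have "vol \<le> measure lebesgue (cball (0::real^'d) (pi * CARD('d) / c))"
    unfolding vol_def using cell_subsets by (intro measure_mono_fmeasurable) auto
  also have "\<dots> = unit_ball_vol CARD('d) * (pi * CARD('d) / c) ^ CARD('d)"
    using assms(2) by (simp add: content_cball)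
  finally show ?thesis .
qed

lemma vol_ge: assumes "\<And>x. norm (M *v x) \<le> c * norm x" "c > 0"
  shows "unit_ball_vol CARD('d) * (pi / c) ^ CARD('d) \<le> vol"
proof -
  have "ball 0 (pi / c) \<subseteq> cell"
  proof -
    have "x \<in> icell" if "norm x < pi / c" for x
    proof -
      have "c * norm x < pi" using that assms(2) by (simp add: field_simps)
      then have "norm (M *v x) < pi" using assms(1)[of x] by linarith
      then show ?thesis using component_le_norm_cart[of "M *v x"] by (auto simp: icell_def intro: le_less_trans)
    qed
    then show ?thesis using cell_subsets by auto
  qed
  then have "measure lebesgue (ball (0::real^'d) (pi / c)) \<le> vol"
    unfolding vol_def by (intro measure_mono_fmeasurable cell_lmeasurable) auto
  then show ?thesis using assms(2) by (simp add: content_ball)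
qed

lemma chr_add: "chr (k + l) x = chr k x * chr l x"
  by (simp add: chr_def cis_mult inner_right_distrib)

lemma chr_uminus: "chr (- k) x = cnj (chr k x)"
  by (simp add: chr_def cis_cnj)

lemma chr_0[simp]: "chr 0 x = 1" and norm_chr[simp]: "cmod (chr k x) = 1"
  by (simp_all add: chr_def)

lemma chr_shift: "chr k (x + t) = chr k x * chr k t"
  by (simp add: chr_def cis_mult matrix_vector_right_distrib inner_left_distrib)

lemma chr_dual_pt: "chr k (dual_pt l) = 1"
proof -
  obtain n :: int where "of_int_vec l \<bullet> of_int_vec k = of_int n" using of_int_vec_inner_int by blast
  then show ?thesis by (simp add: chr_def M_dual_pt cis_2pi_int)
qed

lemma chr_periodic: "periodic (chr k)"
  by (simp add: periodic_def chr_shift chr_dual_pt)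

lemma chr_continuous: "continuous_on S (chr k)"
  unfolding chr_def by (intro continuous_intros)

lemma chr_measurable[measurable]: "chr k \<in> borel_measurable lebesgue"
  by (rule measurable_completion) (simp add: borel_measurable_continuous_onI chr_continuous)

lemma measurable_T: "f \<in> borel_measurable lebesgue \<Longrightarrow> f \<in> borel_measurable T"
  by (rule measurable_restrict_space1)

lemma integrable_T_bounded:
  fixes f :: "real^'d \<Rightarrow> 'b::{banach, second_countable_topology}"
  assumes "f \<in> borel_measurable T" "\<And>x. x \<in> cell \<Longrightarrow> norm (f x) \<le> B"
  shows "integrable T f"
  by (rule finite_measure.integrable_const_bound[OF finite_measure_T, of _ B])
    (use assms in \<open>auto simp: space_restrict_space\<close>)

lemma sq_int_T_bounded:
  assumes "f \<in> borel_measurable T" "\<And>x. x \<in> cell \<Longrightarrow> cmod (f x) \<le> B"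
  shows "sq_int T f"
  unfolding sq_int_def
  using assms by (intro conjI integrable_T_bounded[where B="B\<^sup>2"]) (auto simp: power_mono)

lemma sq_int_chr[simp]: "sq_int T (chr k)"
  by (rule sq_int_T_bounded[where B=1]) (auto intro: measurable_T)

text \<open>For \<open>k \<noteq> 0\<close> there is a translation on which the character takes the
  value -1, and translation invariance then turns the integral into its negative.\<close>

lemma integral_chr: "(\<integral>x. chr k x \<partial>T) = (if k = 0 then of_real vol else 0)"
proof (cases "k = 0")
  case True
  have "measure T (space T) = vol" using emeasure_T vol_pos by (simp add: measure_def)
  then show ?thesis using True by (simp add: scaleR_conv_of_real)
next
  case False
  then obtain i where i: "k $ i \<noteq> 0" by (auto simp: vec_eq_iff)
  define t where "t = N *v axis i (pi / of_int (k $ i))"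
  have "(M *v t) \<bullet> of_int_vec k = pi" using i by (simp add: t_def inner_axis')
  then have t: "chr k t = -1" by (simp add: chr_def)
  have "(\<integral>x. chr k (x + t) \<partial>T) = (\<integral>x. chr k x \<partial>T)"
    by (rule integral_periodic_translation[OF chr_measurable chr_periodic])
      (rule integrable_T_bounded[where B=1], auto intro: measurable_T)
  then show ?thesis using False t by (simp add: chr_shift)
qed

lemma ip_chr: "ip T (chr k) (chr l) = (if k = l then of_real vol else 0)"
proof -
  have "ip T (chr k) (chr l) = (\<integral>x. chr (k + - l) x \<partial>T)"
    by (simp add: ip_def chr_add chr_uminus del: add_uminus_conv_diff)
  then show ?thesis by (simp only: integral_chr) auto
qed

lemma sq_norm_trig:
  assumes "finite F"
  shows "sq_norm T (\<lambda>x. \<Sum>k\<in>F. c k * chr k x) = vol * (\<Sum>k\<in>F. (cmod (c k))\<^sup>2)"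
proof -
  have "sq_norm T (chr k) = vol" for k using ip_self[of T "chr k"] by (simp add: ip_chr)
  then show ?thesis
    using assms by (subst sq_norm_sum_orthogonal)
      (auto simp: sq_int_scale ip_scale_left ip_scale_right ip_chr sq_norm_scale sum_distrib_left mult.commute)
qed

section \<open>Density of trigonometric polynomials and Parseval's identity\<close>

definition trig :: "(real^'d \<Rightarrow> complex) set" where
  "trig = lincomb chr UNIV"

lemma trigE:
  assumes "q \<in> trig" obtains F c where "finite F" "q = (\<lambda>x. \<Sum>k\<in>F. c k * chr k x)"
  using assms unfolding trig_def lincomb_def by auto

lemma trig_chr: "(\<lambda>x. c * chr k x) \<in> trig"
  unfolding trig_def lincomb_def by (intro CollectI exI[of _ "{k}"] exI[of _ "\<lambda>_. c"]) simp

lemma trig_const: "(\<lambda>x. c) \<in> trig"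
  using trig_chr[of c 0] by simp

lemma trig_add: "p \<in> trig \<Longrightarrow> q \<in> trig \<Longrightarrow> (\<lambda>x. p x + q x) \<in> trig"
  unfolding trig_def by (rule lincomb_add)

lemma trig_scale: "q \<in> trig \<Longrightarrow> (\<lambda>x. c * q x) \<in> trig"
  unfolding trig_def by (rule lincomb_scale)

lemma trig_sum: "(\<And>i. i \<in> I \<Longrightarrow> q i \<in> trig) \<Longrightarrow> (\<lambda>x. \<Sum>i\<in>I. q i x) \<in> trig"
  by (induction I rule: infinite_finite_induct) (auto simp: trig_const intro: trig_add)

lemma trig_mult: assumes "p \<in> trig" "q \<in> trig" shows "(\<lambda>x. p x * q x) \<in> trig"
proof -
  obtain F c where p: "p = (\<lambda>x. \<Sum>k\<in>F. c k * chr k x)" by (rule trigE[OF assms(1)])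
  obtain G d where q: "q = (\<lambda>x. \<Sum>k\<in>G. d k * chr k x)" by (rule trigE[OF assms(2)])
  have "(\<lambda>x. p x * q x) = (\<lambda>x. \<Sum>k\<in>F. \<Sum>l\<in>G. (c k * d l) * chr (k + l) x)"
    unfolding p q by (simp add: sum_product chr_add mult_ac)
  then show ?thesis by (simp add: trig_sum trig_chr)
qed

lemma trig_sq_int: "q \<in> trig \<Longrightarrow> sq_int T q"
  unfolding trig_def by (erule lincomb_sq_int) (rule sq_int_chr)

definition torus_map :: "real^'d \<Rightarrow> complex^'d" where
  "torus_map x = (\<chi> i. cis ((M *v x) $ i))"

lemma torus_map_continuous: "continuous_on S torus_map"
  unfolding torus_map_def by (intro continuous_on_vec_lambda continuous_intros)

text \<open>Equal images mean that the coordinates differ by multiples of 2 pi; the strict bound on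
  one of the points excludes the identification of opposite faces.\<close>

lemma torus_map_inj:
  assumes "torus_map x = torus_map y" "x \<in> icell" "y \<in> ccell" shows "x = y"
proof -
  have "(M *v x) $ i = (M *v y) $ i" for i
  proof -
    have "cis ((M *v x) $ i) = cis ((M *v y) $ i)"
      using assms(1) by (simp add: torus_map_def vec_eq_iff)
    then have "sin ((M *v x) $ i) = sin ((M *v y) $ i) \<and> cos ((M *v x) $ i) = cos ((M *v y) $ i)"
      by (simp add: complex_eq_iff)
    then obtain n :: int where n: "(M *v x) $ i = (M *v y) $ i + 2 * pi * of_int n"
      unfolding sin_cos_eq_iff by blast
    have pi2: "0 < 2 * pi" by simp
    have "\<bar>(M *v x) $ i\<bar> < pi" "\<bar>(M *v y) $ i\<bar> \<le> pi" using assms by (auto simp: icell_def ccell_def)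
    then have "2 * pi * of_int n < 2 * pi * 1" "2 * pi * (- 1) < 2 * pi * of_int n" using n by linarith+
    then have "of_int n < (1::real)" "(- 1 :: real) < of_int n"
      by (simp_all only: mult_less_cancel_left_pos[OF pi2])
    then have "n = 0" by linarith
    then show ?thesis using n by simp
  qed
  then have "M *v x = M *v y" by (simp add: vec_eq_iff)
  then show ?thesis using N_M by metis
qed

text \<open>Stone--Weierstrass is applied on the image of the closed cell under \<open>torus_map\<close>, where
  opposite faces are identified, so that the trigonometric polynomials separate points.\<close>

lemma trig_approx_continuous:
  assumes f: "continuous_on (torus_map ` ccell) f" and e: "e > 0"
  shows "\<exists>q\<in>trig. \<forall>x\<in>ccell. cmod (of_real (f (torus_map x)) - q x) < e"
proof -
  \<comment> \<open>The Stone-Weierstrass theorem applied here is about real functions, while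
    \<open>trig\<close> is complex: \<open>P\<close> selects the real continuous functions on the
    torus whose pullback is a trigonometric polynomial.\<close>
  define P where "P g \<longleftrightarrow> continuous_on (torus_map ` ccell) g \<and> (\<lambda>x. complex_of_real (g (torus_map x))) \<in> trig" for g
  have trigc: "(\<lambda>x. complex_of_real (cos ((M *v x) $ i))) \<in> trig"
    "(\<lambda>x. complex_of_real (sin ((M *v x) $ i))) \<in> trig" for i
  proof -
    have chr: "chr (axis i 1) x = cis ((M *v x) $ i)" for x
    proof -
      have "of_int_vec (axis i 1) = (axis i 1 :: real^'d)" by (simp add: vec_eq_iff axis_def)
      then show ?thesis by (simp add: chr_def inner_axis)
    qed
    have c: "complex_of_real (cos ((M *v x) $ i)) = 1/2 * chr (axis i 1) x + 1/2 * chr (- axis i 1) x" for x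
      unfolding chr_uminus chr by (simp add: complex_eq_iff)
    show "(\<lambda>x. complex_of_real (cos ((M *v x) $ i))) \<in> trig" unfolding c by (intro trig_add trig_chr)
    have s: "complex_of_real (sin ((M *v x) $ i)) = - \<i>/2 * chr (axis i 1) x + \<i>/2 * chr (- axis i 1) x" for x
      unfolding chr_uminus chr by (simp add: complex_eq_iff)
    show "(\<lambda>x. complex_of_real (sin ((M *v x) $ i))) \<in> trig" unfolding s by (intro trig_add trig_chr)
  qed
  have PRe: "P (\<lambda>z. Re (z $ i))" "P (\<lambda>z. Im (z $ i))" for i
    unfolding P_def torus_map_def using trigc by (auto intro!: continuous_intros)
  have "\<exists>g. P g \<and> (\<forall>z \<in> torus_map ` ccell. \<bar>f z - g z\<bar> < e)"
  proof (rule Stone_Weierstrass_HOL[OF _ _ _ _ _ _ f e])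
    show "compact (torus_map ` ccell)" by (intro compact_continuous_image torus_map_continuous compact_ccell)
    show "P (\<lambda>x. c)" for c by (simp add: P_def trig_const)
    show "P g \<Longrightarrow> continuous_on (torus_map ` ccell) g" for g by (simp add: P_def)
    show "P g \<and> P h \<Longrightarrow> P (\<lambda>x. g x + h x)" for g h by (auto simp: P_def intro!: continuous_intros trig_add)
    show "P g \<and> P h \<Longrightarrow> P (\<lambda>x. g x * h x)" for g h by (auto simp: P_def intro!: continuous_intros trig_mult)
    show "\<exists>g. P g \<and> g x \<noteq> g y" if xy: "x \<in> torus_map ` ccell \<and> y \<in> torus_map ` ccell \<and> x \<noteq> y" for x y
    proof -
      obtain i where "x $ i \<noteq> y $ i" using xy by (metis vec_eq_iff)
      then have "Re (x $ i) \<noteq> Re (y $ i) \<or> Im (x $ i) \<noteq> Im (y $ i)" by (simp add: complex_eq_iff)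
      then show ?thesis using PRe by blast
    qed
  qed
  then obtain g where g0: "P g" "\<forall>z \<in> torus_map ` ccell. \<bar>f z - g z\<bar> < e" by (elim exE conjE)
  have g: "(\<lambda>x. complex_of_real (g (torus_map x))) \<in> trig"
    "\<And>x. x \<in> ccell \<Longrightarrow> \<bar>f (torus_map x) - g (torus_map x)\<bar> < e"
    using g0 by (simp_all add: P_def)
  have "cmod (of_real (f (torus_map x)) - of_real (g (torus_map x))) < e" if "x \<in> ccell" for x
    using g(2)[OF that] by (simp only: of_real_diff[symmetric] norm_of_real)
  then show ?thesis using g(1) by (intro bexI[of _ "\<lambda>x. complex_of_real (g (torus_map x))"]) simp_all
qed

lemma cell_boundary_null: "cell - icell \<in> null_sets lebesgue"
proof -
  have "cell - icell \<subseteq> (\<Union>i. {x. (transpose M *v axis i 1) \<bullet> x = - pi})"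
  proof
    fix x assume x: "x \<in> cell - icell"
    then obtain i where "\<not> \<bar>(M *v x) $ i\<bar> < pi" "- pi \<le> (M *v x) $ i" "(M *v x) $ i < pi"
      by (auto simp: cell_def icell_def)
    then have "(M *v x) $ i = - pi" by linarith
    moreover have "(transpose M *v axis i 1) \<bullet> x = (M *v x) $ i"
      by (metis dot_lmul_matrix inner_axis' inner_real_def mult_1 vector_transpose_matrix transpose_transpose inner_commute)
    ultimately show "x \<in> (\<Union>i. {x. (transpose M *v axis i 1) \<bullet> x = - pi})" by auto
  qed
  moreover have "negligible (\<Union>i. {x. (transpose M *v axis i 1) \<bullet> x = - pi})"
    by (intro negligible_Union) (auto intro!: negligible_hyperplane)
  ultimately show ?thesis using negligible_subset negligible_iff_null_sets by blast
qed

text \<open>A compact set inside and an open set around it approximate \<open>A\<close> in measure,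
  and Urysohn's lemma on the torus gives a continuous function between them. The boundary of the
  cell is a null set and is discarded beforehand, so that the two sets to be separated stay disjoint
  on the torus.\<close>

lemma trig_approx_indicator:
  assumes A: "A \<in> sets lebesgue" "A \<subseteq> cell" and e: "e > 0"
  shows "\<exists>q\<in>trig. sq_norm T (\<lambda>x. indicator A x - q x) < e"
proof -
  define A' where "A' = A \<inter> icell"
  have icell: "icell \<in> sets lebesgue" using open_icell by (simp add: borel_open)
  have A': "A' \<in> sets lebesgue" unfolding A'_def using A icell by auto
  \<comment> \<open>Error budget: the exceptional set has measure at most 2 d and squared error at
    most 4, which costs 8 d = 2 e / 5; elsewhere the error is at most \<open>s\<close>, which costs
    at most e / 4.\<close>
  define d where "d = e / 20"
  have d: "d > 0" using e by (simp add: d_def)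
  define s where "s = min 1 (e / (4 * vol))"
  have s: "s > 0" "s \<le> 1" "s * vol \<le> e / 4" using e vol_pos by (auto simp: s_def min_def field_simps)
  obtain C where C: "closed C" "C \<subseteq> A'" "A' - C \<in> lmeasurable" "emeasure lebesgue (A' - C) < ennreal d"
    using sets_lebesgue_inner_closed[OF A' d] .
  have CA: "C \<subseteq> icell" "C \<subseteq> A" using C by (auto simp: A'_def)
  have Cs: "C \<in> sets lebesgue" using C by (simp add: borel_closed)
  obtain U0 where U0: "open U0" "C \<subseteq> U0" "U0 - C \<in> lmeasurable" "emeasure lebesgue (U0 - C) < ennreal d"
    using sets_lebesgue_outer_open[OF Cs d] .
  define U where "U = U0 \<inter> icell"
  have U: "open U" "C \<subseteq> U" using U0 open_icell CA by (auto simp: U_def)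
  have "bounded C" using bounded_ccell CA cell_subsets bounded_subset by (metis order_trans)
  then have cC: "compact C" using C compact_eq_bounded_closed by blast
  have c1: "closed (torus_map ` C)"
    by (intro compact_imp_closed compact_continuous_image torus_map_continuous cC)
  have c2: "closed (torus_map ` (ccell - U))"
    by (intro compact_imp_closed compact_continuous_image torus_map_continuous compact_diff compact_ccell U)
  have "torus_map ` C \<inter> torus_map ` (ccell - U) = {}"
  proof (safe)
    fix x y assume "x \<in> C" "y \<in> ccell" "y \<notin> U" "torus_map x = torus_map y"
    moreover from this have "x = y" using torus_map_inj CA by blast
    ultimately show "torus_map x \<in> {}" using U by auto
  qed
  then obtain f :: "complex^'d \<Rightarrow> real" where f: "continuous_on UNIV f" "\<And>z. f z \<in> closed_segment 1 0"
    "\<And>z. z \<in> torus_map ` C \<Longrightarrow> f z = 1" "\<And>z. z \<in> torus_map ` (ccell - U) \<Longrightarrow> f z = 0"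
    using Urysohn[OF c1 c2] by metis
  have f01: "0 \<le> f z" "f z \<le> 1" for z using f(2)[of z] by (auto simp: closed_segment_eq_real_ivl)
  obtain q where q: "q \<in> trig" "\<And>x. x \<in> ccell \<Longrightarrow> cmod (of_real (f (torus_map x)) - q x) < s"
    using trig_approx_continuous[OF continuous_on_subset[OF f(1)] s(1)] by auto
  define B where "B = (A' - C) \<union> (U0 - C) \<union> (cell - icell)"
  have null: "emeasure lebesgue (cell - icell) = 0" using cell_boundary_null by auto
  have Bs: "B \<in> sets lebesgue" unfolding B_def using A' Cs U0 icell by (auto intro!: sets.Un sets.Diff simp: borel_open)
  have "emeasure lebesgue B \<le> emeasure lebesgue ((A' - C) \<union> (U0 - C)) + emeasure lebesgue (cell - icell)"
    unfolding B_def by (intro emeasure_subadditive) (use A' Cs U0 icell in \<open>auto simp: borel_open\<close>)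
  also have "emeasure lebesgue ((A' - C) \<union> (U0 - C)) \<le> emeasure lebesgue (A' - C) + emeasure lebesgue (U0 - C)"
    by (intro emeasure_subadditive) (use A' Cs U0 in \<open>auto simp: borel_open\<close>)
  also have "\<dots> \<le> ennreal d + ennreal d" using C U0 by (intro add_mono) auto
  finally have eB: "emeasure lebesgue B \<le> ennreal (2 * d)" using d null by (simp add: ennreal_plus[symmetric] del: ennreal_plus)
  have pt: "ennreal ((cmod (indicator A x - q x))\<^sup>2) * indicator cell x
      \<le> ennreal (s\<^sup>2) * indicator cell x + 4 * indicator B x" for x
  proof (cases "x \<in> cell")
    case False then show ?thesis by simp
  next
    case xcell: True
    then have xc: "x \<in> ccell" using cell_subsets by auto
    show ?thesis
    proof (cases "x \<in> B")
      case True
      have "cmod (indicator A x - q x) \<le> cmod (indicator A x - of_real (f (torus_map x))) + cmod (of_real (f (torus_map x)) - q x)"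
        using norm_triangle_ineq[of "indicator A x - of_real (f (torus_map x))" "of_real (f (torus_map x)) - q x"] by simp
      also have "cmod (indicator A x - of_real (f (torus_map x))) \<le> 1"
      proof -
        have "indicator A x - complex_of_real (f (torus_map x)) = of_real (indicator A x - f (torus_map x))"
          by (simp split: split_indicator)
        then show ?thesis using f01[of "torus_map x"] by (simp only: norm_of_real) (simp split: split_indicator)
      qed
      finally have "cmod (indicator A x - q x) \<le> 2" using q(2)[OF xc] s by simp
      then have "(cmod (indicator A x - q x))\<^sup>2 \<le> 2\<^sup>2" by (intro power_mono) auto
      then have "ennreal ((cmod (indicator A x - q x))\<^sup>2) \<le> ennreal 4" by (intro ennreal_leI) simp
      then show ?thesis using True xcell by (auto intro!: add_increasing)
    next
      case False
      have "indicator A x = complex_of_real (f (torus_map x))"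
      proof (cases "x \<in> C")
        case True then show ?thesis using f(3) CA by auto
      next
        case nC: False
        then have "x \<notin> A" "x \<notin> U" using False \<open>x \<in> cell\<close> by (auto simp: B_def A'_def U_def)
        then show ?thesis using f(4) xc by auto
      qed
      then have "(cmod (indicator A x - q x))\<^sup>2 \<le> s\<^sup>2" using q(2)[OF xc] by (intro power_mono) auto
      then show ?thesis using \<open>x \<in> cell\<close> by (auto intro!: add_increasing2 ennreal_leI)
    qed
  qed
  have sq: "sq_int T (\<lambda>x. indicator A x - q x)"
  proof (rule sq_int_diff[OF _ trig_sq_int[OF q(1)]])
    show "sq_int T (indicator A)"
      using A by (intro sq_int_T_bounded[where B=1] measurable_T) (auto simp: indicator_def)
  qed
  have "ennreal (sq_norm T (\<lambda>x. indicator A x - q x))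
      = (\<integral>\<^sup>+x. ennreal ((cmod (indicator A x - q x))\<^sup>2) * indicator cell x \<partial>lebesgue)"
    by (simp add: sq_norm_eq_nn_integral[OF sq] nn_integral_restrict_space)
  also have "\<dots> \<le> (\<integral>\<^sup>+x. ennreal (s\<^sup>2) * indicator cell x + 4 * indicator B x \<partial>lebesgue)"
    by (intro nn_integral_mono pt)
  also have "\<dots> = ennreal (s\<^sup>2) * ennreal vol + 4 * emeasure lebesgue B"
    using Bs by (subst nn_integral_add) (auto simp: nn_integral_cmult emeasure_cell)
  also have "\<dots> \<le> ennreal (s\<^sup>2 * vol) + ennreal (4 * (2 * d))"
  proof (intro add_mono)
    have "4 * emeasure lebesgue B \<le> 4 * ennreal (2 * d)" by (intro mult_left_mono eB) simp
    also have "\<dots> = ennreal (4 * (2 * d))" using d by (subst ennreal_mult) auto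
    finally show "4 * emeasure lebesgue B \<le> ennreal (4 * (2 * d))" .
  qed (use vol_pos in \<open>simp add: ennreal_mult\<close>)
  also have "\<dots> = ennreal (s\<^sup>2 * vol + 8 * d)" using vol_pos d by (subst ennreal_plus[symmetric]) auto
  finally have "sq_norm T (\<lambda>x. indicator A x - q x) \<le> s\<^sup>2 * vol + 8 * d"
    using vol_pos d by (subst (asm) ennreal_le_iff) auto
  also have "s\<^sup>2 * vol \<le> s * vol" using s vol_pos by (simp add: power2_eq_square mult_le_cancel_right)
  also have "s * vol + 8 * d < e" using s e by (simp add: d_def)
  finally show ?thesis using q(1) by auto
qed

text \<open>Orthogonality passes from trigonometric polynomials to indicators by approximation, and
  a function whose integral over every measurable set vanishes is 0 almost everywhere.\<close>

lemma AE_zero_if_orthogonal_trig: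
  assumes g: "sq_int T g" and orth: "\<And>q. q \<in> trig \<Longrightarrow> ip T g q = 0"
  shows "AE x in T. g x = 0"
proof -
  have gT[measurable]: "g \<in> borel_measurable T" using g by (simp add: sq_int_def)
  have gi: "integrable T g"
    using integrable_mult_cnj[OF g sq_int_chr[of 0]] by simp
  have zero: "(\<integral>x. indicator A x *\<^sub>R g x \<partial>T) = 0" if A: "A \<in> sets T" for A
  proof -
    have A': "A \<in> sets lebesgue" "A \<subseteq> cell" using A by (auto simp: sets_restrict_space_iff)
    have sA: "sq_int T (indicator A)"
      by (rule sq_int_T_bounded[where B=1]) (use A in \<open>auto simp: indicator_def\<close>)
    have "(cmod (ip T g (indicator A)))\<^sup>2 \<le> sq_norm T g * e" if e: "e > 0" for e
    proof -
      obtain q where q: "q \<in> trig" "sq_norm T (\<lambda>x. indicator A x - q x) < e"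
        using trig_approx_indicator[OF A' e] by auto
      have "ip T g (indicator A) = ip T g (\<lambda>x. indicator A x - q x)"
        using ip_diff_right[OF sA trig_sq_int[OF q(1)] g] orth[OF q(1)] by simp
      then have "(cmod (ip T g (indicator A)))\<^sup>2 \<le> sq_norm T g * sq_norm T (\<lambda>x. indicator A x - q x)"
        using ip_cauchy_schwarz[OF g sq_int_diff[OF sA trig_sq_int[OF q(1)]]] by simp
      also have "\<dots> \<le> sq_norm T g * e" using q(2) by (intro mult_left_mono) auto
      finally show ?thesis .
    qed
    note bound = this
    have "(cmod (ip T g (indicator A)))\<^sup>2 \<le> 0"
    proof (rule field_le_epsilon)
      fix e :: real assume e: "e > 0"
      have "(cmod (ip T g (indicator A)))\<^sup>2 \<le> sq_norm T g * (e / (sq_norm T g + 1))"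
        by (rule bound) (use e sq_norm_nonneg[of T g] in \<open>simp add: add_nonneg_pos\<close>)
      also have "\<dots> \<le> e" using e sq_norm_nonneg[of T g] by (simp add: divide_le_eq add_nonneg_pos mult.commute distrib_left)
      finally show "(cmod (ip T g (indicator A)))\<^sup>2 \<le> 0 + e" by simp
    qed
    then have "ip T g (indicator A) = 0" by simp
    moreover have eq: "indicator A x *\<^sub>R g x = g x * cnj (indicator A x)" for x by (simp add: indicator_def)
    ultimately show ?thesis
      by (simp only: ip_def eq)
  qed
  \<comment> \<open>Tests with the set where \<open>h\<close> is positive; it will be applied to
    plus and minus the real and imaginary parts.\<close>
  have rpos: "AE x in T. h x \<le> 0" if h: "integrable T h" "\<And>A. A \<in> sets T \<Longrightarrow> (\<integral>x. indicator A x * h x \<partial>T) = 0"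
    for h :: "real^'d \<Rightarrow> real"
  proof -
    have [measurable]: "h \<in> borel_measurable T" using h by auto
    define A where "A = {x \<in> space T. h x > 0}"
    have A: "A \<in> sets T" unfolding A_def by measurable
    have "(\<integral>x. indicator A x * h x \<partial>T) = 0" by (rule h(2)[OF A])
    moreover have "integrable T (\<lambda>x. indicator A x * h x)"
      using integrable_mult_indicator[OF A h(1)] by simp
    moreover have "AE x in T. 0 \<le> indicator A x * h x" by (auto simp: A_def split: split_indicator)
    ultimately have "AE x in T. indicator A x * h x = 0" by (subst (asm) integral_nonneg_eq_0_iff_AE) auto
    then show ?thesis using AE_space by eventually_elim (auto simp: A_def indicator_def split: if_splits)
  qed
  have Rez: "(\<integral>x. indicator A x * Re (g x) \<partial>T) = 0" and Imz: "(\<integral>x. indicator A x * Im (g x) \<partial>T) = 0"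
    if "A \<in> sets T" for A
    using integral_Re[OF integrable_mult_indicator[OF that gi]] integral_Im[OF integrable_mult_indicator[OF that gi]]
      zero[OF that] by simp_all
  have "AE x in T. Re (g x) \<le> 0" "AE x in T. - Re (g x) \<le> 0" "AE x in T. Im (g x) \<le> 0" "AE x in T. - Im (g x) \<le> 0"
    by (rule rpos; use gi Rez Imz in simp)+
  then show ?thesis by eventually_elim (auto simp: complex_eq_iff)
qed

lemma AE_zero_if_coeffs_zero:
  assumes "sq_int T g" "\<And>k. ip T g (chr k) = 0"
  shows "AE x in T. g x = 0"
proof (rule AE_zero_if_orthogonal_trig[OF assms(1)])
  fix q assume "q \<in> trig"
  then show "ip T g q = 0"
    by (rule trigE) (simp add: assms ip_sum_right sq_int_scale ip_scale_right)
qed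

text \<open>Were the polynomials not dense, the projection argument would give a nonzero function
  orthogonal to all of them.\<close>

lemma trig_dense:
  assumes f: "sq_int T f" and e: "e > 0"
  shows "\<exists>q\<in>trig. sq_norm T (\<lambda>x. f x - q x) < e"
proof (rule ccontr)
  assume "\<not> ?thesis"
  then have "\<And>q. q \<in> trig \<Longrightarrow> e \<le> sq_norm T (\<lambda>x. f x - q x)" by force
  from exists_orthogonal_if_not_dense[OF trig_sq_int trig_const trig_add trig_scale f e this]
  obtain g where g: "sq_int T g" "sq_norm T g > 0" "\<And>q. q \<in> trig \<Longrightarrow> ip T g q = 0" by blast
  have "AE x in T. g x = 0" using AE_zero_if_orthogonal_trig[OF g(1,3)] by blast
  then show False using g(2) sq_norm_eq_0_iff[OF g(1)] by simp
qed

lemma parseval: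
  assumes f: "sq_int T f"
  shows "(\<integral>\<^sup>+k. ennreal ((cmod (ip T f (chr k)))\<^sup>2) \<partial>count_space UNIV) = ennreal (vol * sq_norm T f)"
proof (rule antisym)
  define c where "c k = ip T f (chr k)" for k
  \<comment> \<open>Completing the square in the coefficients. With \<open>a k = c k / vol\<close>
    the last sum vanishes and Bessel's inequality remains; for an approximating polynomial, dropping
    the last sum gives the reverse inequality.\<close>
  have expand: "sq_norm T (\<lambda>x. f x - (\<Sum>k\<in>F. a k * chr k x))
      = sq_norm T f - (\<Sum>k\<in>F. (cmod (c k))\<^sup>2) / vol + (\<Sum>k\<in>F. (cmod (a k * vol - c k))\<^sup>2) / vol"
    if "finite F" for F a
  proof -
    have "sq_norm T (\<lambda>x. f x - (\<Sum>k\<in>F. a k * chr k x))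
        = sq_norm T f - 2 * Re (\<Sum>k\<in>F. cnj (a k) * c k) + vol * (\<Sum>k\<in>F. (cmod (a k))\<^sup>2)"
      using that by (subst sq_norm_diff[OF f]) (auto intro!: sq_int_sum sq_int_scale simp: ip_sum_right sq_int_scale f ip_scale_right c_def sq_norm_trig)
    also have "\<dots> = sq_norm T f + (\<Sum>k\<in>F. vol * (cmod (a k))\<^sup>2 - 2 * Re (cnj (a k) * c k))"
      by (simp add: sum_subtractf sum_distrib_left)
    also have "(\<Sum>k\<in>F. vol * (cmod (a k))\<^sup>2 - 2 * Re (cnj (a k) * c k))
        = (\<Sum>k\<in>F. (cmod (a k * vol - c k))\<^sup>2 / vol - (cmod (c k))\<^sup>2 / vol)"
    proof (rule sum.cong[OF refl])
      fix k
      have "(cmod (a k * vol - c k))\<^sup>2 = vol\<^sup>2 * (cmod (a k))\<^sup>2 - 2 * vol * Re (cnj (a k) * c k) + (cmod (c k))\<^sup>2"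
        by (simp only: cmod_power2) (simp add: power2_eq_square algebra_simps)
      then show "vol * (cmod (a k))\<^sup>2 - 2 * Re (cnj (a k) * c k) = (cmod (a k * vol - c k))\<^sup>2 / vol - (cmod (c k))\<^sup>2 / vol"
        using vol_pos by (simp add: field_simps power2_eq_square)
    qed
    finally show ?thesis by (simp add: sum_subtractf sum_divide_distrib)
  qed
  have "(\<Sum>k\<in>F. (cmod (c k))\<^sup>2) \<le> vol * sq_norm T f" if F: "finite F" for F
  proof -
    have "0 \<le> sq_norm T (\<lambda>x. f x - (\<Sum>k\<in>F. (c k / vol) * chr k x))" by simp
    also have "\<dots> = sq_norm T f - (\<Sum>k\<in>F. (cmod (c k))\<^sup>2) / vol"
      by (subst expand[OF F]) (use vol_pos in simp)
    finally show ?thesis using vol_pos by (simp add: field_simps)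
  qed
  then show "(\<integral>\<^sup>+k. ennreal ((cmod (ip T f (chr k)))\<^sup>2) \<partial>count_space UNIV) \<le> ennreal (vol * sq_norm T f)"
    unfolding c_def by (intro nn_integral_count_space_le) auto
  let ?S = "\<integral>\<^sup>+k. ennreal ((cmod (ip T f (chr k)))\<^sup>2) \<partial>count_space UNIV"
  show "ennreal (vol * sq_norm T f) \<le> ?S"
  proof (rule ennreal_le_epsilon)
    fix e :: real assume e: "e > 0"
    obtain q where q: "q \<in> trig" "sq_norm T (\<lambda>x. f x - q x) < e / vol"
      using trig_dense[OF f, of "e / vol"] e vol_pos by auto
    obtain F a where F: "finite F" and qa: "q = (\<lambda>x. \<Sum>k\<in>F. a k * chr k x)" by (rule trigE[OF q(1)])
    have "sq_norm T f - (\<Sum>k\<in>F. (cmod (c k))\<^sup>2) / vol \<le> e / vol"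
    proof -
      have "(\<Sum>k\<in>F. (cmod (a k * vol - c k))\<^sup>2) / vol \<ge> 0" using vol_pos by (simp add: sum_nonneg)
      then show ?thesis using q(2) unfolding qa expand[OF F] by linarith
    qed
    then have "sq_norm T f \<le> ((\<Sum>k\<in>F. (cmod (c k))\<^sup>2) + e) / vol" by (simp add: add_divide_distrib)
    then have "vol * sq_norm T f \<le> (\<Sum>k\<in>F. (cmod (c k))\<^sup>2) + e"
      using vol_pos by (simp add: pos_le_divide_eq mult.commute)
    then have "ennreal (vol * sq_norm T f) \<le> ennreal ((\<Sum>k\<in>F. (cmod (c k))\<^sup>2) + e)" by (rule ennreal_leI)
    also have "\<dots> = (\<Sum>k\<in>F. ennreal ((cmod (c k))\<^sup>2)) + ennreal e"
      using e by (subst ennreal_plus) (auto simp: sum_nonneg sum_ennreal)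
    also have "\<dots> \<le> ?S + ennreal e"
      unfolding c_def by (intro add_right_mono sum_le_nn_integral_count_space F)
    finally show "ennreal (vol * sq_norm T f) \<le> ?S + ennreal e" .
  qed
qed

end

section \<open>Plancherel's theorem\<close>

text \<open>Comparison with balls would not give the constant of Plancherel's theorem. For a scalar
  matrix the cell lies between an open and a closed cube, so its volume is known exactly.\<close>

lemma (in lattice_torus) vol_scalar:
  assumes M: "\<And>x. M *v x = a *\<^sub>R x" and a: "a > 0"
  shows "vol = (2 * pi / a) ^ CARD('d)"
proof -
  define u :: "real^'d" where "u = (\<chi> i. pi / a)"
  have ub: "u \<bullet> b = pi / a" if "b \<in> Basis" for b
    using that by (auto simp: Basis_vec_def inner_axis u_def)
  have "(\<Prod>b\<in>Basis. (u - - u) \<bullet> b) = (\<Prod>b\<in>(Basis::(real^'d) set). 2 * pi / a)"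
  proof (rule prod.cong[OF refl])
    fix b :: "real^'d" assume "b \<in> Basis"
    then show "(u - - u) \<bullet> b = 2 * pi / a" unfolding diff_minus_eq_add inner_add_left by (simp add: ub)
  qed
  then have pr: "(\<Prod>b\<in>Basis. (u - - u) \<bullet> b) = (2 * pi / a) ^ CARD('d)" by simp
  have le: "\<And>b. b \<in> Basis \<Longrightarrow> (- u) \<bullet> b \<le> u \<bullet> b" using a by (simp add: ub)
  have m1: "emeasure lebesgue (box (-u) u) = ennreal ((2 * pi / a) ^ CARD('d))"
    using emeasure_lborel_box[OF le] pr by simp
  have m2: "emeasure lebesgue (cbox (-u) u) = ennreal ((2 * pi / a) ^ CARD('d))"
    using emeasure_lborel_cbox[OF le] pr by simp
  have sub: "box (-u) u \<subseteq> cell" "cell \<subseteq> cbox (-u) u"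
    using a by (auto simp: mem_box_cart cell_def M u_def field_simps less_imp_le)
  have "emeasure lebesgue (box (-u) u) \<le> emeasure lebesgue cell"
    by (intro emeasure_mono sub) simp
  moreover have "emeasure lebesgue cell \<le> emeasure lebesgue (cbox (-u) u)"
    by (intro emeasure_mono sub) simp
  ultimately have "ennreal vol = ennreal ((2 * pi / a) ^ CARD('d))"
    using m1 m2 by (simp add: emeasure_cell)
  then show ?thesis using vol_pos a by (subst (asm) ennreal_inj) auto
qed

lemma lattice_torus_scalar: "c > 0 \<Longrightarrow> lattice_torus (c *\<^sub>R mat 1) ((1 / c) *\<^sub>R mat 1 :: real^'d^'d)"
  by standard (simp add: matrix_matrix_mult_def mat_def vec_eq_iff if_distrib[of "\<lambda>x. _ * x"] if_distrib[of "\<lambda>x. x * _"] cong: if_cong)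

lemma scalar_matrix_vector: "(c *\<^sub>R mat 1) *v x = c *\<^sub>R (x :: real^'d)"
  by (simp add: scaleR_matrix_vector_assoc[symmetric])

text \<open>The sign \<open>s\<close> selects the Fourier integral (\<open>s = -1\<close>) or the unnormalized inverse one (\<open>s = 1\<close>).\<close>

definition fourier_int :: "real \<Rightarrow> (real^'d \<Rightarrow> complex) \<Rightarrow> real^'d \<Rightarrow> complex" where
  "fourier_int s f \<omega> = (\<integral>x. f x * cis (s * (x \<bullet> \<omega>)) \<partial>lebesgue)"

abbreviation two_pi_dim :: "'d::finite itself \<Rightarrow> real" where "two_pi_dim _ \<equiv> (2 * pi) ^ CARD('d)"

lemma cis_measurable_lebesgue[measurable]: "(\<lambda>x. cis (s * (x \<bullet> \<omega>))) \<in> borel_measurable (lebesgue :: (real^'d) measure)"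
  by (rule measurable_completion) (simp add: borel_measurable_continuous_onI continuous_intros)

lemma cis_pair_measurable:
  "(\<lambda>(\<omega>, x). cis (s * (x \<bullet> \<omega>))) \<in> borel_measurable (lebesgue \<Otimes>\<^sub>M lebesgue :: ((real^'d) \<times> (real^'d)) measure)"
proof -
  have id: "(\<lambda>x. x) \<in> (lebesgue :: (real^'d) measure) \<rightarrow>\<^sub>M borel"
    by (rule measurable_completion) simp
  have [measurable]: "cis \<in> borel_measurable borel"
    by (intro borel_measurable_continuous_onI continuous_intros)
  have [measurable]: "(\<lambda>p. fst p) \<in> (lebesgue \<Otimes>\<^sub>M lebesgue :: ((real^'d) \<times> (real^'d)) measure) \<rightarrow>\<^sub>M borel"
    "(\<lambda>p. snd p) \<in> (lebesgue \<Otimes>\<^sub>M lebesgue :: ((real^'d) \<times> (real^'d)) measure) \<rightarrow>\<^sub>M borel"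
    by (rule measurable_compose[OF measurable_fst id], rule measurable_compose[OF measurable_snd id])
  show ?thesis unfolding split_beta by measurable
qed

lemma fourier_int_measurable[measurable]:
  assumes [measurable]: "f \<in> borel_measurable lebesgue"
  shows "fourier_int s f \<in> borel_measurable lebesgue"
proof -
  have "(\<lambda>(\<omega>, x). f x * cis (s * (x \<bullet> \<omega>))) \<in> borel_measurable (lebesgue \<Otimes>\<^sub>M lebesgue)"
  proof -
    have "(\<lambda>p. f (snd p)) \<in> borel_measurable (lebesgue \<Otimes>\<^sub>M lebesgue)"
      by (rule measurable_compose[OF measurable_snd]) fact
    from borel_measurable_times[OF this cis_pair_measurable] show ?thesis by (simp add: split_beta)
  qed
  from sigma_finite_measure.borel_measurable_lebesgue_integral[OF sigma_finite_lebesgue this]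
  show ?thesis by (simp add: fourier_int_def[abs_def])
qed

definition supp_in :: "nat \<Rightarrow> (real^'d \<Rightarrow> complex) \<Rightarrow> bool" where
  "supp_in n f \<longleftrightarrow> (\<forall>x. norm x > real n \<longrightarrow> f x = 0)"

definition trunc :: "nat \<Rightarrow> (real^'d \<Rightarrow> complex) \<Rightarrow> real^'d \<Rightarrow> complex" where
  "trunc n f x = indicator (cball 0 (real n)) x * f x"

lemma indicator_cball_measurable[measurable]:
  "(indicator (cball 0 (real n)) :: real^'d \<Rightarrow> complex) \<in> borel_measurable lebesgue"
  by (rule borel_measurable_indicator) auto

lemma trunc_measurable[measurable]:
  "f \<in> borel_measurable lebesgue \<Longrightarrow> trunc n f \<in> borel_measurable lebesgue"
  unfolding trunc_def by measurable

lemma trunc_sq_int: "sq_int lebesgue f \<Longrightarrow> sq_int lebesgue (trunc n f)"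
  by (rule sq_int_bound[where C=1 and g=f])
    (auto simp: sq_int_def trunc_def norm_mult split: split_indicator)

lemma trunc_supp: "supp_in n (trunc n f)"
  by (auto simp: supp_in_def trunc_def)

text \<open>The product of \<open>f\<close> with the square-integrable indicator of a ball is
  \<open>f\<close> itself.\<close>

lemma integrable_supp:
  assumes f: "sq_int lebesgue f" and supp: "supp_in n f"
  shows "integrable lebesgue f"
proof -
  have "sq_int lebesgue (indicator (cball (0::real^'d) (real n)) :: _ \<Rightarrow> complex)"
  proof (rule sq_int_if_nn_integral)
    have "(\<integral>\<^sup>+x. ennreal ((cmod (indicator (cball (0::real^'d) (real n)) x))\<^sup>2) \<partial>lebesgue)
        = (\<integral>\<^sup>+x. indicator (cball (0::real^'d) (real n)) x \<partial>lebesgue)"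
      by (intro nn_integral_cong) (simp split: split_indicator)
    also have "\<dots> < \<infinity>" using emeasure_lborel_cball_finite[of "0::real^'d" "real n"] by simp
    finally show "(\<integral>\<^sup>+x. ennreal ((cmod (indicator (cball (0::real^'d) (real n)) x))\<^sup>2) \<partial>lebesgue) < \<infinity>" .
  qed (rule indicator_cball_measurable)
  from integrable_mult_sq_int[OF f this]
  have "integrable lebesgue (\<lambda>x. f x * indicator (cball 0 (real n)) x)" .
  moreover have "f x * indicator (cball 0 (real n)) x = f x" for x
    using supp by (auto simp: supp_in_def split: split_indicator)
  ultimately show ?thesis by simp
qed

lemma integrable_cis:
  fixes f :: "real^'d \<Rightarrow> complex"
  shows "integrable lebesgue f \<Longrightarrow> integrable lebesgue (\<lambda>x. f x * cis (s * (x \<bullet> \<omega>)))"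
  by (rule Bochner_Integration.integrable_bound)
    (auto simp: norm_mult intro!: borel_measurable_times cis_measurable_lebesgue)

lemma fourier_int_cnj: "fourier_int s f \<omega> = cnj (fourier_int (- s) (\<lambda>x. cnj (f x)) \<omega>)"
  unfolding fourier_int_def by (subst Bochner_Integration.integral_cnj[symmetric]) (simp add: cis_cnj)

lemma fourier_int_diff: "integrable lebesgue f \<Longrightarrow> integrable lebesgue g \<Longrightarrow> fourier_int s (\<lambda>x. f x - g x) \<omega> = fourier_int s f \<omega> - fourier_int s g \<omega>"
  unfolding fourier_int_def by (simp add: left_diff_distrib integrable_cis)

lemma fourier_int_add: "integrable lebesgue f \<Longrightarrow> integrable lebesgue g \<Longrightarrow> fourier_int s (\<lambda>x. f x + g x) \<omega> = fourier_int s f \<omega> + fourier_int s g \<omega>"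
  unfolding fourier_int_def by (simp add: distrib_right integrable_cis)

lemma fourier_int_scale: "fourier_int s (\<lambda>x. c * f x) \<omega> = c * fourier_int s f \<omega>"
  unfolding fourier_int_def by (simp add: mult.assoc)

text \<open>Parseval on a cube containing the support gives the values of the transform on the dual
  lattice and all its translates; integrating over the translates yields the full \<open>L\<^sub>2\<close> norm.\<close>

lemma plancherel_neg:
  fixes f :: "real^'d \<Rightarrow> complex"
  assumes f: "sq_int lebesgue f" and supp: "supp_in n f"
  shows "sq_int lebesgue (fourier_int (-1) f) \<and> sq_norm lebesgue (fourier_int (-1) f) = two_pi_dim TYPE('d) * sq_norm lebesgue f"
proof -
  \<comment> \<open>The extra 1 puts the closed ball of radius \<open>n\<close> strictly inside the
    half-open cube of half-side \<open>t\<close>.\<close>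
  define t where "t = real n + 1"
  have t: "t > 0" by (simp add: t_def)
  have fm[measurable]: "f \<in> borel_measurable lebesgue" using f by (simp add: sq_int_def)
  \<comment> \<open>\<open>P\<close> has the cube [-t, t)^d as its cell and characters of
    frequencies (pi / t) k. Exactly these frequencies form the dual lattice of \<open>Q\<close>,
    whose cell has side pi / t, and the two volumes multiply to (2 pi)^d.\<close>
  interpret P: lattice_torus "(pi / t) *\<^sub>R mat 1" "(1 / (pi / t)) *\<^sub>R mat 1 :: real^'d^'d"
    using t by (intro lattice_torus_scalar) simp
  interpret Q: lattice_torus "(2 * t) *\<^sub>R mat 1" "(1 / (2 * t)) *\<^sub>R mat 1 :: real^'d^'d"
    using t by (intro lattice_torus_scalar) simp
  have volP: "P.vol = (2 * t) ^ CARD('d)"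
    using P.vol_scalar[OF scalar_matrix_vector] t by simp
  have volQ: "Q.vol = (pi / t) ^ CARD('d)"
    using Q.vol_scalar[OF scalar_matrix_vector] t by simp
  have out: "f x = 0" if "x \<notin> P.cell" for x
  proof -
    have "norm x > real n"
    proof (rule ccontr)
      assume "\<not> norm x > real n"
      then have "\<bar>x $ i\<bar> < t" for i using component_le_norm_cart[of x i] by (simp add: t_def)
      then have "- pi \<le> (pi / t) * x $ i \<and> (pi / t) * x $ i < pi" for i
        using t by (simp add: abs_less_iff field_simps) (smt (verit) mult_less_cancel_left_pos mult_minus_right pi_gt_zero)
      then have "x \<in> P.cell" unfolding P.cell_def scalar_matrix_vector by simp
      then show False using that by simp
    qed
    then show ?thesis using supp by (simp add: supp_in_def)
  qed
  have restr: "(\<integral>x. h x \<partial>P.T) = (\<integral>x. h x \<partial>lebesgue)" if "\<And>x. f x = 0 \<Longrightarrow> h x = 0"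
    for h :: "real^'d \<Rightarrow> 'b::{banach, second_countable_topology}"
  proof -
    have "indicator P.cell x *\<^sub>R h x = h x" for x using out that by (auto split: split_indicator)
    then show ?thesis by (simp add: integral_restrict_space)
  qed
  have par: "(\<integral>\<^sup>+k. ennreal ((cmod (fourier_int (-1) f (\<xi> + Q.dual_pt k)))\<^sup>2) \<partial>count_space UNIV) = ennreal (P.vol * sq_norm lebesgue f)" for \<xi>
  proof -
    define g where "g x = f x * cis (- (x \<bullet> \<xi>))" for x
    have gl: "sq_int lebesgue g"
      by (rule sq_int_bound[where C=1 and g=f]) (use f cis_measurable_lebesgue[of "-1" \<xi>] in \<open>auto simp: g_def[abs_def] norm_mult\<close>)
    have gP: "sq_int P.T g"
      using gl integrable_mult_indicator[of P.cell lebesgue "\<lambda>x. (cmod (g x))\<^sup>2"]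
      by (auto simp: sq_int_def P.integrable_T_iff intro: P.measurable_T)
    have "sq_norm P.T g = sq_norm lebesgue f"
      unfolding sq_norm_def by (subst restr) (auto simp: g_def norm_mult)
    moreover have "ip P.T g (P.chr k) = fourier_int (-1) f (\<xi> + Q.dual_pt k)" for k
    proof -
      have "ip P.T g (P.chr k) = (\<integral>x. g x * cnj (P.chr k x) \<partial>lebesgue)"
        unfolding ip_def by (rule restr) (simp add: g_def)
      also have "\<dots> = fourier_int (-1) f (\<xi> + Q.dual_pt k)"
        unfolding fourier_int_def g_def P.chr_def Q.dual_pt_def scalar_matrix_vector
        by (simp add: cis_cnj mult.assoc cis_mult inner_add_right)
      finally show ?thesis .
    qed
    ultimately show ?thesis using P.parseval[OF gP] by simp
  qed
  have "(\<integral>\<^sup>+\<omega>. ennreal ((cmod (fourier_int (-1) f \<omega>))\<^sup>2) \<partial>lebesgue)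
      = (\<integral>\<^sup>+\<xi>. (\<integral>\<^sup>+k. ennreal ((cmod (fourier_int (-1) f (\<xi> + Q.dual_pt k)))\<^sup>2) \<partial>count_space UNIV) \<partial>Q.T)"
    by (rule Q.nn_integral_unfold) measurable
  also have "\<dots> = ennreal (P.vol * sq_norm lebesgue f) * ennreal Q.vol"
    unfolding par by (simp only: nn_integral_const Q.emeasure_T)
  also have "\<dots> = ennreal (two_pi_dim TYPE('d) * sq_norm lebesgue f)"
  proof -
    have "P.vol * Q.vol = two_pi_dim TYPE('d)"
      unfolding volP volQ power_mult_distrib[symmetric] using t by simp
    moreover have "P.vol * sq_norm lebesgue f * Q.vol = (P.vol * Q.vol) * sq_norm lebesgue f" by simp
    ultimately have "P.vol * sq_norm lebesgue f * Q.vol = two_pi_dim TYPE('d) * sq_norm lebesgue f" by (simp only:)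
    then show ?thesis using P.vol_pos Q.vol_pos by (subst ennreal_mult[symmetric]) auto
  qed
  finally have eq: "(\<integral>\<^sup>+\<omega>. ennreal ((cmod (fourier_int (-1) f \<omega>))\<^sup>2) \<partial>lebesgue) = ennreal (two_pi_dim TYPE('d) * sq_norm lebesgue f)" .
  then have s: "sq_int lebesgue (fourier_int (-1) f)"
    by (intro sq_int_if_nn_integral) auto
  moreover have "sq_norm lebesgue (fourier_int (-1) f) = two_pi_dim TYPE('d) * sq_norm lebesgue f"
    using sq_norm_eq_nn_integral[OF s] eq by (subst (asm) eq) (auto simp: ennreal_inj)
  ultimately show ?thesis by blast
qed

lemma sq_norm_cnj: "sq_norm M (\<lambda>x. cnj (f x)) = sq_norm M f"
  by (simp add: sq_norm_def)

text \<open>Conjugation reduces the sign \<open>s = 1\<close> to \<open>s = -1\<close> and leaves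
  norms unchanged.\<close>

lemma plancherel:
  fixes f :: "real^'d \<Rightarrow> complex"
  assumes f: "sq_int lebesgue f" and supp: "supp_in n f" and s: "s = 1 \<or> s = -1"
  shows "sq_int lebesgue (fourier_int s f)" "sq_norm lebesgue (fourier_int s f) = two_pi_dim TYPE('d) * sq_norm lebesgue f"
proof -
  have "sq_int lebesgue (fourier_int s f) \<and> sq_norm lebesgue (fourier_int s f) = two_pi_dim TYPE('d) * sq_norm lebesgue f"
  proof (cases "s = -1")
    case True then show ?thesis using plancherel_neg[OF f supp] by simp
  next
    case False
    then have s: "s = 1" using s by simp
    have "supp_in n (\<lambda>x. cnj (f x))" using supp by (simp add: supp_in_def)
    from plancherel_neg[OF sq_int_cnj[OF f] this]
    have "sq_int lebesgue (\<lambda>\<omega>. cnj (fourier_int (-1) (\<lambda>x. cnj (f x)) \<omega>)) \<and>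
        sq_norm lebesgue (\<lambda>\<omega>. cnj (fourier_int (-1) (\<lambda>x. cnj (f x)) \<omega>)) = two_pi_dim TYPE('d) * sq_norm lebesgue f"
      by (simp add: sq_int_cnj sq_norm_cnj)
    moreover have "fourier_int s f = (\<lambda>\<omega>. cnj (fourier_int (-1) (\<lambda>x. cnj (f x)) \<omega>))" unfolding s by (rule ext) (rule fourier_int_cnj)
    ultimately show ?thesis by simp
  qed
  then show "sq_int lebesgue (fourier_int s f)" "sq_norm lebesgue (fourier_int s f) = two_pi_dim TYPE('d) * sq_norm lebesgue f" by auto
qed

text \<open>Fubini; the kernel has modulus 1, so the double integral converges absolutely. The
  inversion theorem rests on this symmetry.\<close>

lemma fourier_int_adjoint:
  fixes f g :: "real^'d \<Rightarrow> complex"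
  assumes f: "integrable lebesgue f" and g: "integrable lebesgue g"
  shows "ip lebesgue (fourier_int s f) g = ip lebesgue f (fourier_int (- s) g)"
proof -
  let ?L = "lebesgue :: (real^'d) measure"
  interpret L: sigma_finite_measure ?L by (rule sigma_finite_lebesgue)
  interpret LL: pair_sigma_finite ?L ?L ..
  have [measurable]: "f \<in> borel_measurable lebesgue" "g \<in> borel_measurable lebesgue" using f g by auto
  define h where "h \<omega> x = f x * cis (s * (x \<bullet> \<omega>)) * cnj (g \<omega>)" for \<omega> x
  have "(\<lambda>p. f (snd p)) \<in> borel_measurable (?L \<Otimes>\<^sub>M ?L)"
    by (rule measurable_compose[OF measurable_snd]) fact
  moreover have "(\<lambda>p. cnj (g (fst p))) \<in> borel_measurable (?L \<Otimes>\<^sub>M ?L)"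
    by (rule measurable_compose[OF measurable_fst, of "\<lambda>x. cnj (g x)"]) measurable
  ultimately have "(\<lambda>p. f (snd p) * (case p of (\<omega>, x) \<Rightarrow> cis (s * (x \<bullet> \<omega>))) * cnj (g (fst p))) \<in> borel_measurable (?L \<Otimes>\<^sub>M ?L)"
    by (intro borel_measurable_times cis_pair_measurable)
  then have hm: "case_prod h \<in> borel_measurable (?L \<Otimes>\<^sub>M ?L)"
    by (simp add: h_def split_beta')
  have hi: "integrable (?L \<Otimes>\<^sub>M ?L) (case_prod h)"
  proof (rule LL.Fubini_integrable[OF hm])
    have "(\<integral>y. norm (case_prod h (x, y)) \<partial>?L) = norm (g x) * (\<integral>y. norm (f y) \<partial>?L)" for x
      by (simp add: h_def norm_mult mult.commute)
    then show "integrable ?L (\<lambda>x. \<integral>y. norm (case_prod h (x, y)) \<partial>?L)" using g by simp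
    show "AE x in ?L. integrable ?L (\<lambda>y. case_prod h (x, y))"
      using f by (auto simp: h_def intro!: integrable_cis)
  qed
  have "ip lebesgue (fourier_int s f) g = (\<integral>\<omega>. (\<integral>x. h \<omega> x \<partial>?L) \<partial>?L)"
    by (simp add: ip_def fourier_int_def h_def)
  also have "\<dots> = (\<integral>x. (\<integral>\<omega>. h \<omega> x \<partial>?L) \<partial>?L)" by (rule LL.Fubini_integral[OF hi, symmetric])
  also have "\<dots> = ip lebesgue f (fourier_int (- s) g)"
  proof -
    have "(\<integral>\<omega>. h \<omega> x \<partial>?L) = f x * cnj (fourier_int (- s) g x)" for x
    proof -
      have "cnj (fourier_int (- s) g x) = (\<integral>\<omega>. cnj (g \<omega>) * cis (s * (x \<bullet> \<omega>)) \<partial>?L)"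
        unfolding fourier_int_def by (subst Bochner_Integration.integral_cnj[symmetric]) (simp add: cis_cnj inner_commute)
      then show ?thesis by (simp add: h_def mult_ac flip: Bochner_Integration.integral_mult_right_zero)
    qed
    then show ?thesis by (simp add: ip_def)
  qed
  finally show ?thesis .
qed

section \<open>The Fourier transform on square-integrable functions\<close>

text \<open>A relation between representatives rather than an operator: the transform is fixed only
  up to null sets, and sums, limits and translates can be verified without reference to a particular
  choice.\<close>

definition is_fourier_L2 :: "real \<Rightarrow> (real^'d \<Rightarrow> complex) \<Rightarrow> (real^'d \<Rightarrow> complex) \<Rightarrow> bool" where
  "is_fourier_L2 s f F \<longleftrightarrow> sq_int lebesgue f \<and> sq_int lebesgue F \<and>
     (\<lambda>n. sq_norm lebesgue (\<lambda>\<omega>. fourier_int s (trunc n f) \<omega> - F \<omega>)) \<longlonglongrightarrow> 0"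

lemma trunc_tendsto:
  fixes f :: "real^'d \<Rightarrow> complex"
  assumes f: "sq_int lebesgue f"
  shows "(\<lambda>n. sq_norm lebesgue (\<lambda>x. trunc n f x - f x)) \<longlonglongrightarrow> 0"
proof -
  have "(\<lambda>n. \<integral>x. (cmod (trunc n f x - f x))\<^sup>2 \<partial>lebesgue) \<longlonglongrightarrow> (\<integral>x. 0 \<partial>(lebesgue :: (real^'d) measure))"
  proof (rule integral_dominated_convergence[where w="\<lambda>x. (cmod (f x))\<^sup>2"])
    have [measurable]: "f \<in> borel_measurable lebesgue" "trunc n f \<in> borel_measurable lebesgue" for n
      using f trunc_sq_int[OF f] by (auto simp: sq_int_def)
    show "(\<lambda>x. (cmod (trunc n f x - f x))\<^sup>2) \<in> borel_measurable lebesgue" for n by measurable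
    show "AE x in lebesgue. (\<lambda>n. (cmod (trunc n f x - f x))\<^sup>2) \<longlonglongrightarrow> 0"
    proof (rule AE_I2)
      fix x :: "real^'d"
      obtain N :: nat where N: "norm x \<le> real N" using real_arch_simple by blast
      have "\<forall>\<^sub>F n in sequentially. (cmod (trunc n f x - f x))\<^sup>2 = 0"
        using N by (intro eventually_sequentiallyI[of N]) (auto simp: trunc_def split: split_indicator)
      then show "(\<lambda>n. (cmod (trunc n f x - f x))\<^sup>2) \<longlonglongrightarrow> 0" by (rule tendsto_eventually)
    qed
  qed (use f in \<open>auto simp: sq_int_def trunc_def split: split_indicator\<close>)
  then show ?thesis by (simp add: sq_norm_def)
qed

lemma integrable_trunc: "sq_int lebesgue f \<Longrightarrow> integrable lebesgue (trunc n f)"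
  by (rule integrable_supp[OF trunc_sq_int trunc_supp])

text \<open>Differences of truncations have bounded support, so Plancherel's identity turns the
  Cauchy property of the truncations into that of their transforms.\<close>

lemma is_fourier_L2_exists:
  fixes f :: "real^'d \<Rightarrow> complex"
  assumes f: "sq_int lebesgue f" and s: "s = 1 \<or> s = -1"
  shows "\<exists>F. is_fourier_L2 s f F"
proof -
  have "\<exists>F. sq_int lebesgue F \<and> (\<lambda>n. sq_norm lebesgue (\<lambda>\<omega>. fourier_int s (trunc n f) \<omega> - F \<omega>)) \<longlonglongrightarrow> 0"
  proof (rule sq_int_complete)
    show "sq_int lebesgue (fourier_int s (trunc n f))" for n by (rule plancherel[OF trunc_sq_int[OF f] trunc_supp s])
    fix e :: real assume e: "e > 0"
    have eq: "sq_norm lebesgue (\<lambda>x. fourier_int s (trunc m f) x - fourier_int s (trunc n f) x)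
        \<le> 2 * two_pi_dim TYPE('d) * (sq_norm lebesgue (\<lambda>x. trunc m f x - f x) + sq_norm lebesgue (\<lambda>x. trunc n f x - f x))" for m n
    proof -
      have supp: "supp_in (max m n) (\<lambda>x. trunc m f x - trunc n f x)" by (auto simp: supp_in_def trunc_def)
      have "sq_norm lebesgue (\<lambda>x. fourier_int s (trunc m f) x - fourier_int s (trunc n f) x)
          = sq_norm lebesgue (fourier_int s (\<lambda>x. trunc m f x - trunc n f x))"
        by (simp add: fourier_int_diff[OF integrable_trunc[OF f] integrable_trunc[OF f], abs_def])
      also have "\<dots> = two_pi_dim TYPE('d) * sq_norm lebesgue (\<lambda>x. trunc m f x - trunc n f x)"
        by (rule plancherel(2)[OF _ supp s]) (intro sq_int_diff trunc_sq_int f)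
      also have "\<dots> \<le> two_pi_dim TYPE('d) * (2 * sq_norm lebesgue (\<lambda>x. trunc m f x - f x) + 2 * sq_norm lebesgue (\<lambda>x. trunc n f x - f x))"
        using sq_norm_add_le[of lebesgue "\<lambda>x. trunc m f x - f x" "\<lambda>x. f x - trunc n f x"] f
        by (intro mult_left_mono) (auto simp: sq_int_diff trunc_sq_int sq_norm_minus_commute[of lebesgue f])
      finally show ?thesis by (simp add: algebra_simps)
    qed
    define \<eta> where "\<eta> = e / (4 * two_pi_dim TYPE('d))"
    have \<eta>: "\<eta> > 0" using e by (simp add: \<eta>_def)
    from LIMSEQ_D[OF trunc_tendsto[OF f] \<eta>] obtain N where N: "\<And>n. n \<ge> N \<Longrightarrow> sq_norm lebesgue (\<lambda>x. trunc n f x - f x) < \<eta>"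
      by (auto simp: abs_less_iff)
    have "sq_norm lebesgue (\<lambda>x. fourier_int s (trunc m f) x - fourier_int s (trunc n f) x) < e" if "m \<ge> N" "n \<ge> N" for m n
    proof -
      have "2 * two_pi_dim TYPE('d) * (sq_norm lebesgue (\<lambda>x. trunc m f x - f x) + sq_norm lebesgue (\<lambda>x. trunc n f x - f x))
          < 2 * two_pi_dim TYPE('d) * (\<eta> + \<eta>)"
        using N[OF that(1)] N[OF that(2)] by (intro mult_strict_left_mono add_strict_mono) auto
      also have "\<dots> = e" by (simp add: \<eta>_def)
      finally show ?thesis using eq[of m n] by linarith
    qed
    then show "\<exists>N. \<forall>m\<ge>N. \<forall>n\<ge>N. sq_norm lebesgue (\<lambda>x. fourier_int s (trunc m f) x - fourier_int s (trunc n f) x) < e" by blast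
  qed
  then show ?thesis using f by (auto simp: is_fourier_L2_def)
qed

context
  fixes s :: real assumes s: "s = 1 \<or> s = -1"
begin

lemma fourier_int_trunc_sq_int: "sq_int lebesgue f \<Longrightarrow> sq_int lebesgue (fourier_int s (trunc n f))"
  by (rule plancherel[OF trunc_sq_int trunc_supp s])

lemma is_fourier_L2_norm:
  fixes f :: "real^'d \<Rightarrow> complex"
  assumes "is_fourier_L2 s f F" shows "sq_norm lebesgue F = two_pi_dim TYPE('d) * sq_norm lebesgue f"
proof -
  have f: "sq_int lebesgue f" and F: "sq_int lebesgue F" using assms by (auto simp: is_fourier_L2_def)
  have "(\<lambda>n. sq_norm lebesgue (fourier_int s (trunc n f))) \<longlonglongrightarrow> sq_norm lebesgue F"
    by (rule sq_norm_tendsto) (use assms fourier_int_trunc_sq_int in \<open>auto simp: is_fourier_L2_def\<close>)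
  moreover have "(\<lambda>n. two_pi_dim TYPE('d) * sq_norm lebesgue (trunc n f)) \<longlonglongrightarrow> two_pi_dim TYPE('d) * sq_norm lebesgue f"
    by (intro tendsto_intros sq_norm_tendsto trunc_sq_int trunc_tendsto f)
  ultimately show ?thesis
    unfolding plancherel(2)[OF trunc_sq_int[OF f] trunc_supp s] by (rule LIMSEQ_unique)
qed

lemma is_fourier_L2_add:
  assumes "is_fourier_L2 s f F" "is_fourier_L2 s g G"
  shows "is_fourier_L2 s (\<lambda>x. f x + g x) (\<lambda>\<omega>. F \<omega> + G \<omega>)"
proof -
  have q: "sq_int lebesgue f" "sq_int lebesgue F" "sq_int lebesgue g" "sq_int lebesgue G" using assms by (auto simp: is_fourier_L2_def)
  have eq: "fourier_int s (trunc n (\<lambda>x. f x + g x)) \<omega> = fourier_int s (trunc n f) \<omega> + fourier_int s (trunc n g) \<omega>" for n \<omega>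
    using fourier_int_add[OF integrable_trunc[OF q(1)] integrable_trunc[OF q(3)], of s n n \<omega>]
    by (simp add: trunc_def[abs_def] distrib_left)
  have "(\<lambda>n. sq_norm lebesgue (\<lambda>\<omega>. fourier_int s (trunc n (\<lambda>x. f x + g x)) \<omega> - (F \<omega> + G \<omega>))) \<longlonglongrightarrow> 0"
  proof (rule tendsto_sandwich[where f="\<lambda>_. 0" and h="\<lambda>n. 2 * sq_norm lebesgue (\<lambda>\<omega>. fourier_int s (trunc n f) \<omega> - F \<omega>) + 2 * sq_norm lebesgue (\<lambda>\<omega>. fourier_int s (trunc n g) \<omega> - G \<omega>)"])
    show "\<forall>\<^sub>F n in sequentially. sq_norm lebesgue (\<lambda>\<omega>. fourier_int s (trunc n (\<lambda>x. f x + g x)) \<omega> - (F \<omega> + G \<omega>))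
        \<le> 2 * sq_norm lebesgue (\<lambda>\<omega>. fourier_int s (trunc n f) \<omega> - F \<omega>) + 2 * sq_norm lebesgue (\<lambda>\<omega>. fourier_int s (trunc n g) \<omega> - G \<omega>)"
    proof (rule always_eventually, rule allI)
      fix n
      show "sq_norm lebesgue (\<lambda>\<omega>. fourier_int s (trunc n (\<lambda>x. f x + g x)) \<omega> - (F \<omega> + G \<omega>))
        \<le> 2 * sq_norm lebesgue (\<lambda>\<omega>. fourier_int s (trunc n f) \<omega> - F \<omega>) + 2 * sq_norm lebesgue (\<lambda>\<omega>. fourier_int s (trunc n g) \<omega> - G \<omega>)"
        using sq_norm_add_le[OF sq_int_diff[OF fourier_int_trunc_sq_int[OF q(1)] q(2)] sq_int_diff[OF fourier_int_trunc_sq_int[OF q(3)] q(4)], of n n]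
        by (simp add: eq algebra_simps)
    qed
    have "(\<lambda>n. 2 * sq_norm lebesgue (\<lambda>\<omega>. fourier_int s (trunc n f) \<omega> - F \<omega>) + 2 * sq_norm lebesgue (\<lambda>\<omega>. fourier_int s (trunc n g) \<omega> - G \<omega>)) \<longlonglongrightarrow> 2 * 0 + 2 * 0"
      using assms unfolding is_fourier_L2_def by (intro tendsto_intros) auto
    then show "(\<lambda>n. 2 * sq_norm lebesgue (\<lambda>\<omega>. fourier_int s (trunc n f) \<omega> - F \<omega>) + 2 * sq_norm lebesgue (\<lambda>\<omega>. fourier_int s (trunc n g) \<omega> - G \<omega>)) \<longlonglongrightarrow> 0" by simp
  qed auto
  then show ?thesis using q by (simp add: is_fourier_L2_def sq_int_add)
qed

lemma is_fourier_L2_scale: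
  assumes "is_fourier_L2 s f F" shows "is_fourier_L2 s (\<lambda>x. c * f x) (\<lambda>\<omega>. c * F \<omega>)"
proof -
  have eq: "fourier_int s (trunc n (\<lambda>x. c * f x)) \<omega> = c * fourier_int s (trunc n f) \<omega>" for n \<omega>
    using fourier_int_scale[of s c "trunc n f" \<omega>] by (simp add: trunc_def[abs_def] mult.left_commute)
  have "(\<lambda>n. (cmod c)\<^sup>2 * sq_norm lebesgue (\<lambda>\<omega>. fourier_int s (trunc n f) \<omega> - F \<omega>)) \<longlonglongrightarrow> (cmod c)\<^sup>2 * 0"
    using assms unfolding is_fourier_L2_def by (intro tendsto_intros) auto
  then have "(\<lambda>n. sq_norm lebesgue (\<lambda>\<omega>. c * (fourier_int s (trunc n f) \<omega> - F \<omega>))) \<longlonglongrightarrow> 0" by (simp add: sq_norm_scale)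
  then show ?thesis using assms by (simp add: is_fourier_L2_def sq_int_scale eq right_diff_distrib)
qed

lemma is_fourier_L2_zero: "is_fourier_L2 s (\<lambda>x. 0) (\<lambda>\<omega>. 0)"
  by (simp add: is_fourier_L2_def fourier_int_def trunc_def[abs_def] sq_norm_def)

lemma is_fourier_L2_sum:
  "(\<And>i. i \<in> I \<Longrightarrow> is_fourier_L2 s (f i) (F i)) \<Longrightarrow> is_fourier_L2 s (\<lambda>x. \<Sum>i\<in>I. f i x) (\<lambda>\<omega>. \<Sum>i\<in>I. F i \<omega>)"
  by (induction I rule: infinite_finite_induct) (auto simp: is_fourier_L2_zero intro: is_fourier_L2_add)

lemma is_fourier_L2_cong:
  assumes "is_fourier_L2 s f F" and g: "g \<in> borel_measurable lebesgue" "AE x in lebesgue. f x = g x"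
    and G: "G \<in> borel_measurable lebesgue" "AE x in lebesgue. F x = G x"
  shows "is_fourier_L2 s g G"
proof -
  have q: "sq_int lebesgue f" "sq_int lebesgue F" using assms by (auto simp: is_fourier_L2_def)
  have [measurable]: "f \<in> borel_measurable lebesgue" "F \<in> borel_measurable lebesgue" using q by (auto simp: sq_int_def)
  have [measurable]: "trunc n f \<in> borel_measurable lebesgue" for n using trunc_sq_int[OF q(1)] by (simp add: sq_int_def)
  have eq: "fourier_int s (trunc n g) \<omega> = fourier_int s (trunc n f) \<omega>" for n \<omega>
    unfolding fourier_int_def
  proof (rule integral_cong_AE)
    show "AE x in lebesgue. trunc n g x * cis (s * (x \<bullet> \<omega>)) = trunc n f x * cis (s * (x \<bullet> \<omega>))"
      using g(2) by eventually_elim (simp add: trunc_def)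
  qed (use g in measurable)
  have "sq_norm lebesgue (\<lambda>\<omega>. fourier_int s (trunc n g) \<omega> - G \<omega>) = sq_norm lebesgue (\<lambda>\<omega>. fourier_int s (trunc n f) \<omega> - F \<omega>)" for n
    unfolding eq using G by (intro sq_norm_cong_AE) auto
  then show ?thesis
    using assms sq_int_cong_AE[OF q(1) g] sq_int_cong_AE[OF q(2) G] by (simp add: is_fourier_L2_def)
qed

text \<open>Modulation commutes with truncation, which translation does not. The system is therefore
  described from its Fourier side: translates of splines and wavelets appear as transforms, with
  \<open>s = 1\<close>, of modulated functions.\<close>

lemma is_fourier_L2_modulate:
  assumes "is_fourier_L2 s f F"
  shows "is_fourier_L2 s (\<lambda>x. f x * cis (- s * (x \<bullet> \<beta>))) (\<lambda>\<omega>. F (\<omega> - \<beta>))"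
proof -
  have q: "sq_int lebesgue f" "sq_int lebesgue F" using assms by (auto simp: is_fourier_L2_def)
  have [measurable]: "f \<in> borel_measurable lebesgue" "F \<in> borel_measurable lebesgue" using q by (auto simp: sq_int_def)
  have [measurable]: "trunc n f \<in> borel_measurable lebesgue" for n using trunc_sq_int[OF q(1)] by (simp add: sq_int_def)
  have tr: "sq_norm lebesgue (\<lambda>\<omega>. h (\<omega> - \<beta>)) = sq_norm lebesgue h" if "h \<in> borel_measurable lebesgue" for h
    using integral_translation[of "\<lambda>x. (cmod (h x))\<^sup>2" "- \<beta>"] that by (simp add: sq_norm_def)
  have Fm: "(\<lambda>\<omega>. F (\<omega> - \<beta>)) \<in> borel_measurable lebesgue"
    using borel_measurable_translation[of F "- \<beta>"] by simp
  have s1: "sq_int lebesgue (\<lambda>\<omega>. F (\<omega> - \<beta>))"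
  proof (rule sq_int_if_nn_integral[OF Fm])
    have "(\<integral>\<^sup>+ x. ennreal ((cmod (F (x - \<beta>)))\<^sup>2) \<partial>lebesgue) = (\<integral>\<^sup>+ x. ennreal ((cmod (F x))\<^sup>2) \<partial>lebesgue)"
      using nn_integral_translation[of "\<lambda>x. ennreal ((cmod (F x))\<^sup>2)" "- \<beta>"] by simp
    also have "\<dots> < \<infinity>" using sq_norm_eq_nn_integral[OF q(2)] by (metis ennreal_less_top infinity_ennreal_def)
    finally show "(\<integral>\<^sup>+ x. ennreal ((cmod (F (x - \<beta>)))\<^sup>2) \<partial>lebesgue) < \<infinity>" .
  qed
  have s2: "sq_int lebesgue (\<lambda>x. f x * cis (- s * (x \<bullet> \<beta>)))"
    by (rule sq_int_bound[where C=1 and g=f])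
      (use q borel_measurable_times[OF _ cis_measurable_lebesgue[of "-s" \<beta>], of f] in \<open>auto simp: norm_mult\<close>)
  have "fourier_int s (trunc n (\<lambda>x. f x * cis (- s * (x \<bullet> \<beta>)))) \<omega> = fourier_int s (trunc n f) (\<omega> - \<beta>)" for n \<omega>
    unfolding fourier_int_def trunc_def
    by (intro Bochner_Integration.integral_cong refl) (simp add: mult.assoc cis_mult inner_diff_right algebra_simps)
  then have "sq_norm lebesgue (\<lambda>\<omega>. fourier_int s (trunc n (\<lambda>x. f x * cis (- s * (x \<bullet> \<beta>)))) \<omega> - F (\<omega> - \<beta>))
      = sq_norm lebesgue (\<lambda>\<omega>. fourier_int s (trunc n f) \<omega> - F \<omega>)" for n
    using tr[of "\<lambda>\<omega>. fourier_int s (trunc n f) \<omega> - F \<omega>"] by simp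
  then show ?thesis using assms s1 s2 by (simp add: is_fourier_L2_def)
qed

text \<open>The symmetry of the Fourier kernel in the limit. Both arguments vary with
  \<open>n\<close>, so one of them is replaced by its limit at the cost of a Cauchy-Schwarz term
  that tends to 0.\<close>

lemma is_fourier_L2_adjoint:
  assumes f: "is_fourier_L2 s f F" and g: "is_fourier_L2 (- s) g G"
  shows "ip lebesgue F g = ip lebesgue f G"
proof -
  have q: "sq_int lebesgue f" "sq_int lebesgue F" "sq_int lebesgue g" "sq_int lebesgue G" using assms by (auto simp: is_fourier_L2_def)
  have s': "- s = 1 \<or> - s = -1" using s by auto
  have qG: "sq_int lebesgue (fourier_int (- s) (trunc n g))" for n by (rule plancherel[OF trunc_sq_int[OF q(3)] trunc_supp s'])
  have ipt: "(\<lambda>n. ip lebesgue h (u n)) \<longlonglongrightarrow> ip lebesgue h k"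
    if "\<And>n. sq_int lebesgue (u n)" "sq_int lebesgue k" "sq_int lebesgue h" "(\<lambda>n. sq_norm lebesgue (\<lambda>x. u n x - k x)) \<longlonglongrightarrow> 0" for h k u
    using tendsto_cnj[OF ip_tendsto[OF that(1,2,3,4)]] by (simp add: ip_commute[of _ h])
  have "(\<lambda>n. ip lebesgue (fourier_int s (trunc n f)) (trunc n g)) \<longlonglongrightarrow> ip lebesgue F g"
  proof -
    have "(\<lambda>n. ip lebesgue (fourier_int s (trunc n f)) (trunc n g) - ip lebesgue (fourier_int s (trunc n f)) g) \<longlonglongrightarrow> 0"
    proof (rule tendsto_norm_zero_cancel, rule tendsto_sandwich[where f="\<lambda>_. 0" and
        h="\<lambda>n. sqrt (sq_norm lebesgue (fourier_int s (trunc n f)) * sq_norm lebesgue (\<lambda>x. trunc n g x - g x))"])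
      show "\<forall>\<^sub>F n in sequentially. norm (ip lebesgue (fourier_int s (trunc n f)) (trunc n g) - ip lebesgue (fourier_int s (trunc n f)) g)
          \<le> sqrt (sq_norm lebesgue (fourier_int s (trunc n f)) * sq_norm lebesgue (\<lambda>x. trunc n g x - g x))"
        using ip_cauchy_schwarz[OF fourier_int_trunc_sq_int[OF q(1)] sq_int_diff[OF trunc_sq_int[OF q(3)] q(3)]]
        by (intro always_eventually allI real_le_rsqrt) (simp add: ip_diff_right fourier_int_trunc_sq_int trunc_sq_int q)
      have "(\<lambda>n. sqrt (sq_norm lebesgue (fourier_int s (trunc n f)) * sq_norm lebesgue (\<lambda>x. trunc n g x - g x))) \<longlonglongrightarrow> sqrt (sq_norm lebesgue F * 0)"
        by (intro tendsto_intros sq_norm_tendsto trunc_tendsto q fourier_int_trunc_sq_int) (use f in \<open>auto simp: is_fourier_L2_def\<close>)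
      then show "(\<lambda>n. sqrt (sq_norm lebesgue (fourier_int s (trunc n f)) * sq_norm lebesgue (\<lambda>x. trunc n g x - g x))) \<longlonglongrightarrow> 0" by simp
    qed auto
    moreover have "(\<lambda>n. ip lebesgue (fourier_int s (trunc n f)) g) \<longlonglongrightarrow> ip lebesgue F g"
      by (rule ip_tendsto) (use f q fourier_int_trunc_sq_int in \<open>auto simp: is_fourier_L2_def\<close>)
    ultimately show ?thesis by (rule Lim_transform[rotated])
  qed
  moreover have "(\<lambda>n. ip lebesgue (trunc n f) (fourier_int (- s) (trunc n g))) \<longlonglongrightarrow> ip lebesgue f G"
  proof -
    have "(\<lambda>n. ip lebesgue (trunc n f) (fourier_int (- s) (trunc n g)) - ip lebesgue f (fourier_int (- s) (trunc n g))) \<longlonglongrightarrow> 0"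
    proof (rule tendsto_norm_zero_cancel, rule tendsto_sandwich[where f="\<lambda>_. 0" and
        h="\<lambda>n. sqrt (sq_norm lebesgue (\<lambda>x. trunc n f x - f x) * sq_norm lebesgue (fourier_int (- s) (trunc n g)))"])
      show "\<forall>\<^sub>F n in sequentially. norm (ip lebesgue (trunc n f) (fourier_int (- s) (trunc n g)) - ip lebesgue f (fourier_int (- s) (trunc n g)))
          \<le> sqrt (sq_norm lebesgue (\<lambda>x. trunc n f x - f x) * sq_norm lebesgue (fourier_int (- s) (trunc n g)))"
        using ip_cauchy_schwarz[OF sq_int_diff[OF trunc_sq_int[OF q(1)] q(1)] qG]
        by (intro always_eventually allI real_le_rsqrt) (simp add: ip_diff_left qG trunc_sq_int q)
      have "(\<lambda>n. sqrt (sq_norm lebesgue (\<lambda>x. trunc n f x - f x) * sq_norm lebesgue (fourier_int (- s) (trunc n g)))) \<longlonglongrightarrow> sqrt (0 * sq_norm lebesgue G)"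
        by (intro tendsto_intros sq_norm_tendsto trunc_tendsto q qG) (use g in \<open>auto simp: is_fourier_L2_def\<close>)
      then show "(\<lambda>n. sqrt (sq_norm lebesgue (\<lambda>x. trunc n f x - f x) * sq_norm lebesgue (fourier_int (- s) (trunc n g)))) \<longlonglongrightarrow> 0" by simp
    qed auto
    moreover have "(\<lambda>n. ip lebesgue f (fourier_int (- s) (trunc n g))) \<longlonglongrightarrow> ip lebesgue f G"
      by (rule ipt) (use g q qG in \<open>auto simp: is_fourier_L2_def\<close>)
    ultimately show ?thesis by (rule Lim_transform[rotated])
  qed
  moreover have "ip lebesgue (fourier_int s (trunc n f)) (trunc n g) = ip lebesgue (trunc n f) (fourier_int (- s) (trunc n g))" for n
    by (intro fourier_int_adjoint integrable_trunc q)
  ultimately show ?thesis by (simp add: LIMSEQ_unique)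
qed

end

text \<open>With c = (2 pi)^d, adjointness gives <G, f> = |F|^2, and Plancherel gives |F|^2 = c
  |f|^2 and |G|^2 = c^2 |f|^2, so that |G - c f|^2 expands to 0. This replaces the usual approximate
  identity.\<close>

lemma is_fourier_L2_inversion:
  fixes f :: "real^'d \<Rightarrow> complex"
  assumes s: "s = 1 \<or> s = -1" and f: "is_fourier_L2 s f F" and g: "is_fourier_L2 (- s) F G"
  shows "AE x in lebesgue. G x = of_real (two_pi_dim TYPE('d)) * f x"
proof -
  define c where "c = two_pi_dim TYPE('d)"
  have s': "- s = 1 \<or> - s = -1" using s by auto
  have q: "sq_int lebesgue f" "sq_int lebesgue F" "sq_int lebesgue G" using assms by (auto simp: is_fourier_L2_def)
  have nF: "sq_norm lebesgue F = c * sq_norm lebesgue f" unfolding c_def by (rule is_fourier_L2_norm[OF s f])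
  have nG: "sq_norm lebesgue G = c * sq_norm lebesgue F" unfolding c_def by (rule is_fourier_L2_norm[OF s' g])
  have "ip lebesgue G f = cnj (ip lebesgue f G)" by (rule ip_commute)
  also have "ip lebesgue f G = ip lebesgue F F" by (rule is_fourier_L2_adjoint[OF s f g, symmetric])
  finally have ipG: "ip lebesgue G f = of_real (sq_norm lebesgue F)" by (simp add: ip_self)
  have "sq_norm lebesgue (\<lambda>x. G x - of_real c * f x) = sq_norm lebesgue G - 2 * Re (cnj (of_real c) * ip lebesgue G f) + c\<^sup>2 * sq_norm lebesgue f"
    by (subst sq_norm_diff[OF q(3) sq_int_scale[OF q(1)]]) (simp add: ip_scale_right sq_norm_scale)
  also have "\<dots> = 0" unfolding ipG nG nF by (simp add: power2_eq_square)
  finally show ?thesis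
    using sq_norm_eq_0_iff[OF sq_int_diff[OF q(3) sq_int_scale[OF q(1)]]] by (simp add: c_def)
qed

lemma L2_iff_sq_int: "f \<in> L2 \<longleftrightarrow> sq_int lebesgue f"
  by (simp add: L2_def sq_int_def)

lemma L2_norm_sq_norm: "L2_norm f = sqrt (sq_norm lebesgue f)"
  by (simp add: L2_norm_def sq_norm_def)

lemma L2_norm_square: "(L2_norm f)\<^sup>2 = sq_norm lebesgue f"
  by (simp add: L2_norm_sq_norm)

lemma converges_L2_iff:
  assumes "\<And>n. sq_int lebesgue (u n)" "sq_int lebesgue F"
  shows "converges_L2 u F \<longleftrightarrow> (\<lambda>n. sq_norm lebesgue (\<lambda>x. u n x - F x)) \<longlonglongrightarrow> 0"
  unfolding converges_L2_def using assms
  by (simp add: sq_norm_eq_nn_integral[symmetric] sq_int_diff ennreal_0[symmetric] tendsto_ennreal_iff del: ennreal_0)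

lemma truncated_fourier_integral:
  "(LINT x:cball 0 (real n)|lebesgue. f x * exp (- \<i> * of_real (x \<bullet> \<omega>))) = fourier_int (-1) (trunc n f) \<omega>"
  "(LINT x:cball 0 (real n)|lebesgue. f x * exp (\<i> * of_real (\<omega> \<bullet> x))) = fourier_int 1 (trunc n f) \<omega>"
  unfolding set_lebesgue_integral_def fourier_int_def trunc_def
  by (intro Bochner_Integration.integral_cong refl; simp add: cis_conv_exp inner_commute split: split_indicator)+

lemma is_fourier_L2_fourier_L2:
  assumes f: "sq_int lebesgue f" shows "is_fourier_L2 (-1) f (fourier_L2 f)"
proof -
  have s: "(-1::real) = 1 \<or> (-1::real) = -1" by simp
  obtain F where F: "is_fourier_L2 (-1) f F" using is_fourier_L2_exists[OF f s] by blast
  define P where "P F \<longleftrightarrow> F \<in> L2 \<and> converges_L2 (\<lambda>n. fourier_int (-1) (trunc n f)) F" for F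
  have iff: "P F \<longleftrightarrow> is_fourier_L2 (-1) f F" for F
    using f converges_L2_iff[OF fourier_int_trunc_sq_int[OF s f], of F] by (auto simp: P_def is_fourier_L2_def L2_iff_sq_int)
  have "fourier_L2 f = (SOME F. P F)"
    unfolding fourier_L2_def P_def truncated_fourier_integral ..
  moreover have "P (SOME F. P F)" using F iff by (metis someI_ex)
  ultimately show ?thesis using iff by simp
qed

text \<open>\<open>inverse_fourier_L2\<close> is normalized by (2 pi)^d and
  \<open>fourier_int\<close> is not, which accounts for the factor.\<close>

lemma is_fourier_L2_inverse_fourier_L2:
  fixes f :: "real^'d \<Rightarrow> complex"
  assumes f: "sq_int lebesgue f"
  shows "is_fourier_L2 1 f (\<lambda>x. of_real (two_pi_dim TYPE('d)) * inverse_fourier_L2 f x)"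
proof -
  define c where "c = complex_of_real (two_pi_dim TYPE('d))"
  have c: "c \<noteq> 0" by (simp add: c_def)
  have s: "(1::real) = 1 \<or> (1::real) = -1" by simp
  obtain F where F: "is_fourier_L2 1 f F" using is_fourier_L2_exists[OF f s] by blast
  define P where "P F \<longleftrightarrow> F \<in> L2 \<and> converges_L2 (\<lambda>n x. fourier_int 1 (trunc n f) x / c) F" for F
  have iff: "P F \<longleftrightarrow> is_fourier_L2 1 f (\<lambda>x. c * F x)" for F
  proof -
    have sq: "sq_int lebesgue (\<lambda>x. c * F x) \<longleftrightarrow> sq_int lebesgue F"
      using sq_int_scale[of lebesgue "\<lambda>x. c * F x" "1 / c"] sq_int_scale[of lebesgue F c] c by auto
    have q: "sq_int lebesgue (\<lambda>x. fourier_int 1 (trunc n f) x / c)" for n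
      using sq_int_scale[OF fourier_int_trunc_sq_int[OF s f], where c="1 / c"] by simp
    have "sq_norm lebesgue (\<lambda>x. fourier_int 1 (trunc n f) x - c * F x)
        = (cmod c)\<^sup>2 * sq_norm lebesgue (\<lambda>x. fourier_int 1 (trunc n f) x / c - F x)" for n
      using c by (subst sq_norm_scale[symmetric]) (simp add: right_diff_distrib)
    then have "(\<lambda>n. sq_norm lebesgue (\<lambda>x. fourier_int 1 (trunc n f) x - c * F x)) \<longlonglongrightarrow> 0 \<longleftrightarrow>
        (\<lambda>n. sq_norm lebesgue (\<lambda>x. fourier_int 1 (trunc n f) x / c - F x)) \<longlonglongrightarrow> 0"
      using c tendsto_mult_left_iff[of "(cmod c)\<^sup>2" _ 0] by simp
    then show ?thesis
      using f converges_L2_iff[OF q, of F] by (auto simp: P_def is_fourier_L2_def L2_iff_sq_int sq)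
  qed
  have "inverse_fourier_L2 f = (SOME F. P F)"
    unfolding inverse_fourier_L2_def P_def truncated_fourier_integral c_def ..
  moreover have "P (\<lambda>x. F x / c)" using F c by (simp add: iff)
  then have "P (SOME F. P F)" by (rule someI[of P])
  ultimately show ?thesis using iff by (simp add: c_def)
qed

text \<open>The truncated integrals ignore null sets, so both sides are choices from the same
  predicate. Hence the equality is literal and not only almost everywhere.\<close>

lemma inverse_fourier_L2_cong:
  assumes [measurable]: "F \<in> borel_measurable lebesgue" "G \<in> borel_measurable lebesgue" and eq: "AE x in lebesgue. F x = G x"
  shows "inverse_fourier_L2 F = inverse_fourier_L2 G"
proof -
  have "fourier_int 1 (trunc n F) x = fourier_int 1 (trunc n G) x" for n x
    unfolding fourier_int_def
  proof (rule integral_cong_AE)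
    show "AE y in lebesgue. trunc n F y * cis (1 * (y \<bullet> x)) = trunc n G y * cis (1 * (y \<bullet> x))"
      using eq by eventually_elim (simp add: trunc_def)
  qed measurable
  then show ?thesis
    unfolding inverse_fourier_L2_def truncated_fourier_integral by simp
qed

lemma fourier_inverse_fourier_L2:
  assumes F: "sq_int lebesgue F"
  shows "sq_int lebesgue (inverse_fourier_L2 F)" "AE \<omega> in lebesgue. fourier_L2 (inverse_fourier_L2 F) \<omega> = F \<omega>"
proof -
  define c where "c = complex_of_real (two_pi_dim TYPE('a))"
  have c: "c \<noteq> 0" by (simp add: c_def)
  have i: "is_fourier_L2 1 F (\<lambda>x. c * inverse_fourier_L2 F x)" unfolding c_def by (rule is_fourier_L2_inverse_fourier_L2[OF F])
  then have "sq_int lebesgue (\<lambda>x. c * inverse_fourier_L2 F x)" by (simp add: is_fourier_L2_def)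
  from sq_int_scale[OF this, of "1 / c"] show q: "sq_int lebesgue (inverse_fourier_L2 F)" using c by simp
  have "is_fourier_L2 (- 1) (\<lambda>x. c * inverse_fourier_L2 F x) (\<lambda>\<omega>. c * fourier_L2 (inverse_fourier_L2 F) \<omega>)"
    by (intro is_fourier_L2_scale is_fourier_L2_fourier_L2 q) simp
  from is_fourier_L2_inversion[OF _ i this] show "AE \<omega> in lebesgue. fourier_L2 (inverse_fourier_L2 F) \<omega> = F \<omega>"
    using c by (simp add: c_def)
qed

section \<open>Riesz bases\<close>

text \<open>The transform is a multiple of an isometry, so the bounds carry over. For density every
  \<open>f\<close> must be reached: inversion exhibits it, up to the factor (2 pi)^d, as the
  transform of its own Fourier transform.\<close>

lemma riesz_basis_L2_transfer:
  fixes E e :: "'i \<Rightarrow> real^'d \<Rightarrow> complex"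
  assumes R: "riesz_basis_L2 E I"
    and e: "\<And>i. i \<in> I \<Longrightarrow> is_fourier_L2 1 (E i) (\<lambda>x. of_real (two_pi_dim TYPE('d)) * e i x)"
  shows "riesz_basis_L2 e I"
proof -
  define c where "c = two_pi_dim TYPE('d)"
  have c: "c > 0" by (simp add: c_def)
  have s: "(1::real) = 1 \<or> (1::real) = -1" "(-1::real) = 1 \<or> (-1::real) = -1" by simp_all
  have E: "sq_int lebesgue (E i)" if "i \<in> I" for i using e[OF that] by (simp add: is_fourier_L2_def)
  have comb: "is_fourier_L2 1 (\<lambda>\<omega>. \<Sum>i\<in>F. a i * E i \<omega>) (\<lambda>x. of_real c * (\<Sum>i\<in>F. a i * e i x))" if "F \<subseteq> I" for F a
  proof -
    have "is_fourier_L2 1 (\<lambda>\<omega>. \<Sum>i\<in>F. a i * E i \<omega>) (\<lambda>x. \<Sum>i\<in>F. a i * (of_real c * e i x))"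
      unfolding c_def by (intro is_fourier_L2_sum is_fourier_L2_scale e s) (use that in auto)
    then show ?thesis by (simp add: sum_distrib_left mult_ac)
  qed
  \<comment> \<open>The factor \<open>c\<close> enters squared on the side of \<open>h\<close> and
    once through Plancherel, which leaves a division by \<open>c\<close>.\<close>
  have norm: "sq_norm lebesgue h = sq_norm lebesgue H / c" if "is_fourier_L2 1 H (\<lambda>x. of_real c * h x)" for h H :: "real^'d \<Rightarrow> complex"
    using is_fourier_L2_norm[OF s(1) that] c unfolding sq_norm_scale c_def[symmetric] by (simp add: field_simps power2_eq_square)
  show ?thesis
    unfolding riesz_basis_L2_def
  proof (intro conjI ballI allI impI)
    fix i assume "i \<in> I"
    then have "sq_int lebesgue (\<lambda>x. of_real c * e i x)" using e by (simp add: is_fourier_L2_def c_def)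
    from sq_int_scale[OF this, of "1 / of_real c"] show "e i \<in> L2" using c by (simp add: L2_iff_sq_int)
  next
    fix f :: "real^'d \<Rightarrow> complex" and \<epsilon> :: real assume f: "f \<in> L2" and \<epsilon>: "\<epsilon> > 0"
    then have fq: "sq_int lebesgue f" by (simp add: L2_iff_sq_int)
    define H where "H = fourier_L2 f"
    have fH: "is_fourier_L2 (-1) f H" unfolding H_def by (rule is_fourier_L2_fourier_L2[OF fq])
    then have H: "sq_int lebesgue H" by (simp add: is_fourier_L2_def)
    obtain G where G: "is_fourier_L2 1 H G" using is_fourier_L2_exists[OF H s(1)] by blast
    have "AE x in lebesgue. G x = of_real c * f x"
      unfolding c_def by (rule is_fourier_L2_inversion[OF s(2) fH]) (use G in simp)
    then have Hf: "is_fourier_L2 1 H (\<lambda>x. of_real c * f x)"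
      using sq_int_scale[OF fq, of c] H by (intro is_fourier_L2_cong[OF s(1) G]) (auto simp: sq_int_def)
    have "\<epsilon> * sqrt c > 0" using \<epsilon> c by simp
    then obtain F a where F: "finite F" "F \<subseteq> I" "L2_norm (\<lambda>x. H x - (\<Sum>i\<in>F. a i * E i x)) < \<epsilon> * sqrt c"
      using H R[unfolded riesz_basis_L2_def, THEN conjunct2, THEN conjunct1, rule_format, of H "\<epsilon> * sqrt c"]
      by (auto simp: L2_iff_sq_int)
    have "is_fourier_L2 1 (\<lambda>x. H x + (-1) * (\<Sum>i\<in>F. a i * E i x)) (\<lambda>x. of_real c * f x + (-1) * (of_real c * (\<Sum>i\<in>F. a i * e i x)))"
      by (intro is_fourier_L2_add is_fourier_L2_scale s Hf comb F)
    then have "is_fourier_L2 1 (\<lambda>x. H x - (\<Sum>i\<in>F. a i * E i x)) (\<lambda>x. of_real c * (f x - (\<Sum>i\<in>F. a i * e i x)))"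
      by (simp add: right_diff_distrib)
    from norm[OF this] have "L2_norm (\<lambda>x. f x - (\<Sum>i\<in>F. a i * e i x)) = L2_norm (\<lambda>x. H x - (\<Sum>i\<in>F. a i * E i x)) / sqrt c"
      by (simp add: L2_norm_sq_norm real_sqrt_divide)
    then have "L2_norm (\<lambda>x. f x - (\<Sum>i\<in>F. a i * e i x)) < \<epsilon>" using F(3) c by (simp add: divide_less_eq)
    then show "\<exists>F c. finite F \<and> F \<subseteq> I \<and> L2_norm (\<lambda>x. f x - (\<Sum>i\<in>F. c i * e i x)) < \<epsilon>"
      using F(1,2) by (intro exI[of _ F] exI[of _ a]) simp
  next
    obtain A B where AB0: "0 < A \<and> (\<forall>F a. finite F \<and> F \<subseteq> I \<longrightarrow>
        A * (\<Sum>i\<in>F. (cmod (a i))\<^sup>2) \<le> sq_norm lebesgue (\<lambda>x. \<Sum>i\<in>F. a i * E i x) \<and>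
        sq_norm lebesgue (\<lambda>x. \<Sum>i\<in>F. a i * E i x) \<le> B * (\<Sum>i\<in>F. (cmod (a i))\<^sup>2))"
      using R[unfolded riesz_basis_L2_def L2_norm_square, THEN conjunct2, THEN conjunct2] by (elim exE)
    then have AB: "0 < A" "\<And>F a. finite F \<Longrightarrow> F \<subseteq> I \<Longrightarrow>
        A * (\<Sum>i\<in>F. (cmod (a i))\<^sup>2) \<le> sq_norm lebesgue (\<lambda>x. \<Sum>i\<in>F. a i * E i x) \<and>
        sq_norm lebesgue (\<lambda>x. \<Sum>i\<in>F. a i * E i x) \<le> B * (\<Sum>i\<in>F. (cmod (a i))\<^sup>2)"
      by simp_all
    show "\<exists>A B. 0 < A \<and> (\<forall>F a. finite F \<and> F \<subseteq> I \<longrightarrow>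
        A * (\<Sum>i\<in>F. (cmod (a i))\<^sup>2) \<le> (L2_norm (\<lambda>x. \<Sum>i\<in>F. a i * e i x))\<^sup>2 \<and>
        (L2_norm (\<lambda>x. \<Sum>i\<in>F. a i * e i x))\<^sup>2 \<le> B * (\<Sum>i\<in>F. (cmod (a i))\<^sup>2))"
    proof (rule exI[of _ "A / c"], rule exI[of _ "B / c"], intro conjI allI impI)
      fix F and a :: "'i \<Rightarrow> complex" assume F: "finite F \<and> F \<subseteq> I"
      show "A / c * (\<Sum>i\<in>F. (cmod (a i))\<^sup>2) \<le> (L2_norm (\<lambda>x. \<Sum>i\<in>F. a i * e i x))\<^sup>2"
        "(L2_norm (\<lambda>x. \<Sum>i\<in>F. a i * e i x))\<^sup>2 \<le> B / c * (\<Sum>i\<in>F. (cmod (a i))\<^sup>2)"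
        unfolding L2_norm_square norm[OF comb[OF conjunct2[OF F]]]
        using AB(2)[of F a] F c by (simp_all add: divide_right_mono)
    qed (use AB c in simp)
  qed
qed

text \<open>By the projection argument, density of the span may be replaced by the absence of
  nonzero functions orthogonal to the family.\<close>

lemma riesz_basis_L2I:
  fixes E :: "'i \<Rightarrow> real^'d \<Rightarrow> complex"
  assumes E: "\<And>i. i \<in> I \<Longrightarrow> sq_int lebesgue (E i)"
    and complete: "\<And>g. sq_int lebesgue g \<Longrightarrow> (\<And>i. i \<in> I \<Longrightarrow> ip lebesgue g (E i) = 0) \<Longrightarrow> AE x in lebesgue. g x = 0"
    and A: "A > 0"
    and bounds: "\<And>F c. finite F \<Longrightarrow> F \<subseteq> I \<Longrightarrow>
        A * (\<Sum>i\<in>F. (cmod (c i))\<^sup>2) \<le> sq_norm lebesgue (\<lambda>x. \<Sum>i\<in>F. c i * E i x) \<and>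
        sq_norm lebesgue (\<lambda>x. \<Sum>i\<in>F. c i * E i x) \<le> B * (\<Sum>i\<in>F. (cmod (c i))\<^sup>2)"
  shows "riesz_basis_L2 E I"
proof -
  have dense: "\<exists>F c. finite F \<and> F \<subseteq> I \<and> L2_norm (\<lambda>x. f x - (\<Sum>i\<in>F. c i * E i x)) < \<epsilon>"
    if f: "f \<in> L2" and \<epsilon>: "\<epsilon> > 0" for f \<epsilon>
  proof (rule ccontr)
    assume neg: "\<not> ?thesis"
    have ge: "\<epsilon>\<^sup>2 \<le> sq_norm lebesgue (\<lambda>x. f x - q x)" if "q \<in> lincomb E I" for q
    proof -
      have "\<epsilon> \<le> L2_norm (\<lambda>x. f x - q x)" using that neg by (auto simp: lincomb_def not_less)
      then show ?thesis using \<epsilon> by (metis L2_norm_square less_imp_le power_mono)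
    qed
    have "\<exists>g. sq_int lebesgue g \<and> sq_norm lebesgue g > 0 \<and> (\<forall>s\<in>lincomb E I. ip lebesgue g s = 0)"
    proof (rule exists_orthogonal_if_not_dense[where f=f and \<delta>="\<epsilon>\<^sup>2"])
      show "sq_int lebesgue q" if "q \<in> lincomb E I" for q using lincomb_sq_int[OF that E] .
    qed (use f \<epsilon> ge in \<open>auto simp: L2_iff_sq_int intro: lincomb_zero lincomb_add lincomb_scale\<close>)
    then obtain g where g: "sq_int lebesgue g" "sq_norm lebesgue g > 0" "\<forall>s\<in>lincomb E I. ip lebesgue g s = 0"
      by (elim exE conjE)
    have "E i \<in> lincomb E I" if "i \<in> I" for i
      unfolding lincomb_def using that by (intro CollectI exI[of _ "{i}"] exI[of _ "\<lambda>_. 1"]) auto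
    then have "AE x in lebesgue. g x = 0" using g by (intro complete) auto
    then show False using sq_norm_eq_0_iff[OF g(1)] g(2) by simp
  qed
  have "\<exists>A B. 0 < A \<and> (\<forall>F c. finite F \<and> F \<subseteq> I \<longrightarrow>
        A * (\<Sum>i\<in>F. (cmod (c i))\<^sup>2) \<le> sq_norm lebesgue (\<lambda>x. \<Sum>i\<in>F. c i * E i x) \<and>
        sq_norm lebesgue (\<lambda>x. \<Sum>i\<in>F. c i * E i x) \<le> B * (\<Sum>i\<in>F. (cmod (c i))\<^sup>2))"
    by (rule exI[of _ A], rule exI[of _ B]) (use A bounds in simp)
  then show ?thesis
    unfolding riesz_basis_L2_def L2_norm_square using E dense by (simp add: L2_iff_sq_int)
qed

section \<open>Powers of the dilation matrix\<close>

text \<open>Keeps \<open>transpose A *v x\<close> as a matrix-vector product, to which the facts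
  about \<open>*v\<close> apply, instead of turning it into a vector-matrix product.\<close>

declare transpose_matrix_vector [simp del]

lemma matrix_inv_right_left:
  fixes D :: "real^'d^'d"
  assumes "D ** D' = mat 1" shows "D ** matrix_inv D = mat 1" "matrix_inv D ** D = mat 1"
proof -
  have "D ** D' = mat 1 \<and> D' ** D = mat 1" using assms by (simp add: matrix_left_right_inverse)
  then have "D ** matrix_inv D = mat 1 \<and> matrix_inv D ** D = mat 1"
    unfolding matrix_inv_def by (rule someI)
  then show "D ** matrix_inv D = mat 1" "matrix_inv D ** D = mat 1" by auto
qed

lemma mat_powi_0[simp]: "mat_powi D 0 = mat 1"
  by (simp add: mat_powi_def)

lemma mat_powi_add_1:
  fixes D :: "real^'d^'d"
  assumes "D ** D' = mat 1"
  shows "mat_powi D (j + 1) = D ** mat_powi D j"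
proof (cases "j \<ge> 0")
  case True
  then show ?thesis by (simp add: mat_powi_def nat_add_distrib)
next
  case False
  define n where "n = nat (- j - 1)"
  have j: "j = - int (Suc n)" "nat (- j) = Suc n" using False by (auto simp: n_def)
  have "D ** mat_powi D j = D ** (matrix_inv D ** (((**) (matrix_inv D)) ^^ n) (mat 1))"
    using False j by (simp add: mat_powi_def)
  also have "\<dots> = (((**) (matrix_inv D)) ^^ n) (mat 1)"
    by (simp add: matrix_mul_assoc matrix_inv_right_left[OF assms])
  also have "\<dots> = mat_powi D (j + 1)"
    using j by (cases n) (auto simp: mat_powi_def nat_add_distrib)
  finally show ?thesis ..
qed

lemma mat_powi_commute:
  fixes D :: "real^'d^'d"
  assumes D: "D ** D' = mat 1"
  shows "D ** mat_powi D j = mat_powi D j ** D"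
proof (induction j rule: int_induct[where k=0])
  case base then show ?case by simp
next
  case (step1 i)
  then show ?case by (simp add: mat_powi_add_1[OF D] matrix_mul_assoc)
next
  case (step2 i)
  have e: "mat_powi D i = D ** mat_powi D (i - 1)" using mat_powi_add_1[OF D, of "i - 1"] by simp
  have "D' ** (D ** (D ** mat_powi D (i - 1))) = D' ** ((D ** mat_powi D (i - 1)) ** D)"
    using step2 e by simp
  moreover have "D' ** D = mat 1" using D by (simp add: matrix_left_right_inverse)
  ultimately show ?case by (simp add: matrix_mul_assoc)
qed

text \<open>This makes 2 pi (D^T)^(-j) Z^d the lattice dual to D^j Z^d, and is the condition for
  instantiating \<open>lattice_torus\<close> at every scale.\<close>

lemma transpose_mat_powi_inverse:
  fixes D :: "real^'d^'d"
  assumes D: "D ** D' = mat 1"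
  shows "transpose (mat_powi D j) ** mat_powi (transpose D) (- j) = mat 1"
proof -
  have DT: "transpose D ** transpose D' = mat 1"
  proof -
    have "D' ** D = mat 1" using D by (simp add: matrix_left_right_inverse)
    then show ?thesis by (simp add: matrix_transpose_mul[symmetric] transpose_mat)
  qed
  have step: "transpose (mat_powi D (i + 1)) ** mat_powi (transpose D) (- (i + 1))
      = transpose (mat_powi D i) ** mat_powi (transpose D) (- i)" for i
    using mat_powi_add_1[OF DT, of "- (i + 1)"]
    by (simp add: mat_powi_add_1[OF D] matrix_transpose_mul matrix_mul_assoc[symmetric])
  show ?thesis
  proof (induction j rule: int_induct[where k=0])
    case base then show ?case by (simp add: transpose_mat)
  next
    case (step1 i) then show ?case using step[of i] by simp
  next
    case (step2 i) then show ?case using step[of "i - 1"] by simp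
  qed
qed

locale dilation =
  fixes D :: "real^'d^'d" and a :: real and R :: "real^'d^'d"
  assumes D_int: "\<And>i j. D $ i $ j \<in> \<int>" and a: "a > 1" and R: "orthogonal_matrix R" and DaR: "D = a *\<^sub>R R"
begin

lemma norm_DT: "norm (transpose D *v x) = a * norm x"
proof -
  have o: "orthogonal_matrix Q \<Longrightarrow> norm (Q *v x) = norm x" for Q :: "real^'d^'d"
    using orthogonal_transformation_norm[of "(*v) Q"] by (simp add: orthogonal_transformation_matrix matrix_of_matrix_vector_mul matrix_vector_mul_linear)
  have "transpose D = a *\<^sub>R transpose R" by (simp add: DaR transpose_scalar)
  then show ?thesis
    using a o[of "transpose R"] R by (simp add: scaleR_matrix_vector_assoc[symmetric])
qed

lemma D_DT: "D *v (transpose D *v x) = a\<^sup>2 *\<^sub>R x" and DT_D: "transpose D *v (D *v x) = a\<^sup>2 *\<^sub>R x"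
proof -
  have "transpose D = a *\<^sub>R transpose R" by (simp add: DaR transpose_scalar)
  moreover have "R *v (transpose R *v x) = x" "transpose R *v (R *v x) = x"
    using R by (simp_all add: matrix_vector_mul_assoc orthogonal_matrix_def)
  ultimately show "D *v (transpose D *v x) = a\<^sup>2 *\<^sub>R x" "transpose D *v (D *v x) = a\<^sup>2 *\<^sub>R x"
    by (simp_all add: DaR scaleR_matrix_vector_assoc[symmetric] matrix_vector_mult_scaleR power2_eq_square)
qed

lemma D_inv: "D ** ((1 / a\<^sup>2) *\<^sub>R transpose D) = mat 1"
proof -
  have "(D ** ((1 / a\<^sup>2) *\<^sub>R transpose D)) *v x = mat 1 *v x" for x
    using a by (simp add: matrix_vector_mul_assoc[symmetric] scaleR_matrix_vector_assoc[symmetric] matrix_vector_mult_scaleR D_DT)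
  then show ?thesis by (simp add: matrix_eq)
qed

lemma abs_det_D: "\<bar>det D\<bar> = a ^ CARD('d)"
proof -
  have "D = (a *\<^sub>R mat 1) ** R"
    by (simp add: DaR matrix_eq matrix_vector_mul_assoc[symmetric] scaleR_matrix_vector_assoc[symmetric])
  moreover have "det (a *\<^sub>R mat 1 :: real^'d^'d) = a ^ CARD('d)"
    by (subst det_diagonal) (auto simp: mat_def)
  ultimately show ?thesis using det_orthogonal_matrix[OF R] a by (auto simp: det_mul abs_mult)
qed

section \<open>Integrality and the cosets of the lattices\<close>

definition dil_sq :: int where "dil_sq = \<lfloor>a\<^sup>2\<rfloor>"

lemma dil_sq: "of_int dil_sq = a\<^sup>2" and dil_sq_pos: "dil_sq > 0"
proof -
  fix i :: 'd
  have "(D *v (transpose D *v axis i 1)) $ i = (\<Sum>l\<in>UNIV. D $ i $ l * D $ i $ l)"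
    by (simp add: matrix_vector_mult_def transpose_def axis_def if_distrib cong: if_cong)
  \<comment> \<open>a^2 is a diagonal entry of the integer matrix D D^T, so the floor in
    \<open>dil_sq\<close> loses nothing.\<close>
  then have "a\<^sup>2 = (\<Sum>l\<in>UNIV. D $ i $ l * D $ i $ l)" by (simp add: D_DT)
  then have "a\<^sup>2 \<in> \<int>" using D_int by (auto intro!: Ints_sum Ints_mult)
  then show "of_int dil_sq = a\<^sup>2" unfolding dil_sq_def by (auto simp: Ints_def)
  then show "dil_sq > 0" using a by (metis of_int_0_less_iff zero_less_power2 less_trans zero_less_one less_irrefl)
qed

text \<open>\<open>Dz\<close> and \<open>DTz\<close> are D and its transpose acting on lattice
  indices; the floors are exact because the entries are integers.\<close>

definition Dz :: "int^'d \<Rightarrow> int^'d" where "Dz k = (\<chi> i. \<Sum>l\<in>UNIV. \<lfloor>D $ i $ l\<rfloor> * k $ l)"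

definition DTz :: "int^'d \<Rightarrow> int^'d" where "DTz k = (\<chi> i. \<Sum>l\<in>UNIV. \<lfloor>D $ l $ i\<rfloor> * k $ l)"

lemma Dz: "of_int_vec (Dz k) = D *v of_int_vec k" and DTz: "of_int_vec (DTz k) = transpose D *v of_int_vec k"
proof -
  have fl: "of_int \<lfloor>D $ i $ l\<rfloor> = D $ i $ l" for i l by (metis D_int Ints_cases floor_of_int)
  show "of_int_vec (Dz k) = D *v of_int_vec k" "of_int_vec (DTz k) = transpose D *v of_int_vec k"
    by (simp_all add: vec_eq_iff Dz_def DTz_def matrix_vector_mult_def transpose_def fl)
qed

text \<open>In the variable \<open>Mj j *v x\<close> the dual lattice of scale \<open>j\<close> is 2
  pi Z^d for every \<open>j\<close>, and lengths are multiplied by a^j.\<close>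

definition Mj :: "int \<Rightarrow> real^'d^'d" where "Mj j = transpose (mat_powi D j)"

definition Nj :: "int \<Rightarrow> real^'d^'d" where "Nj j = mat_powi (transpose D) (- j)"

sublocale tor: lattice_torus "Mj j" "Nj j" for j
  by standard (simp add: Mj_def Nj_def transpose_mat_powi_inverse[OF D_inv])

lemma Mj_add_1: "Mj (j + 1) *v x = Mj j *v (transpose D *v x)" "Mj (j + 1) *v x = transpose D *v (Mj j *v x)"
proof -
  have "Mj (j + 1) = Mj j ** transpose D" by (simp add: Mj_def mat_powi_add_1[OF D_inv] matrix_transpose_mul)
  then show "Mj (j + 1) *v x = Mj j *v (transpose D *v x)" by (simp add: matrix_vector_mul_assoc)
  have "Mj (j + 1) = transpose D ** Mj j"
    by (simp add: Mj_def mat_powi_add_1[OF D_inv] mat_powi_commute[OF D_inv] matrix_transpose_mul)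
  then show "Mj (j + 1) *v x = transpose D *v (Mj j *v x)" by (simp add: matrix_vector_mul_assoc)
qed

lemma norm_Mj: "norm (Mj j *v x) = a powi j * norm x"
proof (induction j rule: int_induct[where k=0])
  case base then show ?case by (simp add: Mj_def transpose_mat)
next
  case (step1 i)
  then show ?case using a by (simp add: Mj_add_1(2) norm_DT power_int_add_1)
next
  case (step2 i)
  have "a powi i * norm x = a * norm (Mj (i - 1) *v x)"
    using step2 Mj_add_1(2)[of "i - 1" x] by (simp add: norm_DT)
  moreover have "a powi i = a * a powi (i - 1)" using a power_int_add_1[of a "i - 1"] by simp
  ultimately show ?case using a by simp
qed

lemma inner_lattice_pt: "x \<bullet> lattice_pt D j k = (Mj j *v x) \<bullet> of_int_vec k"
  unfolding lattice_pt_def Mj_def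
  by (metis dot_lmul_matrix inner_commute vector_transpose_matrix transpose_transpose)

lemma dual_pt_eq: "(2 * pi) *\<^sub>R lattice_pt (transpose D) (- j) k = tor.dual_pt j k"
  by (simp only: tor.dual_pt_def lattice_pt_def) (simp only: Nj_def)

lemma cis_lattice_pt: "cis (- (x \<bullet> lattice_pt D j k)) = tor.chr j (- k) x"
  by (simp add: inner_lattice_pt tor.chr_def)

lemma lattice_pt_Suc: "lattice_pt D (j + 1) k = lattice_pt D j (Dz k)"
  by (simp add: lattice_pt_def Dz matrix_vector_mul_assoc mat_powi_add_1[OF D_inv] mat_powi_commute[OF D_inv])

text \<open>As the scale grows the lattices decrease and their duals increase; periodicity at a
  coarse scale therefore implies periodicity at all finer ones.\<close>

lemma dual_pt_Suc: "tor.dual_pt j k = tor.dual_pt (j + 1) (DTz k)"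
proof -
  have "Mj (j + 1) *v tor.dual_pt j k = Mj (j + 1) *v tor.dual_pt (j + 1) (DTz k)"
    unfolding Mj_add_1(2)[of j "tor.dual_pt j k"] by (simp add: tor.M_dual_pt DTz matrix_vector_mult_scaleR)
  then show ?thesis using tor.N_M by metis
qed

lemma dilated_lattice_mono: "i \<le> j \<Longrightarrow> dilated_lattice D j \<subseteq> dilated_lattice D i"
proof (induction j rule: int_ge_induct)
  case (step j)
  have "dilated_lattice D (j + 1) \<subseteq> dilated_lattice D j" by (auto simp: dilated_lattice_def lattice_pt_Suc)
  then show ?case using step by blast
qed simp

lemma periodic_mono: "i \<le> j \<Longrightarrow> tor.periodic j g \<Longrightarrow> tor.periodic i g"
proof (induction j rule: int_ge_induct)
  case (step j)
  have "tor.periodic j g" using step(3) by (auto simp: tor.periodic_def dual_pt_Suc[of j])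
  then show ?case using step by blast
qed simp

text \<open>D D^T is a^2 times the identity, so the inverse of D is D^T / a^2. This turns the
  pairing of a dual point of scale j + 1 with a lattice point of scale j into a character of Z^d
  modulo a^2.\<close>

lemma inner_dual_pt_Suc_lattice_pt:
  "tor.dual_pt (j + 1) q \<bullet> lattice_pt D j k = (2 * pi / a\<^sup>2) * (of_int_vec q \<bullet> of_int_vec (DTz k))"
proof -
  have "a\<^sup>2 *\<^sub>R (Mj j *v tor.dual_pt (j + 1) q) = D *v (Mj (j + 1) *v tor.dual_pt (j + 1) q)"
    by (simp add: Mj_add_1(2) D_DT)
  also have "\<dots> = (2 * pi) *\<^sub>R (D *v of_int_vec q)" by (simp add: tor.M_dual_pt matrix_vector_mult_scaleR)
  finally have "(a\<^sup>2 *\<^sub>R (Mj j *v tor.dual_pt (j + 1) q)) \<bullet> of_int_vec k = 2 * pi * ((D *v of_int_vec q) \<bullet> of_int_vec k)"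
    by simp
  also have "(D *v of_int_vec q) \<bullet> of_int_vec k = of_int_vec q \<bullet> of_int_vec (DTz k)"
    unfolding DTz by (metis dot_lmul_matrix inner_commute vector_transpose_matrix transpose_transpose)
  finally show ?thesis using a by (simp add: inner_lattice_pt field_simps)
qed

text \<open>If D^T k were a^2 l, applying D would give k = D l, a point of the coarser
  lattice.\<close>

lemma DTz_divisible:
  assumes "lattice_pt D j k \<notin> dilated_lattice D (j + 1)"
  shows "\<exists>i. \<not> dil_sq dvd DTz k $ i"
proof (rule ccontr)
  assume "\<not> ?thesis"
  then have "\<forall>i. \<exists>m. DTz k $ i = dil_sq * m" by (auto simp: dvd_def)
  then obtain m where m: "\<And>i. DTz k $ i = dil_sq * m i" by metis
  define l where "l = (\<chi> i. m i)"
  have "of_int_vec (DTz k) = a\<^sup>2 *\<^sub>R (of_int_vec l :: real^'d)"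
    by (simp add: vec_eq_iff m l_def dil_sq)
  then have "a\<^sup>2 *\<^sub>R of_int_vec k = a\<^sup>2 *\<^sub>R (D *v of_int_vec l)"
    unfolding DTz by (metis D_DT matrix_vector_mult_scaleR)
  then have "of_int_vec k = of_int_vec (Dz l)" using a by (simp add: Dz)
  then have "k = Dz l" by simp
  then show False using assms by (auto simp: dilated_lattice_def lattice_pt_Suc)
qed

text \<open>Complete residues of Z^d modulo a^2. Since a^2 times the identity is D^T D, the box
  represents all cosets of D^T Z^d, in general with repetition, and spares a choice of
  representatives.\<close>

definition coset_box :: "(int^'d) set" where "coset_box = {q. \<forall>i. 0 \<le> q $ i \<and> q $ i < dil_sq}"

lemma coset_box_finite: "finite coset_box"
proof -
  have "coset_box \<subseteq> (\<lambda>f. \<chi> i. f i) ` (PiE UNIV (\<lambda>_. {0..<dil_sq}))"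
  proof
    fix q assume "q \<in> coset_box"
    then have "(\<lambda>i. q $ i) \<in> PiE UNIV (\<lambda>_. {0..<dil_sq})" "q = (\<chi> i. q $ i)" by (auto simp: coset_box_def vec_eq_iff)
    then show "q \<in> (\<lambda>f. \<chi> i. f i) ` (PiE UNIV (\<lambda>_. {0..<dil_sq}))" by blast
  qed
  then show ?thesis by (rule finite_subset) (intro finite_imageI finite_PiE; simp)
qed

lemma coset_box_0: "0 \<in> coset_box" using dil_sq_pos by (simp add: coset_box_def)

text \<open>The sum over the box \<open>coset_box\<close> is invariant under a shift of the summation index, and the shift by
  a unit vector multiplies the character by a root of unity different from \<open>1\<close>.\<close>

lemma sum_chr_coset_box:
  assumes "lattice_pt D j k \<notin> dilated_lattice D (j + 1)"
  shows "(\<Sum>q\<in>coset_box. cis (- (tor.dual_pt (j + 1) q \<bullet> lattice_pt D j k))) = 0"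
proof -
  obtain i where i: "\<not> dil_sq dvd DTz k $ i" using DTz_divisible[OF assms] by blast
  define w where "w = DTz k"
  define f where "f q = cis (- (2 * pi / a\<^sup>2) * (of_int_vec q \<bullet> of_int_vec w))" for q
  \<comment> \<open>Addition of 1 in coordinate \<open>i\<close>, modulo a^2. The reduction changes
    the phase by a multiple of 2 pi, so only the factor \<open>\<zeta>\<close> remains.\<close>
  define \<sigma> where "\<sigma> q = (\<chi> l. (q $ l + (if l = i then 1 else 0)) mod dil_sq)" for q :: "int^'d"
  define \<zeta> where "\<zeta> = cis (- (2 * pi / a\<^sup>2) * of_int (w $ i))"
  have a2: "a\<^sup>2 > 0" using a by simp
  have f\<sigma>: "f (\<sigma> q) = f q * \<zeta>" for q
  proof -
    define m where "m l = (q $ l + (if l = i then 1 else 0)) div dil_sq" for l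
    have \<sigma>l: "\<sigma> q $ l = q $ l + (if l = i then 1 else 0) - dil_sq * m l" for l
      by (simp add: \<sigma>_def m_def minus_mult_div_eq_mod)
    have "of_int_vec (\<sigma> q) \<bullet> (of_int_vec w :: real^'d)
        = of_int_vec q \<bullet> of_int_vec w + of_int (w $ i) - a\<^sup>2 * of_int (\<Sum>l\<in>UNIV. m l * w $ l)"
      by (simp add: inner_vec_def \<sigma>l dil_sq[symmetric] algebra_simps sum.distrib sum_subtractf sum_distrib_left
          if_distrib[of "\<lambda>x. of_int x * _"] if_distrib[of "\<lambda>x. _ * of_int x"] cong: if_cong)
    note ipq = this
    have "- (2 * pi / a\<^sup>2) * (of_int_vec (\<sigma> q) \<bullet> of_int_vec w)
        = - (2 * pi / a\<^sup>2) * (of_int_vec q \<bullet> of_int_vec w) + - (2 * pi / a\<^sup>2) * of_int (w $ i)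
          + 2 * pi * of_int (\<Sum>l\<in>UNIV. m l * w $ l)"
      unfolding ipq using a2 by (simp add: field_simps)
    then show ?thesis
      unfolding f_def \<zeta>_def by (simp only: cis_mult[symmetric] cis_2pi_int mult_1_right)
  qed
  have inj: "inj_on \<sigma> coset_box"
  proof (rule inj_onI)
    fix q q' assume q: "q \<in> coset_box" "q' \<in> coset_box" and eq: "\<sigma> q = \<sigma> q'"
    have "q $ l = q' $ l" for l
    proof -
      have "(q $ l + (if l = i then 1 else 0)) mod dil_sq = (q' $ l + (if l = i then 1 else 0)) mod dil_sq"
        using eq by (simp add: \<sigma>_def vec_eq_iff)
      then have "q $ l mod dil_sq = q' $ l mod dil_sq" by (metis add_diff_cancel_right' mod_diff_left_eq)
      then show ?thesis using q by (simp add: coset_box_def)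
    qed
    then show "q = q'" by (simp add: vec_eq_iff)
  qed
  have sub: "\<sigma> ` coset_box \<subseteq> coset_box" using dil_sq_pos by (auto simp: \<sigma>_def coset_box_def)
  have "\<sigma> ` coset_box = coset_box" by (rule endo_inj_surj[OF coset_box_finite sub inj])
  then have "(\<Sum>q\<in>coset_box. f q) = (\<Sum>q\<in>coset_box. f (\<sigma> q))" using sum.reindex[OF inj, of f] by simp
  also have "\<dots> = (\<Sum>q\<in>coset_box. f q) * \<zeta>" by (simp add: f\<sigma> sum_distrib_right)
  finally have "(\<Sum>q\<in>coset_box. f q) * (\<zeta> - 1) = 0" by (simp add: algebra_simps)
  moreover have "\<zeta> \<noteq> 1"
  proof
    assume "\<zeta> = 1"
    then have "cos ((2 * pi / a\<^sup>2) * of_int (w $ i)) = 1" unfolding \<zeta>_def by (simp add: complex_eq_iff)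
    then obtain n :: int where "(2 * pi / a\<^sup>2) * of_int (w $ i) = of_int n * 2 * pi" unfolding cos_one_2pi_int by blast
    then have "of_int (w $ i) = of_int n * a\<^sup>2" using a2 by (simp add: field_simps)
    then have "w $ i = n * dil_sq" unfolding dil_sq[symmetric] by (simp only: of_int_mult[symmetric] of_int_eq_iff)
    then show False using i by (simp add: w_def)
  qed
  ultimately have "(\<Sum>q\<in>coset_box. f q) = 0" by simp
  then show ?thesis by (simp add: f_def w_def inner_dual_pt_Suc_lattice_pt)
qed

text \<open>If the character were 1 on the whole dual lattice of scale j + 1, the vanishing sum over
  the box would equal its cardinality.\<close>

lemma dual_pt_Suc_separates:
  assumes "lattice_pt D j k \<notin> dilated_lattice D (j + 1)"
  shows "\<exists>q. cis (- (tor.dual_pt (j + 1) q \<bullet> lattice_pt D j k)) \<noteq> 1"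
proof (rule ccontr)
  assume "\<not> ?thesis"
  then have "(\<Sum>q\<in>coset_box. cis (- (tor.dual_pt (j + 1) q \<bullet> lattice_pt D j k))) = of_nat (card coset_box)" by simp
  then have "card coset_box = 0" using sum_chr_coset_box[OF assms] by simp
  then show False using coset_box_finite coset_box_0 by auto
qed

text \<open>The radius pi / a is made for this. Modulo 2 pi Z^d the difference of the two points has
  length below 2 pi / a; D^T stretches it to a vector of length below 2 pi that is 2 pi times an
  integer vector, hence 0.\<close>

lemma near_dual_lattice_shift:
  assumes "norm (Mj j *v x + (2 * pi) *\<^sub>R of_int_vec k) < pi / a"
    and "norm (Mj j *v (x + tor.dual_pt (j + 1) q) + (2 * pi) *\<^sub>R of_int_vec k') < pi / a"
  shows "q \<in> range DTz"
proof -
  define y where "y = Mj j *v tor.dual_pt (j + 1) q + (2 * pi) *\<^sub>R of_int_vec (k' - k)"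
  have "y = (Mj j *v (x + tor.dual_pt (j + 1) q) + (2 * pi) *\<^sub>R of_int_vec k') - (Mj j *v x + (2 * pi) *\<^sub>R of_int_vec k)"
    by (simp add: y_def matrix_vector_right_distrib algebra_simps)
  then have "norm y \<le> norm (Mj j *v (x + tor.dual_pt (j + 1) q) + (2 * pi) *\<^sub>R of_int_vec k') + norm (Mj j *v x + (2 * pi) *\<^sub>R of_int_vec k)"
    by (simp only: norm_triangle_ineq4)
  then have "norm y < pi / a + pi / a" using assms by linarith
  then have "a * norm y < 2 * pi" using a by (simp add: field_simps)
  moreover have "transpose D *v y = (2 * pi) *\<^sub>R of_int_vec (q + DTz (k' - k))"
    unfolding y_def matrix_vector_right_distrib Mj_add_1(2)[symmetric] tor.M_dual_pt
    by (simp add: matrix_vector_mult_scaleR DTz[symmetric] scaleR_add_right del: of_int_vec_diff)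
  then have "a * norm y = 2 * pi * norm (of_int_vec (q + DTz (k' - k)) :: real^'d)"
    using norm_DT[of y] by simp
  ultimately have "norm (of_int_vec (q + DTz (k' - k)) :: real^'d) < 1" by simp
  then have "\<bar>of_int ((q + DTz (k' - k)) $ i)\<bar> < (1::real)" for i
    using component_le_norm_cart[of "of_int_vec (q + DTz (k' - k)) :: real^'d" i] by (metis le_less_trans of_int_vec_nth)
  note small = this
  have "(q + DTz (k' - k)) $ i = 0" for i using small[of i] by linarith
  then have "of_int_vec (q + DTz (k' - k)) = (0 :: real^'d)" by (simp add: vec_eq_iff del: of_int_vec_add)
  then have "of_int_vec q = - (of_int_vec (DTz (k' - k)) :: real^'d)" by (simp add: eq_neg_iff_add_eq_0)
  also have "\<dots> = of_int_vec (DTz (k - k'))"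
    unfolding DTz by (simp add: linear_neg[OF matrix_vector_mul_linear, symmetric])
  finally show ?thesis by simp
qed

end

section \<open>Periodization of the inverse symbol\<close>

lemma sum_le_integral_count_space:
  fixes f :: "'a \<Rightarrow> real"
  assumes "integrable (count_space UNIV) f" "\<And>k. f k \<ge> 0" "finite F"
  shows "sum f F \<le> (\<integral>k. f k \<partial>count_space UNIV)"
proof -
  have "ennreal (sum f F) = (\<Sum>k\<in>F. ennreal (f k))" using assms by (simp add: sum_ennreal)
  also have "\<dots> \<le> (\<integral>\<^sup>+k. ennreal (f k) \<partial>count_space UNIV)" by (rule sum_le_nn_integral_count_space) fact
  also have "\<dots> = ennreal (\<integral>k. f k \<partial>count_space UNIV)" using assms by (intro nn_integral_eq_integral) auto
  finally show ?thesis using assms by (subst (asm) ennreal_le_iff) (auto intro: integral_nonneg_AE)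
qed

lemma integral_count_space_le:
  fixes f :: "'a \<Rightarrow> real"
  assumes "integrable (count_space UNIV) f" "\<And>k. f k \<ge> 0" "\<And>F. finite F \<Longrightarrow> sum f F \<le> B"
  shows "(\<integral>k. f k \<partial>count_space UNIV) \<le> B"
proof -
  have "B \<ge> 0" using assms(3)[of "{}"] by simp
  have "ennreal (\<integral>k. f k \<partial>count_space UNIV) = (\<integral>\<^sup>+k. ennreal (f k) \<partial>count_space UNIV)"
    using assms by (intro nn_integral_eq_integral[symmetric]) auto
  also have "\<dots> \<le> ennreal B" by (rule nn_integral_count_space_le) (use assms in auto)
  finally show ?thesis using \<open>B \<ge> 0\<close> by (subst (asm) ennreal_le_iff) auto
qed

lemma integral_count_space_infsum:
  fixes f :: "'a \<Rightarrow> 'b::{banach, second_countable_topology}"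
  assumes "(\<lambda>k. norm (f k)) summable_on UNIV"
  shows "(\<integral>k. f k \<partial>count_space UNIV) = infsum f UNIV"
  using assms infsetsum_infsum[of f UNIV] unfolding infsetsum_def
  by (simp add: abs_summable_equivalent[symmetric])

lemma integrable_count_space_iff:
  fixes f :: "'a \<Rightarrow> real"
  assumes "\<And>k. f k \<ge> 0"
  shows "integrable (count_space UNIV) f \<longleftrightarrow> f summable_on UNIV"
proof -
  have "f summable_on UNIV \<longleftrightarrow> (\<lambda>k. norm (f k)) summable_on UNIV" using assms by simp
  also have "\<dots> \<longleftrightarrow> Infinite_Set_Sum.abs_summable_on f UNIV" by (rule abs_summable_equivalent)
  finally show ?thesis by (simp add: Infinite_Set_Sum.abs_summable_on_def)
qed

lemma borel_measurable_integral_count_space: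
  fixes f :: "'k::countable \<Rightarrow> 'a::euclidean_space \<Rightarrow> 'b::{banach, second_countable_topology}"
  assumes "\<And>k. f k \<in> borel_measurable lebesgue"
  shows "(\<lambda>x. \<integral>k. f k x \<partial>count_space UNIV) \<in> borel_measurable lebesgue"
proof -
  have "case_prod f \<in> borel_measurable (count_space UNIV \<Otimes>\<^sub>M lebesgue)"
    by (rule measurable_pair_measure_countable1) (use assms in auto)
  from measurable_pair_swap[OF this]
  have "(\<lambda>(x, k). f k x) \<in> borel_measurable (lebesgue \<Otimes>\<^sub>M count_space UNIV)"
    by (simp add: split_beta)
  from sigma_finite_measure.borel_measurable_lebesgue_integral[OF sigma_finite_measure_count_space this]
  show ?thesis by simp
qed

lemma (in lattice_torus) fold_measurable:
  assumes "f \<in> borel_measurable lebesgue" shows "fold f \<in> borel_measurable lebesgue"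
  unfolding fold_def[abs_def]
  by (intro borel_measurable_integral_count_space borel_measurable_translation assms)

text \<open>The squared l2 norm of \<open>g\<close> along an orbit of the dual lattice. It is the
  majorant in the Cauchy-Schwarz estimates below and integrates over the cell to the full
  norm.\<close>

definition (in lattice_torus) energy :: "(real^'d \<Rightarrow> complex) \<Rightarrow> real^'d \<Rightarrow> real" where
  "energy g x = sq_norm (count_space UNIV) (\<lambda>k. g (x + dual_pt k))"

lemma (in lattice_torus) energy:
  assumes g: "sq_int lebesgue g"
  shows AE_energy: "AE x in lebesgue. sq_int (count_space UNIV) (\<lambda>k. g (x + dual_pt k))"
    and integrable_energy: "integrable T (energy g)"
    and integral_energy: "(\<integral>x. energy g x \<partial>T) = sq_norm lebesgue g"
proof -
  define f where "f x = complex_of_real ((cmod (g x))\<^sup>2)" for x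
  have f: "integrable lebesgue f" unfolding f_def using g by (simp add: sq_int_def del: of_real_power)
  have fold: "fold f x = of_real (energy g x)" for x
    unfolding fold_def f_def energy_def sq_norm_def by (rule integral_complex_of_real)
  show "AE x in lebesgue. sq_int (count_space UNIV) (\<lambda>k. g (x + dual_pt k))"
    using AE_fold[OF f] unfolding f_def complex_of_real_integrable_eq by (simp add: sq_int_def)
  show "integrable T (energy g)"
    using integrable_Re[OF integrable_fold[OF f]] by (simp add: fold[abs_def])
  have "complex_of_real (\<integral>x. energy g x \<partial>T) = complex_of_real (sq_norm lebesgue g)"
    using integral_fold[OF f] unfolding fold f_def by (simp add: sq_norm_def del: of_real_power)
  then show "(\<integral>x. energy g x \<partial>T) = sq_norm lebesgue g" by (simp only: of_real_eq_iff)
qed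

lemma (in lattice_torus) energy_nonneg[simp]: "0 \<le> energy g x"
  by (simp add: energy_def)

text \<open>Turns an almost-everywhere statement into an actual sample point in a prescribed
  region.\<close>

lemma AE_ex_open:
  fixes U :: "(real^'d) set"
  assumes "AE x in lebesgue. P x" "open U" "U \<noteq> {}"
  shows "\<exists>x\<in>U. P x"
proof (rule ccontr)
  assume "\<not> ?thesis"
  then have sub: "U \<subseteq> {x \<in> space lebesgue. \<not> P x}" by auto
  obtain N where N: "{x \<in> space lebesgue. \<not> P x} \<subseteq> N" "emeasure lebesgue N = 0" "N \<in> sets lebesgue"
    by (rule AE_E[OF assms(1)])
  then have "N \<in> null_sets lebesgue" by (simp only: null_sets_def mem_Collect_eq simp_thms)
  then have "negligible N" by (simp only: negligible_iff_null_sets)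
  then have "negligible U" by (rule negligible_subset) (use sub N(1) in \<open>rule order_trans\<close>)
  then show False using open_not_negligible[OF assms(2,3)] by simp
qed

locale spline = dilation D a R
  for D :: "real^'d^'d" and a :: real and R :: "real^'d^'d" +
  fixes L :: "real^'d \<Rightarrow> complex" and r :: real and p :: "int \<Rightarrow> int^'d \<Rightarrow> complex"
    and \<omega>\<^sub>0 C\<^sub>1 C\<^sub>2 :: real
  assumes r: "r > 0" and L_meas[measurable]: "L \<in> borel_measurable lebesgue"
    and L_nz: "AE \<omega> in lebesgue. L \<omega> \<noteq> 0"
    and loc: "\<And>j. localizes L D j (p j)"
    and pos: "\<omega>\<^sub>0 > 0" "C\<^sub>1 > 0" "C\<^sub>2 > 0"
    and growth: "\<And>\<omega>. norm \<omega> \<ge> \<omega>\<^sub>0 \<Longrightarrow>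
           C\<^sub>1 * norm \<omega> powr r \<le> cmod (L \<omega>) \<and> cmod (L \<omega>) \<le> C\<^sub>2 * norm \<omega> powr r"
begin

definition S :: "int \<Rightarrow> real^'d \<Rightarrow> real" where
  "S j \<omega> = (\<integral>k. inverse ((cmod (L (\<omega> + tor.dual_pt j k)))\<^sup>2) \<partial>count_space UNIV)"

lemma S_nonneg[simp]: "0 \<le> S j \<omega>"
  unfolding S_def by (intro integral_nonneg_AE) simp

lemma S_fold: "tor.fold j (\<lambda>\<omega>. of_real (inverse ((cmod (L \<omega>))\<^sup>2))) \<omega> = of_real (S j \<omega>)"
  unfolding tor.fold_def S_def by (rule integral_complex_of_real)

lemma S_periodic: "tor.periodic j (S j)"
  unfolding tor.periodic_def
proof (intro allI)
  fix x k
  have "complex_of_real (S j (x + tor.dual_pt j k)) = of_real (S j x)"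
    unfolding S_fold[symmetric] by (rule tor.periodicD[OF tor.fold_periodic])
  then show "S j (x + tor.dual_pt j k) = S j x" by (simp only: of_real_eq_iff)
qed

lemma S_measurable[measurable]: "S j \<in> borel_measurable lebesgue"
proof -
  have "(\<lambda>\<omega>. inverse ((cmod (L (\<omega> + t)))\<^sup>2)) \<in> borel_measurable lebesgue" for t
    by (rule borel_measurable_translation[of "\<lambda>\<omega>. inverse ((cmod (L \<omega>))\<^sup>2)"]) measurable
  then show ?thesis unfolding S_def by (intro borel_measurable_integral_count_space)
qed

definition Ld :: "int \<Rightarrow> real^'d \<Rightarrow> complex" where "Ld j = loc_symbol D j (p j)"

lemma Ld_eq: "Ld j \<omega> = (\<Sum>\<^sub>\<infinity>k. p j k * tor.chr j k \<omega>)"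
  unfolding Ld_def loc_symbol_def inner_lattice_pt tor.chr_def cis_conv_exp ..

lemma p_summable: "(\<lambda>k. cmod (p j k)) summable_on UNIV"
  using loc[of j] by (simp add: localizes_def)

lemma Ld_periodic: "tor.periodic j (Ld j)"
  unfolding tor.periodic_def Ld_eq by (simp add: tor.periodicD[OF tor.chr_periodic])

lemma Ld_measurable[measurable]: "Ld j \<in> borel_measurable lebesgue"
proof -
  have "Ld j = (\<lambda>\<omega>. \<integral>k. p j k * tor.chr j k \<omega> \<partial>count_space UNIV)"
    unfolding Ld_eq by (rule ext, rule integral_count_space_infsum[symmetric]) (simp add: norm_mult p_summable)
  then show ?thesis
    by (simp only:) (intro borel_measurable_integral_count_space borel_measurable_times tor.chr_measurable borel_measurable_const)
qed

lemma bspline_hat_eq: "bspline_hat L D j (p j) \<omega> = Ld j \<omega> / L \<omega>"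
  by (simp add: bspline_hat_def Ld_def divide_inverse)

lemma bspline_period_sum:
  "bspline_period L D j (p j) \<omega> = (\<Sum>\<^sub>\<infinity>k. (cmod (Ld j \<omega>))\<^sup>2 * inverse ((cmod (L (\<omega> + tor.dual_pt j k)))\<^sup>2))"
  unfolding bspline_period_def dual_pt_eq bspline_hat_eq tor.periodicD[OF Ld_periodic]
  by (simp add: divide_inverse norm_mult norm_inverse power_mult_distrib power_inverse)

lemma bspline_period_eq: "bspline_period L D j (p j) \<omega> = (cmod (Ld j \<omega>))\<^sup>2 * S j \<omega>"
proof -
  define f where "f k = (cmod (Ld j \<omega>))\<^sup>2 * inverse ((cmod (L (\<omega> + tor.dual_pt j k)))\<^sup>2)" for k
  have f0: "f k \<ge> 0" for k by (simp add: f_def)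
  have "infsum f UNIV = (\<integral>k. f k \<partial>count_space UNIV)"
  proof (cases "f summable_on UNIV")
    case True
    then show ?thesis using f0 by (intro integral_count_space_infsum[symmetric]) simp
  next
    \<comment> \<open>A divergent \<open>infsum\<close> and a divergent Bochner integral are both 0,
      so the identity holds at every point.\<close>
    case False
    then have "\<not> integrable (count_space UNIV) f" using integrable_count_space_iff[of f] f0 by simp
    then show ?thesis using False by (simp add: infsum_not_exists not_integrable_integral_eq)
  qed
  also have "\<dots> = (cmod (Ld j \<omega>))\<^sup>2 * S j \<omega>" unfolding f_def S_def by (rule integral_mult_right_zero)
  finally show ?thesis unfolding bspline_period_sum f_def .
qed

definition good :: "real \<Rightarrow> real \<Rightarrow> int \<Rightarrow> real^'d \<Rightarrow> bool" where
  "good A B j \<omega> \<longleftrightarrow> Ld j \<omega> \<noteq> 0 \<and> S j \<omega> > 0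
      \<and> integrable (count_space UNIV) (\<lambda>k. inverse ((cmod (L (\<omega> + tor.dual_pt j k)))\<^sup>2))
      \<and> A \<le> (cmod (Ld j \<omega>))\<^sup>2 * S j \<omega> \<and> (cmod (Ld j \<omega>))\<^sup>2 * S j \<omega> \<le> B"

text \<open>The lower bound is positive, so \<open>S j \<omega>\<close> is not the default value 0
  of a divergent integral: positivity itself yields convergence.\<close>

lemma AE_localizes:
  obtains A B where "A > 0" "AE \<omega> in lebesgue. good A B j \<omega>"
proof -
  obtain A B where A: "A > 0" and AE: "AE \<omega> in lebesgue. A \<le> bspline_period L D j (p j) \<omega> \<and> bspline_period L D j (p j) \<omega> \<le> B"
    using loc[of j] unfolding localizes_def by blast
  have "AE \<omega> in lebesgue. good A B j \<omega>"
    using AE unfolding bspline_period_eq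
  proof eventually_elim
    case (elim \<omega>)
    then have posi: "(cmod (Ld j \<omega>))\<^sup>2 * S j \<omega> > 0" using A by linarith
    then have nz: "Ld j \<omega> \<noteq> 0" and S: "S j \<omega> > 0" using S_nonneg[of j \<omega>] by (auto simp: zero_less_mult_iff)
    then have "integrable (count_space UNIV) (\<lambda>k. inverse ((cmod (L (\<omega> + tor.dual_pt j k)))\<^sup>2))"
      unfolding S_def using not_integrable_integral_eq by fastforce
    then show ?case using nz S elim by (simp add: good_def)
  qed
  with A show thesis by (rule that)
qed

lemma AE_S: "AE \<omega> in lebesgue. S j \<omega> > 0 \<and> integrable (count_space UNIV) (\<lambda>k. inverse ((cmod (L (\<omega> + tor.dual_pt j k)))\<^sup>2))"
  by (rule AE_localizes[of j]) (erule eventually_mono, simp add: good_def)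

subsection \<open>Bounds on the periodization\<close>

text \<open>Chosen so that a rescaled length of at least 1 / a already lies beyond
  \<open>\<omega>\<^sub>0\<close>. The length is 1 / a rather than 1 because the balls to be
  excluded have radius pi / a.\<close>

definition fine_scale :: "int \<Rightarrow> bool" where "fine_scale j \<longleftrightarrow> \<omega>\<^sub>0 * a powi (j + 1) \<le> 1"

lemma fine_scale_mono: "i \<le> j \<Longrightarrow> fine_scale j \<Longrightarrow> fine_scale i"
proof -
  assume "i \<le> j" "fine_scale j"
  then have "\<omega>\<^sub>0 * a powi (i + 1) \<le> \<omega>\<^sub>0 * a powi (j + 1)"
    using pos a by (intro mult_left_mono power_int_increasing) auto
  then show "fine_scale i" using \<open>fine_scale j\<close> by (simp add: fine_scale_def)
qed

lemma fine_scale_exists: "\<exists>j. fine_scale j"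
proof -
  obtain n :: nat where n: "\<omega>\<^sub>0 < a ^ n" using real_arch_pow[OF a] by blast
  have "\<omega>\<^sub>0 * a powi (- int n) \<le> 1" using n a by (simp add: power_int_minus field_simps)
  then have "fine_scale (- int n - 1)" by (simp add: fine_scale_def)
  then show ?thesis by blast
qed

lemma far:
  assumes "fine_scale j" "norm (Mj j *v x) \<ge> 1 / a" shows "norm x \<ge> \<omega>\<^sub>0"
proof -
  have ap: "a powi j > 0" "a powi (j + 1) = a powi j * a" using a by (auto simp: power_int_add)
  have "1 \<le> norm x * (a powi j * a)" using assms(2) a by (simp add: norm_Mj field_simps)
  also have "\<omega>\<^sub>0 * (a powi j * a) \<le> 1" using assms(1) by (simp add: fine_scale_def ap)
  finally have "\<omega>\<^sub>0 * (a powi j * a) \<le> norm x * (a powi j * a)" using assms(1) \<open>\<omega>\<^sub>0 * (a powi j * a) \<le> 1\<close> by linarith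
  then show ?thesis using ap a by (simp add: mult_le_cancel_right)
qed

text \<open>|x|^(-2r) is a^(2rj) times the same power of the rescaled length. The scale is thus
  isolated in one factor.\<close>

lemma inverse_L_bounds:
  assumes "fine_scale j" "norm (Mj j *v x) \<ge> 1 / a"
  shows "inverse ((cmod (L x))\<^sup>2) \<le> inverse (C\<^sub>1\<^sup>2) * (a powi j) powr (2 * r) * norm (Mj j *v x) powr (- 2 * r)"
    and "inverse ((cmod (L x))\<^sup>2) \<ge> inverse (C\<^sub>2\<^sup>2) * (a powi j) powr (2 * r) * norm (Mj j *v x) powr (- 2 * r)"
    and "L x \<noteq> 0"
proof -
  define h where "h = a powi j"
  define m where "m = norm (Mj j *v x)"
  have h: "h > 0" using a by (simp add: h_def)
  have m: "m > 0" using assms(2) a unfolding m_def by (meson less_le_trans zero_less_divide_1_iff less_trans zero_less_one)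
  have x: "norm x = m / h" using h unfolding m_def norm_Mj h_def[symmetric] by simp
  have sq: "(norm x powr r)\<^sup>2 = m powr (2 * r) * h powr (- 2 * r)"
  proof -
    have "(norm x powr r)\<^sup>2 = (m / h) powr (2 * r)" unfolding x using m h by (simp add: powr_power mult.commute)
    also have "\<dots> = m powr (2 * r) / h powr (2 * r)" using m h by (simp add: powr_divide)
    finally show ?thesis using powr_minus[of h "2 * r"] by (simp add: divide_inverse)
  qed
  have inv: "inverse ((C * norm x powr r)\<^sup>2) = inverse (C\<^sup>2) * h powr (2 * r) * m powr (- 2 * r)" for C
    unfolding power_mult_distrib sq using m h by (simp add: powr_minus field_simps)
  have x0: "norm x powr r > 0" using m h unfolding x by simp
  have g: "C\<^sub>1 * norm x powr r \<le> cmod (L x)" "cmod (L x) \<le> C\<^sub>2 * norm x powr r"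
    using growth[OF far[OF assms]] by auto
  have l1: "0 < C\<^sub>1 * norm x powr r" using x0 pos by simp
  then have l2: "0 < cmod (L x)" using g by linarith
  then show "L x \<noteq> 0" by simp
  show "inverse ((cmod (L x))\<^sup>2) \<le> inverse (C\<^sub>1\<^sup>2) * (a powi j) powr (2 * r) * norm (Mj j *v x) powr (- 2 * r)"
    unfolding h_def[symmetric] m_def[symmetric] inv[symmetric]
    using g l1 by (intro le_imp_inverse_le power_mono) auto
  show "inverse ((cmod (L x))\<^sup>2) \<ge> inverse (C\<^sub>2\<^sup>2) * (a powi j) powr (2 * r) * norm (Mj j *v x) powr (- 2 * r)"
    unfolding h_def[symmetric] m_def[symmetric] inv[symmetric]
    using g l2 by (intro le_imp_inverse_le power_mono) auto
qed

lemma M_shift: "Mj j *v (x + tor.dual_pt j k) = Mj j *v x + (2 * pi) *\<^sub>R of_int_vec k"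
  by (simp add: matrix_vector_right_distrib tor.M_dual_pt)

text \<open>The convergence of the lattice sum is read off from the periodization being finite at a
  point all of whose translates lie in the region where \<open>L\<close> grows like the power.\<close>

lemma lattice_sum_reference:
  "\<exists>x Z. (\<forall>k. norm (x + (2 * pi) *\<^sub>R of_int_vec k) \<ge> 1) \<and>
     (\<forall>F. finite F \<longrightarrow> (\<Sum>k\<in>F. norm (x + (2 * pi) *\<^sub>R of_int_vec k :: real^'d) powr (- 2 * r)) \<le> Z)"
proof -
  obtain j where j: "fine_scale j" using fine_scale_exists by blast
  fix i :: 'd
  \<comment> \<open>Coordinate \<open>i\<close> lies between 1 and pi, so adding any multiple of 2
    pi leaves its modulus at least 1: every translate avoids the uncontrolled region.\<close>
  define U where "U = {\<omega>. 1 < (Mj j *v \<omega>) $ i} \<inter> {\<omega>. (Mj j *v \<omega>) $ i < pi}"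
  have "open U" unfolding U_def by (intro open_Int open_Collect_less tor.continuous_on_M continuous_intros)
  moreover have "Nj j *v axis i 2 \<in> U" using pi_gt3 by (simp add: U_def)
  then have "U \<noteq> {}" by blast
  ultimately obtain \<omega> where \<omega>: "\<omega> \<in> U" "integrable (count_space UNIV) (\<lambda>k. inverse ((cmod (L (\<omega> + tor.dual_pt j k)))\<^sup>2))"
    using AE_ex_open[OF AE_S[of j]] by blast
  define x where "x = Mj j *v \<omega>"
  have n1: "norm (x + (2 * pi) *\<^sub>R of_int_vec k) \<ge> 1" for k
  proof -
    have xi: "1 < x $ i" "x $ i < pi" using \<omega> by (auto simp: U_def x_def)
    have "1 \<le> \<bar>x $ i + 2 * pi * of_int (k $ i)\<bar>"
    proof (cases "k $ i \<ge> 0")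
      case True
      then have "2 * pi * of_int (k $ i) \<ge> 0" by simp
      then show ?thesis using xi by linarith
    next
      case False
      then have "of_int (k $ i) \<le> (-1 :: real)" by linarith
      then have "2 * pi * of_int (k $ i) \<le> 2 * pi * (-1)" by (intro mult_left_mono) auto
      then show ?thesis using xi pi_gt3 by linarith
    qed
    also have "\<dots> \<le> norm (x + (2 * pi) *\<^sub>R of_int_vec k)"
      using component_le_norm_cart[of "x + (2 * pi) *\<^sub>R of_int_vec k" i] by simp
    finally show ?thesis .
  qed
  define c where "c = inverse (C\<^sub>2\<^sup>2) * (a powi j) powr (2 * r)"
  have c: "c > 0" using pos a by (simp add: c_def)
  have "(\<Sum>k\<in>F. norm (x + (2 * pi) *\<^sub>R of_int_vec k) powr (- 2 * r)) \<le> S j \<omega> / c" if "finite F" for F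
  proof -
    have "c * (\<Sum>k\<in>F. norm (x + (2 * pi) *\<^sub>R of_int_vec k) powr (- 2 * r))
        \<le> (\<Sum>k\<in>F. inverse ((cmod (L (\<omega> + tor.dual_pt j k)))\<^sup>2))"
      unfolding sum_distrib_left
    proof (rule sum_mono)
      fix k
      have "1 / a \<le> 1" using a by simp
      then have "1 / a \<le> norm (Mj j *v (\<omega> + tor.dual_pt j k))" using n1[of k] unfolding M_shift x_def by linarith
      from inverse_L_bounds(2)[OF j this]
      show "c * norm (x + (2 * pi) *\<^sub>R of_int_vec k) powr (- 2 * r) \<le> inverse ((cmod (L (\<omega> + tor.dual_pt j k)))\<^sup>2)"
        unfolding M_shift x_def c_def .
    qed
    also have "\<dots> \<le> S j \<omega>"
      unfolding S_def by (rule sum_le_integral_count_space) (use \<omega> that in auto)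
    finally show ?thesis using c by (simp add: field_simps)
  qed
  then show ?thesis using n1 by blast
qed

lemma cube_translate: "\<exists>l. norm (x + (2 * pi) *\<^sub>R of_int_vec l :: real^'d) \<le> pi * CARD('d)"
proof -
  interpret I: lattice_torus "mat 1" "mat 1 :: real^'d^'d" by standard simp
  obtain l where "x + I.dual_pt l \<in> I.cell" using I.ex1_cell_plus by blast
  then have "norm (mat 1 *v (x + I.dual_pt l)) \<le> pi * CARD('d)"
    using I.norm_M_le_ccell I.cell_subsets by blast
  then show ?thesis by (auto simp: I.dual_pt_def)
qed

text \<open>After a lattice shift, \<open>x\<close> is within pi d of the reference point, so the
  two sums are comparable term by term as long as the terms stay away from 0.\<close>

lemma lattice_sum_bound:
  assumes \<delta>: "\<delta> > 0"
  shows "\<exists>K>0. \<forall>x F. finite F \<longrightarrow> (\<forall>k\<in>F. norm (x + (2 * pi) *\<^sub>R of_int_vec k) \<ge> \<delta>) \<longrightarrow>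
     (\<Sum>k\<in>F. norm (x + (2 * pi) *\<^sub>R of_int_vec k :: real^'d) powr (- 2 * r)) \<le> K"
proof -
  obtain y Z where y: "\<And>k. norm (y + (2 * pi) *\<^sub>R of_int_vec k) \<ge> 1"
    "\<And>F. finite F \<Longrightarrow> (\<Sum>k\<in>F. norm (y + (2 * pi) *\<^sub>R of_int_vec k :: real^'d) powr (- 2 * r)) \<le> Z"
    using lattice_sum_reference by blast
  have Z: "Z \<ge> 0" using y(2)[of "{}"] by simp
  \<comment> \<open>From v \<le> u + pi d and u \<ge> \<delta> follows v \<le> \<rho> u.\<close>
  define \<rho> where "\<rho> = 1 + pi * CARD('d) / \<delta>"
  have \<rho>: "\<rho> > 0" using \<delta> by (simp add: \<rho>_def add_pos_nonneg)
  show ?thesis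
  proof (intro exI[of _ "\<rho> powr (2 * r) * Z + 1"] conjI allI impI)
    show "0 < \<rho> powr (2 * r) * Z + 1" using Z by (simp add: add_nonneg_pos)
    fix x :: "real^'d" and F assume F: "finite F" "\<forall>k\<in>F. norm (x + (2 * pi) *\<^sub>R of_int_vec k) \<ge> \<delta>"
    obtain l where l: "norm ((y - x) + (2 * pi) *\<^sub>R of_int_vec l) \<le> pi * CARD('d)" using cube_translate by blast
    have "(\<Sum>k\<in>F. norm (x + (2 * pi) *\<^sub>R of_int_vec k) powr (- 2 * r))
        \<le> (\<Sum>k\<in>F. \<rho> powr (2 * r) * norm (y + (2 * pi) *\<^sub>R of_int_vec (k + l)) powr (- 2 * r))"
    proof (rule sum_mono)
      fix k assume k: "k \<in> F"
      define u where "u = norm (x + (2 * pi) *\<^sub>R of_int_vec k)"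
      define v where "v = norm (y + (2 * pi) *\<^sub>R of_int_vec (k + l))"
      have u: "u \<ge> \<delta>" using F k by (simp add: u_def)
      have v: "v \<ge> 1" unfolding v_def by (rule y)
      have "v \<le> u + pi * CARD('d)"
      proof -
        have "y + (2 * pi) *\<^sub>R of_int_vec (k + l) = (x + (2 * pi) *\<^sub>R of_int_vec k) + ((y - x) + (2 * pi) *\<^sub>R of_int_vec l)"
          by (simp add: algebra_simps)
        then have "v \<le> u + norm ((y - x) + (2 * pi) *\<^sub>R of_int_vec l)"
          unfolding u_def v_def by (simp only: norm_triangle_ineq)
        then show ?thesis using l by linarith
      qed
      also have "\<dots> \<le> \<rho> * u" using u \<delta> by (simp add: \<rho>_def field_simps)
      finally have "(\<rho> * u) powr (- 2 * r) \<le> v powr (- 2 * r)" using v r by (intro powr_mono2') auto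
      then have "\<rho> powr (2 * r) * (\<rho> * u) powr (- 2 * r) \<le> \<rho> powr (2 * r) * v powr (- 2 * r)"
        by (intro mult_left_mono) auto
      moreover have "\<rho> powr (2 * r) * (\<rho> * u) powr (- 2 * r) = u powr (- 2 * r)"
        using \<rho> u \<delta> by (simp add: powr_mult powr_minus)
      ultimately show "u powr (- 2 * r) \<le> \<rho> powr (2 * r) * v powr (- 2 * r)" by simp
    qed
    also have "\<dots> = \<rho> powr (2 * r) * (\<Sum>k\<in>(\<lambda>k. k + l) ` F. norm (y + (2 * pi) *\<^sub>R of_int_vec k) powr (- 2 * r))"
      by (subst sum.reindex) (auto simp: sum_distrib_left)
    also have "\<dots> \<le> \<rho> powr (2 * r) * Z" using F by (intro mult_left_mono y) auto
    finally show "(\<Sum>k\<in>F. norm (x + (2 * pi) *\<^sub>R of_int_vec k) powr (- 2 * r)) \<le> \<rho> powr (2 * r) * Z + 1" by simp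
  qed
qed

text \<open>Stated for finite partial sums so that terms may be left out: it is used for full sums
  away from the dual lattice and for sums without their central term.\<close>

lemma partial_S_upper:
  "\<exists>K>0. \<forall>j \<omega> F. fine_scale j \<longrightarrow> finite F \<longrightarrow> (\<forall>k\<in>F. norm (Mj j *v \<omega> + (2 * pi) *\<^sub>R of_int_vec k) \<ge> pi / a) \<longrightarrow>
     (\<Sum>k\<in>F. inverse ((cmod (L (\<omega> + tor.dual_pt j k)))\<^sup>2)) \<le> K * (a powi j) powr (2 * r)"
proof -
  have "pi / a > 0" using a by simp
  from lattice_sum_bound[OF this] obtain K where K: "K > 0"
    "\<And>x F. finite F \<Longrightarrow> (\<forall>k\<in>F. norm (x + (2 * pi) *\<^sub>R of_int_vec k) \<ge> pi / a) \<Longrightarrow>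
     (\<Sum>k\<in>F. norm (x + (2 * pi) *\<^sub>R of_int_vec k :: real^'d) powr (- 2 * r)) \<le> K" by blast
  show ?thesis
  proof (intro exI[of _ "inverse (C\<^sub>1\<^sup>2) * K"] conjI allI impI)
    show "0 < inverse (C\<^sub>1\<^sup>2) * K" using K pos by simp
    fix j \<omega> F assume j: "fine_scale j" and F: "finite F" "\<forall>k\<in>F. norm (Mj j *v \<omega> + (2 * pi) *\<^sub>R of_int_vec k) \<ge> pi / a"
    have "(\<Sum>k\<in>F. inverse ((cmod (L (\<omega> + tor.dual_pt j k)))\<^sup>2))
        \<le> (\<Sum>k\<in>F. inverse (C\<^sub>1\<^sup>2) * (a powi j) powr (2 * r) * norm (Mj j *v \<omega> + (2 * pi) *\<^sub>R of_int_vec k) powr (- 2 * r))"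
    proof (rule sum_mono)
      fix k assume k: "k \<in> F"
      have "1 / a \<le> pi / a" using a pi_gt3 by (simp add: divide_right_mono)
      then have "1 / a \<le> norm (Mj j *v (\<omega> + tor.dual_pt j k))" using F k unfolding M_shift by fastforce
      from inverse_L_bounds(1)[OF j this]
      show "inverse ((cmod (L (\<omega> + tor.dual_pt j k)))\<^sup>2) \<le> inverse (C\<^sub>1\<^sup>2) * (a powi j) powr (2 * r) * norm (Mj j *v \<omega> + (2 * pi) *\<^sub>R of_int_vec k) powr (- 2 * r)"
        unfolding M_shift .
    qed
    also have "\<dots> = inverse (C\<^sub>1\<^sup>2) * (a powi j) powr (2 * r) * (\<Sum>k\<in>F. norm (Mj j *v \<omega> + (2 * pi) *\<^sub>R of_int_vec k) powr (- 2 * r))"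
      by (simp add: sum_distrib_left)
    also have "\<dots> \<le> inverse (C\<^sub>1\<^sup>2) * (a powi j) powr (2 * r) * K"
      by (intro mult_left_mono K F) auto
    finally show "(\<Sum>k\<in>F. inverse ((cmod (L (\<omega> + tor.dual_pt j k)))\<^sup>2)) \<le> inverse (C\<^sub>1\<^sup>2) * K * (a powi j) powr (2 * r)"
      by (simp add: mult_ac)
  qed
qed

text \<open>A single term suffices, if it is taken where the growth condition holds and at bounded
  rescaled distance.\<close>

lemma S_lower:
  "\<exists>c>0. \<forall>j. fine_scale j \<longrightarrow> (AE \<omega> in lebesgue. c * (a powi j) powr (2 * r) \<le> S j \<omega>)"
proof -
  define \<rho> where "\<rho> = pi * CARD('d) + 2 * pi"
  have \<rho>: "\<rho> > 0" by (simp add: \<rho>_def add_nonneg_pos)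
  show ?thesis
  proof (intro exI[of _ "inverse (C\<^sub>2\<^sup>2) * \<rho> powr (- 2 * r)"] conjI allI impI)
    show "0 < inverse (C\<^sub>2\<^sup>2) * \<rho> powr (- 2 * r)" using \<rho> pos by simp
    fix j assume j: "fine_scale j"
    show "AE \<omega> in lebesgue. inverse (C\<^sub>2\<^sup>2) * \<rho> powr (- 2 * r) * (a powi j) powr (2 * r) \<le> S j \<omega>"
      using AE_S[of j]
    proof eventually_elim
      case (elim \<omega>)
      fix i :: 'd
      obtain l where l: "\<omega> + tor.dual_pt j l \<in> tor.cell j" using tor.ex1_cell_plus by blast
      \<comment> \<open>The translate in the cell may be close to 0. One more step in direction
        \<open>i\<close> raises that coordinate to at least pi, while the length stays at most
        \<rho>.\<close>
      define k where "k = l + axis i 1"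
      have ax: "of_int_vec (axis i 1 :: int^'d) = (axis i 1 :: real^'d)" by (simp add: vec_eq_iff axis_def)
      have Mk: "Mj j *v (\<omega> + tor.dual_pt j k) = Mj j *v (\<omega> + tor.dual_pt j l) + (2 * pi) *\<^sub>R axis i 1"
        unfolding M_shift k_def by (simp add: scaleR_add_right ax)
      have "- pi \<le> (Mj j *v (\<omega> + tor.dual_pt j l)) $ i" using l by (simp add: tor.cell_def)
      then have "pi \<le> (Mj j *v (\<omega> + tor.dual_pt j k)) $ i" unfolding Mk by simp
      then have ge: "pi \<le> norm (Mj j *v (\<omega> + tor.dual_pt j k))"
        using component_le_norm_cart[of "Mj j *v (\<omega> + tor.dual_pt j k)" i] by linarith
      have le: "norm (Mj j *v (\<omega> + tor.dual_pt j k)) \<le> \<rho>"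
      proof -
        have "norm (Mj j *v (\<omega> + tor.dual_pt j l)) \<le> pi * CARD('d)"
          using l tor.norm_M_le_ccell tor.cell_subsets by blast
        moreover have "norm ((2 * pi) *\<^sub>R axis i 1 :: real^'d) = 2 * pi" by simp
        ultimately show ?thesis unfolding Mk \<rho>_def by (metis add_mono norm_triangle_le order_refl)
      qed
      have "1 / a \<le> 1" using a by simp
      then have "1 / a \<le> norm (Mj j *v (\<omega> + tor.dual_pt j k))" using ge pi_gt3 by linarith
      from inverse_L_bounds(2)[OF j this]
      have "inverse (C\<^sub>2\<^sup>2) * (a powi j) powr (2 * r) * norm (Mj j *v (\<omega> + tor.dual_pt j k)) powr (- 2 * r)
          \<le> inverse ((cmod (L (\<omega> + tor.dual_pt j k)))\<^sup>2)" .
      moreover have "\<rho> powr (- 2 * r) \<le> norm (Mj j *v (\<omega> + tor.dual_pt j k)) powr (- 2 * r)"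
        using le less_le_trans[OF pi_gt_zero ge] r by (intro powr_mono2') simp_all
      then have "inverse (C\<^sub>2\<^sup>2) * (a powi j) powr (2 * r) * \<rho> powr (- 2 * r)
          \<le> inverse (C\<^sub>2\<^sup>2) * (a powi j) powr (2 * r) * norm (Mj j *v (\<omega> + tor.dual_pt j k)) powr (- 2 * r)"
        by (intro mult_left_mono) auto
      moreover have "inverse ((cmod (L (\<omega> + tor.dual_pt j k)))\<^sup>2) \<le> S j \<omega>"
        using sum_le_integral_count_space[of "\<lambda>k. inverse ((cmod (L (\<omega> + tor.dual_pt j k)))\<^sup>2)" "{k}"] elim
        by (simp add: S_def)
      ultimately show ?case by (simp add: mult_ac)
    qed
  qed
qed

lemma S_upper:
  "\<exists>K>0. \<forall>j. fine_scale j \<longrightarrow> (AE \<omega> in lebesgue.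
     (\<forall>k. norm (Mj j *v \<omega> + (2 * pi) *\<^sub>R of_int_vec k) \<ge> pi / a) \<longrightarrow> S j \<omega> \<le> K * (a powi j) powr (2 * r))"
proof -
  obtain K where K: "K > 0" "\<And>j \<omega> F. fine_scale j \<Longrightarrow> finite F \<Longrightarrow>
      (\<forall>k\<in>F. norm (Mj j *v \<omega> + (2 * pi) *\<^sub>R of_int_vec k) \<ge> pi / a) \<Longrightarrow>
      (\<Sum>k\<in>F. inverse ((cmod (L (\<omega> + tor.dual_pt j k)))\<^sup>2)) \<le> K * (a powi j) powr (2 * r)"
    using partial_S_upper by blast
  show ?thesis
  proof (intro exI[of _ K] conjI allI impI K)
    fix j assume j: "fine_scale j"
    show "AE \<omega> in lebesgue. (\<forall>k. norm (Mj j *v \<omega> + (2 * pi) *\<^sub>R of_int_vec k) \<ge> pi / a) \<longrightarrow> S j \<omega> \<le> K * (a powi j) powr (2 * r)"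
      using AE_S[of j]
    proof eventually_elim
      case (elim \<omega>)
      then show ?case unfolding S_def using K(2)[OF j]
        by (intro impI integral_count_space_le) auto
    qed
  qed
qed

subsection \<open>Quotients of periodic functions by the symbol\<close>

text \<open>On an orbit \<open>m\<close> is constant, so unfolding leaves the sum of |L|^(-2) as a
  weight on one cell.\<close>

lemma nn_integral_quotient:
  assumes [measurable]: "m \<in> borel_measurable lebesgue" and per: "tor.periodic j m"
  shows "(\<integral>\<^sup>+\<omega>. ennreal ((cmod (m \<omega> / L \<omega>))\<^sup>2) \<partial>lebesgue)
       = (\<integral>\<^sup>+\<omega>. ennreal ((cmod (m \<omega>))\<^sup>2 * S j \<omega>) \<partial>tor.T j)"
proof -
  have "(\<integral>\<^sup>+\<omega>. ennreal ((cmod (m \<omega> / L \<omega>))\<^sup>2) \<partial>lebesgue)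
      = (\<integral>\<^sup>+\<omega>. (\<integral>\<^sup>+k. ennreal ((cmod (m (\<omega> + tor.dual_pt j k) / L (\<omega> + tor.dual_pt j k)))\<^sup>2) \<partial>count_space UNIV) \<partial>tor.T j)"
    by (rule tor.nn_integral_unfold) measurable
  also have "\<dots> = (\<integral>\<^sup>+\<omega>. ennreal ((cmod (m \<omega>))\<^sup>2 * S j \<omega>) \<partial>tor.T j)"
  proof (rule nn_integral_cong_AE)
    show "AE \<omega> in tor.T j. (\<integral>\<^sup>+k. ennreal ((cmod (m (\<omega> + tor.dual_pt j k) / L (\<omega> + tor.dual_pt j k)))\<^sup>2) \<partial>count_space UNIV)
        = ennreal ((cmod (m \<omega>))\<^sup>2 * S j \<omega>)"
      using tor.AE_T[OF AE_S[of j], of j]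
    proof eventually_elim
    case (elim \<omega>)
    have "(\<integral>\<^sup>+k. ennreal ((cmod (m (\<omega> + tor.dual_pt j k) / L (\<omega> + tor.dual_pt j k)))\<^sup>2) \<partial>count_space UNIV)
        = (\<integral>\<^sup>+k. ennreal ((cmod (m \<omega>))\<^sup>2) * ennreal (inverse ((cmod (L (\<omega> + tor.dual_pt j k)))\<^sup>2)) \<partial>count_space UNIV)"
      unfolding tor.periodicD[OF per]
      by (simp add: divide_inverse norm_mult norm_inverse power_mult_distrib power_inverse ennreal_mult)
    also have "\<dots> = ennreal ((cmod (m \<omega>))\<^sup>2) * (\<integral>\<^sup>+k. ennreal (inverse ((cmod (L (\<omega> + tor.dual_pt j k)))\<^sup>2)) \<partial>count_space UNIV)"
      by (rule nn_integral_cmult) simp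
    also have "\<dots> = ennreal ((cmod (m \<omega>))\<^sup>2) * ennreal (S j \<omega>)"
      using elim unfolding S_def by (subst nn_integral_eq_integral) auto
    finally show ?case by (simp add: ennreal_mult)
    qed
  qed
  finally show ?thesis .
qed

lemma sq_int_quotient:
  assumes m: "m \<in> borel_measurable lebesgue" and per: "tor.periodic j m"
    and b: "AE \<omega> in tor.T j. (cmod (m \<omega>))\<^sup>2 * S j \<omega> \<le> b \<omega>" and int: "integrable (tor.T j) b"
  shows "sq_int lebesgue (\<lambda>\<omega>. m \<omega> / L \<omega>)"
proof (rule sq_int_if_nn_integral)
  have "(\<integral>\<^sup>+\<omega>. ennreal ((cmod (m \<omega>))\<^sup>2 * S j \<omega>) \<partial>tor.T j) \<le> (\<integral>\<^sup>+\<omega>. ennreal (norm (b \<omega>)) \<partial>tor.T j)"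
    by (intro nn_integral_mono_AE) (use b in \<open>auto elim!: eventually_mono intro!: ennreal_leI\<close>)
  also have "\<dots> < \<infinity>" using int by (simp add: integrable_iff_bounded)
  finally show "(\<integral>\<^sup>+\<omega>. ennreal ((cmod (m \<omega> / L \<omega>))\<^sup>2) \<partial>lebesgue) < \<infinity>"
    by (simp only: nn_integral_quotient[OF m per])
qed (use m in measurable)

text \<open>Against quotients with periodic numerator, \<open>g\<close> acts only through the
  periodization of \<open>g\<close> divided by the conjugate symbol. This periodization is the
  quantity shown to vanish in the completeness argument.\<close>

lemma ip_quotient:
  assumes g: "sq_int lebesgue g" and q: "sq_int lebesgue (\<lambda>\<omega>. m \<omega> / L \<omega>)" and per: "tor.periodic j m"
  shows "ip lebesgue g (\<lambda>\<omega>. m \<omega> / L \<omega>) = (\<integral>\<omega>. tor.fold j (\<lambda>\<omega>. g \<omega> / cnj (L \<omega>)) \<omega> * cnj (m \<omega>) \<partial>tor.T j)"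
    and "integrable (tor.T j) (\<lambda>\<omega>. tor.fold j (\<lambda>\<omega>. g \<omega> / cnj (L \<omega>)) \<omega> * cnj (m \<omega>))"
proof -
  define f where "f \<omega> = g \<omega> * cnj (m \<omega> / L \<omega>)" for \<omega>
  have f: "integrable lebesgue f" unfolding f_def by (rule integrable_mult_cnj[OF g q])
  have fold: "tor.fold j f \<omega> = tor.fold j (\<lambda>\<omega>. g \<omega> / cnj (L \<omega>)) \<omega> * cnj (m \<omega>)" for \<omega>
  proof -
    have eq: "f (\<omega> + tor.dual_pt j k) = (g (\<omega> + tor.dual_pt j k) / cnj (L (\<omega> + tor.dual_pt j k))) * cnj (m \<omega>)" for k
      by (simp add: f_def tor.periodicD[OF per])
    show ?thesis unfolding tor.fold_def eq by (rule integral_mult_left_zero)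
  qed
  show "ip lebesgue g (\<lambda>\<omega>. m \<omega> / L \<omega>) = (\<integral>\<omega>. tor.fold j (\<lambda>\<omega>. g \<omega> / cnj (L \<omega>)) \<omega> * cnj (m \<omega>) \<partial>tor.T j)"
    using tor.integral_fold[OF f, of j] unfolding fold by (simp add: ip_def f_def)
  show "integrable (tor.T j) (\<lambda>\<omega>. tor.fold j (\<lambda>\<omega>. g \<omega> / cnj (L \<omega>)) \<omega> * cnj (m \<omega>))"
    using tor.integrable_fold[OF f, of j] by (simp only: fold[abs_def])
qed

text \<open>Cauchy-Schwarz in l2 of the orbit, separating the values of \<open>g\<close> from those
  of 1 / L.\<close>

lemma fold_cauchy_schwarz:
  assumes g: "sq_int lebesgue g"
  shows "AE \<omega> in lebesgue. (cmod (tor.fold j (\<lambda>\<omega>. g \<omega> / cnj (L \<omega>)) \<omega>))\<^sup>2 \<le> tor.energy j g \<omega> * S j \<omega>"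
  using tor.AE_energy[OF g, of j] AE_S[of j]
proof eventually_elim
  case (elim \<omega>)
  define u where "u k = g (\<omega> + tor.dual_pt j k)" for k
  define v where "v k = inverse (L (\<omega> + tor.dual_pt j k))" for k
  have u: "sq_int (count_space UNIV) u" using elim by (simp add: u_def[abs_def])
  have v: "sq_int (count_space UNIV) v" using elim by (simp add: v_def[abs_def] sq_int_def norm_inverse power_inverse)
  have "tor.fold j (\<lambda>\<omega>. g \<omega> / cnj (L \<omega>)) \<omega> = ip (count_space UNIV) u v"
    by (simp add: tor.fold_def ip_def u_def v_def divide_inverse)
  moreover have "sq_norm (count_space UNIV) v = S j \<omega>"
    by (simp add: sq_norm_def v_def S_def norm_inverse power_inverse)
  ultimately show ?case using ip_cauchy_schwarz[OF u v] by (simp add: tor.energy_def u_def[abs_def])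
qed

end

context spline
begin

section \<open>Bounds within one scale\<close>

lemma sq_norm_quotient:
  assumes m: "m \<in> borel_measurable lebesgue" and per: "tor.periodic j m" and q: "sq_int lebesgue (\<lambda>\<omega>. m \<omega> / L \<omega>)"
  shows "ennreal (sq_norm lebesgue (\<lambda>\<omega>. m \<omega> / L \<omega>)) = (\<integral>\<^sup>+\<omega>. ennreal ((cmod (m \<omega>))\<^sup>2 * S j \<omega>) \<partial>tor.T j)"
  unfolding sq_norm_eq_nn_integral[OF q] by (rule nn_integral_quotient[OF m per])

lemma periodic_mult: "tor.periodic j f \<Longrightarrow> tor.periodic j g \<Longrightarrow> tor.periodic j (\<lambda>x. f x * g x)"
  for f g :: "real^'d \<Rightarrow> complex"
  by (simp add: tor.periodic_def)

lemma block_upper: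
  assumes C[measurable]: "C \<in> borel_measurable lebesgue" and Cper: "tor.periodic j C" and Cq: "sq_int (tor.T j) C"
    and m[measurable]: "m \<in> borel_measurable lebesgue" and mper: "tor.periodic j m"
    and B: "B \<ge> 0" "AE \<omega> in lebesgue. (cmod (m \<omega>))\<^sup>2 * S j \<omega> \<le> B"
  shows "sq_int lebesgue (\<lambda>\<omega>. C \<omega> * m \<omega> / L \<omega>)" and "sq_norm lebesgue (\<lambda>\<omega>. C \<omega> * m \<omega> / L \<omega>) \<le> B * sq_norm (tor.T j) C"
proof -
  have per: "tor.periodic j (\<lambda>\<omega>. C \<omega> * m \<omega>)" by (rule periodic_mult) fact+
  have b: "AE \<omega> in tor.T j. (cmod (C \<omega> * m \<omega>))\<^sup>2 * S j \<omega> \<le> (cmod (C \<omega>))\<^sup>2 * B"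
    using tor.AE_T[OF B(2), of j]
  proof eventually_elim
    case (elim \<omega>)
    from mult_left_mono[OF elim, of "(cmod (C \<omega>))\<^sup>2"] show ?case
      by (simp add: norm_mult power_mult_distrib mult.assoc)
  qed
  show q: "sq_int lebesgue (\<lambda>\<omega>. C \<omega> * m \<omega> / L \<omega>)"
    by (rule sq_int_quotient[OF _ per b]) (use Cq in \<open>auto simp: sq_int_def\<close>)
  have "ennreal (sq_norm lebesgue (\<lambda>\<omega>. C \<omega> * m \<omega> / L \<omega>)) = (\<integral>\<^sup>+\<omega>. ennreal ((cmod (C \<omega> * m \<omega>))\<^sup>2 * S j \<omega>) \<partial>tor.T j)"
    by (rule sq_norm_quotient[OF _ per q]) measurable
  also have "\<dots> \<le> (\<integral>\<^sup>+\<omega>. ennreal B * ennreal ((cmod (C \<omega>))\<^sup>2) \<partial>tor.T j)"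
    by (rule nn_integral_mono_AE) (use b B(1) in \<open>auto elim!: eventually_mono simp: ennreal_mult[symmetric] mult.commute intro!: ennreal_leI\<close>)
  also have "\<dots> = ennreal B * ennreal (sq_norm (tor.T j) C)"
    unfolding sq_norm_eq_nn_integral[OF Cq] by (rule nn_integral_cmult) (use Cq in \<open>auto simp: sq_int_def\<close>)
  also have "\<dots> = ennreal (B * sq_norm (tor.T j) C)" using B(1) by (simp add: ennreal_mult)
  finally show "sq_norm lebesgue (\<lambda>\<omega>. C \<omega> * m \<omega> / L \<omega>) \<le> B * sq_norm (tor.T j) C" using B(1) by (subst (asm) ennreal_le_iff) auto
qed

text \<open>The weight is bounded below only on \<open>G\<close>; the inequality with
  \<open>K\<close> says that \<open>C\<close> keeps a fixed share of its mass there.\<close>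

lemma block_lower:
  assumes C[measurable]: "C \<in> borel_measurable lebesgue" and Cper: "tor.periodic j C" and Cq: "sq_int (tor.T j) C"
    and m[measurable]: "m \<in> borel_measurable lebesgue" and mper: "tor.periodic j m"
    and q: "sq_int lebesgue (\<lambda>\<omega>. C \<omega> * m \<omega> / L \<omega>)"
    and A: "A \<ge> 0" "AE \<omega> in lebesgue. \<omega> \<in> G \<longrightarrow> A \<le> (cmod (m \<omega>))\<^sup>2 * S j \<omega>"
    and G: "G \<in> sets lebesgue"
    and K: "K \<ge> 0" "ennreal (sq_norm (tor.T j) C) \<le> ennreal K * (\<integral>\<^sup>+\<omega>. ennreal ((cmod (C \<omega>))\<^sup>2) * indicator G \<omega> \<partial>tor.T j)"
  shows "A * sq_norm (tor.T j) C \<le> K * sq_norm lebesgue (\<lambda>\<omega>. C \<omega> * m \<omega> / L \<omega>)"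
proof -
  have per: "tor.periodic j (\<lambda>\<omega>. C \<omega> * m \<omega>)" by (rule periodic_mult) fact+
  have b: "AE \<omega> in tor.T j. ennreal A * (ennreal ((cmod (C \<omega>))\<^sup>2) * indicator G \<omega>) \<le> ennreal ((cmod (C \<omega> * m \<omega>))\<^sup>2 * S j \<omega>)"
    using tor.AE_T[OF A(2), of j]
  proof eventually_elim
    case (elim \<omega>)
    show ?case
    proof (cases "\<omega> \<in> G")
      case True
      then have "A \<le> (cmod (m \<omega>))\<^sup>2 * S j \<omega>" using elim by simp
      from mult_left_mono[OF this, of "(cmod (C \<omega>))\<^sup>2"]
      have "A * (cmod (C \<omega>))\<^sup>2 \<le> (cmod (C \<omega> * m \<omega>))\<^sup>2 * S j \<omega>" by (simp add: norm_mult power_mult_distrib mult_ac)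
      then show ?thesis using True A(1) by (simp add: ennreal_mult[symmetric] ennreal_leI)
    qed simp
  qed
  have Gm: "(\<lambda>\<omega>. ennreal ((cmod (C \<omega>))\<^sup>2) * indicator G \<omega>) \<in> borel_measurable (tor.T j)"
    by (rule tor.measurable_T) (use G in measurable)
  have "ennreal (A * sq_norm (tor.T j) C) = ennreal A * ennreal (sq_norm (tor.T j) C)" using A(1) by (simp add: ennreal_mult)
  also have "\<dots> \<le> ennreal A * (ennreal K * (\<integral>\<^sup>+\<omega>. ennreal ((cmod (C \<omega>))\<^sup>2) * indicator G \<omega> \<partial>tor.T j))"
    by (rule mult_left_mono[OF K(2)]) simp
  also have "\<dots> = ennreal K * (\<integral>\<^sup>+\<omega>. ennreal A * (ennreal ((cmod (C \<omega>))\<^sup>2) * indicator G \<omega>) \<partial>tor.T j)"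
    by (subst nn_integral_cmult[OF Gm]) (simp add: mult.left_commute)
  also have "\<dots> \<le> ennreal K * (\<integral>\<^sup>+\<omega>. ennreal ((cmod (C \<omega> * m \<omega>))\<^sup>2 * S j \<omega>) \<partial>tor.T j)"
    by (intro mult_left_mono nn_integral_mono_AE b) simp
  also have "\<dots> = ennreal K * ennreal (sq_norm lebesgue (\<lambda>\<omega>. C \<omega> * m \<omega> / L \<omega>))"
    by (subst sq_norm_quotient[OF _ per q]) auto
  also have "\<dots> = ennreal (K * sq_norm lebesgue (\<lambda>\<omega>. C \<omega> * m \<omega> / L \<omega>))" using K(1) by (simp add: ennreal_mult)
  finally show ?thesis using K(1) by (subst (asm) ennreal_le_iff) auto
qed

text \<open>The index type is arbitrary so that the sums can run over lattice points as well as over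
  indices of the wavelet system.\<close>

definition char_sum :: "'i set \<Rightarrow> ('i \<Rightarrow> real^'d) \<Rightarrow> ('i \<Rightarrow> complex) \<Rightarrow> real^'d \<Rightarrow> complex" where
  "char_sum F pt c \<omega> = (\<Sum>i\<in>F. c i * cis (- (\<omega> \<bullet> pt i)))"

lemma char_sum_measurable[measurable]: "char_sum F pt c \<in> borel_measurable lebesgue"
  unfolding char_sum_def using cis_measurable_lebesgue[of "-1"]
  by (intro borel_measurable_sum borel_measurable_times) auto

lemma cis_periodic: "\<beta> \<in> dilated_lattice D j \<Longrightarrow> tor.periodic j (\<lambda>\<omega>. cis (- (\<omega> \<bullet> \<beta>)))"
  unfolding dilated_lattice_def by (auto simp: cis_lattice_pt tor.chr_periodic[unfolded tor.periodic_def] tor.periodic_def)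

lemma char_sum_periodic:
  "(\<And>i. i \<in> F \<Longrightarrow> pt i \<in> dilated_lattice D j) \<Longrightarrow> tor.periodic j (char_sum F pt c)"
  using cis_periodic by (auto simp: char_sum_def tor.periodic_def intro!: sum.cong)

lemma char_sum_norm:
  assumes F: "finite F" "inj_on pt F" and pt: "\<And>i. i \<in> F \<Longrightarrow> pt i \<in> dilated_lattice D j"
  shows "sq_int (tor.T j) (char_sum F pt c)" "sq_norm (tor.T j) (char_sum F pt c) = tor.vol j * (\<Sum>i\<in>F. (cmod (c i))\<^sup>2)"
proof -
  have "\<exists>k. pt i = lattice_pt D j k" if "i \<in> F" for i using pt[OF that] by (auto simp: dilated_lattice_def)
  then obtain k where k: "\<And>i. i \<in> F \<Longrightarrow> pt i = lattice_pt D j (k i)" by metis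
  have e: "(\<lambda>\<omega>. cis (- (\<omega> \<bullet> pt i))) = tor.chr j (- k i)" if "i \<in> F" for i
    using k[OF that] by (auto simp: cis_lattice_pt)
  have q: "sq_int (tor.T j) (\<lambda>\<omega>. c i * cis (- (\<omega> \<bullet> pt i)))" if "i \<in> F" for i
    using e[OF that] by (intro sq_int_scale) simp
  show "sq_int (tor.T j) (char_sum F pt c)" unfolding char_sum_def by (rule sq_int_sum[OF q])
  have n: "sq_norm (tor.T j) (tor.chr j l) = tor.vol j" for l
    using ip_self[of "tor.T j" "tor.chr j l"] by (simp add: tor.ip_chr)
  have "sq_norm (tor.T j) (char_sum F pt c) = (\<Sum>i\<in>F. sq_norm (tor.T j) (\<lambda>\<omega>. c i * cis (- (\<omega> \<bullet> pt i))))"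
    unfolding char_sum_def
  proof (rule sq_norm_sum_orthogonal[OF F(1) q])
    fix i l assume il: "i \<in> F" "l \<in> F" "i \<noteq> l"
    then have "k i \<noteq> k l" using F(2) k by (metis inj_onD)
    then show "ip (tor.T j) (\<lambda>\<omega>. c i * cis (- (\<omega> \<bullet> pt i))) (\<lambda>\<omega>. c l * cis (- (\<omega> \<bullet> pt l))) = 0"
      unfolding ip_scale_left ip_scale_right e[OF il(1)] e[OF il(2)] tor.ip_chr by simp
  qed
  also have "\<dots> = (\<Sum>i\<in>F. (cmod (c i))\<^sup>2 * tor.vol j)"
  proof (rule sum.cong[OF refl])
    fix i assume i: "i \<in> F"
    show "sq_norm (tor.T j) (\<lambda>\<omega>. c i * cis (- (\<omega> \<bullet> pt i))) = (cmod (c i))\<^sup>2 * tor.vol j"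
      unfolding sq_norm_scale e[OF i] n ..
  qed
  finally show "sq_norm (tor.T j) (char_sum F pt c) = tor.vol j * (\<Sum>i\<in>F. (cmod (c i))\<^sup>2)"
    by (simp add: sum_distrib_left mult.commute)
qed

text \<open>The region excluded from the lower bound on the wavelet weight; the radius is that of
  \<open>near_dual_lattice_shift\<close>.\<close>

definition near_dual :: "int \<Rightarrow> (real^'d) set" where
  "near_dual j = {\<omega>. \<exists>k. norm (Mj j *v \<omega> + (2 * pi) *\<^sub>R of_int_vec k) < pi / a}"

lemma near_dual_sets[measurable]: "near_dual j \<in> sets lebesgue"
proof -
  have "near_dual j = (\<Union>k. {\<omega>. norm (Mj j *v \<omega> + (2 * pi) *\<^sub>R of_int_vec k) < pi / a})" by (auto simp: near_dual_def)
  also have "open \<dots>" by (intro open_UN ballI open_Collect_less continuous_intros tor.continuous_on_M)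
  finally show ?thesis by (simp add: borel_open)
qed

lemma near_dual_periodic: "\<omega> + tor.dual_pt j k \<in> near_dual j \<longleftrightarrow> \<omega> \<in> near_dual j"
proof -
  have imp: "\<omega> \<in> near_dual j" if b: "\<omega> + tor.dual_pt j k \<in> near_dual j" for \<omega> k
  proof -
    obtain l where "norm (Mj j *v (\<omega> + tor.dual_pt j k) + (2 * pi) *\<^sub>R of_int_vec l) < pi / a"
      using b by (auto simp: near_dual_def)
    then have "norm (Mj j *v \<omega> + (2 * pi) *\<^sub>R of_int_vec (k + l)) < pi / a"
      unfolding M_shift by (simp add: algebra_simps)
    then show ?thesis unfolding near_dual_def by blast
  qed
  show ?thesis using imp[of \<omega> k] imp[of "\<omega> + tor.dual_pt j k" "- k"] by (auto simp: tor.dual_pt_uminus)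
qed

text \<open>A trigonometric sum without frequencies in the coarser lattice averages to zero over the
  cosets of the dual lattices. At most one coset comes near the dual lattice, so the mass of the sum there is
  controlled by its mass elsewhere.\<close>

lemma char_sum_concentration:
  assumes F: "finite F" and pt: "\<And>i. i \<in> F \<Longrightarrow> pt i \<in> dilated_lattice D j - dilated_lattice D (j + 1)"
    and q: "sq_int (tor.T j) (char_sum F pt c)"
  shows "ennreal (sq_norm (tor.T j) (char_sum F pt c)) \<le> ennreal (1 + real (card coset_box) * real (card coset_box)) *
     (\<integral>\<^sup>+\<omega>. ennreal ((cmod (char_sum F pt c \<omega>))\<^sup>2) * indicator (- near_dual j) \<omega> \<partial>tor.T j)"
proof -
  define C where "C = char_sum F pt c"
  have Cm[measurable]: "C \<in> borel_measurable lebesgue" unfolding C_def by measurable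
  have Cper: "tor.periodic j C" unfolding C_def by (rule char_sum_periodic) (use pt in auto)
  \<comment> \<open>\<open>Q1\<close> collects the shifts by points of the dual lattice of scale
    \<open>j\<close>, which leave \<open>C\<close> unchanged; those in \<open>Q2\<close> move every
    point near that lattice away from it.\<close>
  define Q2 where "Q2 = {q \<in> coset_box. q \<notin> range DTz}"
  define Q1 where "Q1 = {q \<in> coset_box. q \<in> range DTz}"
  have fin: "finite Q1" "finite Q2" using coset_box_finite by (auto simp: Q1_def Q2_def)
  have card2: "card Q2 \<le> card coset_box" by (intro card_mono coset_box_finite) (auto simp: Q2_def)
  have "0 = DTz 0" by (simp add: DTz_def vec_eq_iff)
  then have "0 \<in> Q1" using coset_box_0 by (auto simp: Q1_def)
  then have card1: "card Q1 \<ge> 1" using fin by (metis One_nat_def Suc_leI card_gt_0_iff empty_iff)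
  have zero: "(\<Sum>q\<in>coset_box. C (\<omega> + tor.dual_pt (j + 1) q)) = 0" for \<omega>
  proof -
    have "(\<Sum>q\<in>coset_box. C (\<omega> + tor.dual_pt (j + 1) q))
        = (\<Sum>i\<in>F. \<Sum>q\<in>coset_box. (c i * cis (- (\<omega> \<bullet> pt i))) * cis (- (tor.dual_pt (j + 1) q \<bullet> pt i)))"
      unfolding C_def char_sum_def by (subst sum.swap) (simp add: inner_add_left cis_mult mult.assoc)
    also have "\<dots> = 0"
    proof (rule sum.neutral, rule ballI)
      fix i assume "i \<in> F"
      then have pi: "pt i \<in> dilated_lattice D j" "pt i \<notin> dilated_lattice D (j + 1)" using pt by auto
      obtain k where k1: "pt i = lattice_pt D j k" using pi(1) by (auto simp: dilated_lattice_def)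
      with pi(2) have k: "pt i = lattice_pt D j k" "lattice_pt D j k \<notin> dilated_lattice D (j + 1)" by simp_all
      show "(\<Sum>q\<in>coset_box. (c i * cis (- (\<omega> \<bullet> pt i))) * cis (- (tor.dual_pt (j + 1) q \<bullet> pt i))) = 0"
        unfolding sum_distrib_left[symmetric] k(1) sum_chr_coset_box[OF k(2)] by simp
    qed
    finally show ?thesis .
  qed
  have ptw: "(cmod (C \<omega>))\<^sup>2 \<le> card coset_box * (\<Sum>q\<in>Q2. (cmod (C (\<omega> + tor.dual_pt (j + 1) q)))\<^sup>2)" for \<omega>
  proof -
    have split: "coset_box = Q1 \<union> Q2" "Q1 \<inter> Q2 = {}" by (auto simp: Q1_def Q2_def)
    have "(\<Sum>q\<in>Q1. C (\<omega> + tor.dual_pt (j + 1) q)) = (\<Sum>q\<in>Q1. C \<omega>)"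
    proof (rule sum.cong[OF refl])
      fix q assume "q \<in> Q1"
      then obtain l where "q = DTz l" by (auto simp: Q1_def)
      then show "C (\<omega> + tor.dual_pt (j + 1) q) = C \<omega>" using tor.periodicD[OF Cper] by (simp add: dual_pt_Suc[symmetric])
    qed
    then have "of_nat (card Q1) * C \<omega> = - (\<Sum>q\<in>Q2. C (\<omega> + tor.dual_pt (j + 1) q))"
      using zero[of \<omega>] unfolding split(1) sum.union_disjoint[OF fin split(2)] by (simp add: add_eq_0_iff2)
    then have "real (card Q1) * cmod (C \<omega>) = cmod (\<Sum>q\<in>Q2. C (\<omega> + tor.dual_pt (j + 1) q))"
      by (metis norm_minus_cancel norm_mult norm_of_nat)
    also have "\<dots> \<le> (\<Sum>q\<in>Q2. cmod (C (\<omega> + tor.dual_pt (j + 1) q)))" by (rule norm_sum)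
    finally have "real (card Q1) * cmod (C \<omega>) \<le> (\<Sum>q\<in>Q2. cmod (C (\<omega> + tor.dual_pt (j + 1) q)))" .
    moreover have "1 * cmod (C \<omega>) \<le> real (card Q1) * cmod (C \<omega>)" using card1 by (intro mult_right_mono) auto
    ultimately have "cmod (C \<omega>) \<le> (\<Sum>q\<in>Q2. cmod (C (\<omega> + tor.dual_pt (j + 1) q)))" by linarith
    then have "(cmod (C \<omega>))\<^sup>2 \<le> (\<Sum>q\<in>Q2. cmod (C (\<omega> + tor.dual_pt (j + 1) q)))\<^sup>2" by (intro power_mono) auto
    also have "\<dots> \<le> (\<Sum>q\<in>Q2. (cmod (C (\<omega> + tor.dual_pt (j + 1) q)))\<^sup>2) * card Q2" by (rule sum_squared_le_sum_of_squares)
    also have "\<dots> \<le> (\<Sum>q\<in>Q2. (cmod (C (\<omega> + tor.dual_pt (j + 1) q)))\<^sup>2) * card coset_box"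
      using card2 by (intro mult_left_mono sum_nonneg) auto
    finally show ?thesis by (simp add: mult.commute)
  qed
  define g where "g \<omega> = ennreal ((cmod (C \<omega>))\<^sup>2) * indicator (- near_dual j) \<omega>" for \<omega>
  have gm[measurable]: "g \<in> borel_measurable lebesgue"
  proof -
    have "- near_dual j \<in> sets lebesgue" using near_dual_sets by (simp add: Compl_in_sets_lebesgue)
    then show ?thesis unfolding g_def by measurable
  qed
  have gper: "tor.periodic j g"
    using tor.periodicD[OF Cper] near_dual_periodic by (simp add: tor.periodic_def g_def indicator_def)
  have shift: "\<omega> + tor.dual_pt (j + 1) q \<notin> near_dual j" if "\<omega> \<in> near_dual j" "q \<in> Q2" for \<omega> q
    using near_dual_lattice_shift that unfolding near_dual_def Q2_def by blast
  have pt2: "ennreal ((cmod (C \<omega>))\<^sup>2) \<le> g \<omega> + of_nat (card coset_box) * (\<Sum>q\<in>Q2. g (\<omega> + tor.dual_pt (j + 1) q))" for \<omega>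
  proof (cases "\<omega> \<in> near_dual j")
    case False
    then show ?thesis by (simp add: g_def add_increasing2)
  next
    case True
    have "ennreal ((cmod (C \<omega>))\<^sup>2) \<le> ennreal (card coset_box * (\<Sum>q\<in>Q2. (cmod (C (\<omega> + tor.dual_pt (j + 1) q)))\<^sup>2))"
      by (intro ennreal_leI ptw)
    also have "\<dots> = of_nat (card coset_box) * (\<Sum>q\<in>Q2. ennreal ((cmod (C (\<omega> + tor.dual_pt (j + 1) q)))\<^sup>2))"
      by (simp add: ennreal_mult sum_nonneg sum_ennreal ennreal_of_nat_eq_real_of_nat)
    also have "(\<Sum>q\<in>Q2. ennreal ((cmod (C (\<omega> + tor.dual_pt (j + 1) q)))\<^sup>2)) = (\<Sum>q\<in>Q2. g (\<omega> + tor.dual_pt (j + 1) q))"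
      by (rule sum.cong[OF refl]) (use shift[OF True] in \<open>simp add: g_def\<close>)
    finally show ?thesis by (simp add: add_increasing)
  qed
  have gt[measurable]: "(\<lambda>\<omega>. g (\<omega> + t)) \<in> borel_measurable (tor.T j)" for t
    by (intro tor.measurable_T borel_measurable_translation gm)
  have gT[measurable]: "g \<in> borel_measurable (tor.T j)" by (intro tor.measurable_T gm)
  have "ennreal (sq_norm (tor.T j) C) = (\<integral>\<^sup>+\<omega>. ennreal ((cmod (C \<omega>))\<^sup>2) \<partial>tor.T j)"
    using q unfolding C_def by (rule sq_norm_eq_nn_integral)
  also have "\<dots> \<le> (\<integral>\<^sup>+\<omega>. g \<omega> + of_nat (card coset_box) * (\<Sum>q\<in>Q2. g (\<omega> + tor.dual_pt (j + 1) q)) \<partial>tor.T j)"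
    by (intro nn_integral_mono pt2)
  also have "\<dots> = (\<integral>\<^sup>+\<omega>. g \<omega> \<partial>tor.T j) + of_nat (card coset_box) * (\<Sum>q\<in>Q2. \<integral>\<^sup>+\<omega>. g (\<omega> + tor.dual_pt (j + 1) q) \<partial>tor.T j)"
    by (simp add: nn_integral_add nn_integral_cmult nn_integral_sum)
  also have "\<dots> = (\<integral>\<^sup>+\<omega>. g \<omega> \<partial>tor.T j) + of_nat (card coset_box) * (of_nat (card Q2) * (\<integral>\<^sup>+\<omega>. g \<omega> \<partial>tor.T j))"
    by (simp add: tor.nn_integral_periodic_translation[OF gm gper])
  \<comment> \<open>One factor \<open>card coset_box\<close> comes from the pointwise Cauchy-Schwarz
    step, the other counts the shifts, whose integrals are all equal by periodicity.\<close>
  also have "\<dots> \<le> (\<integral>\<^sup>+\<omega>. g \<omega> \<partial>tor.T j) + of_nat (card coset_box) * (of_nat (card coset_box) * (\<integral>\<^sup>+\<omega>. g \<omega> \<partial>tor.T j))"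
    using card2 by (intro add_left_mono mult_left_mono mult_right_mono) auto
  also have "\<dots> = ennreal (1 + real (card coset_box) * real (card coset_box)) * (\<integral>\<^sup>+\<omega>. g \<omega> \<partial>tor.T j)"
    by (simp add: ennreal_plus ennreal_mult distrib_right ennreal_of_nat_eq_real_of_nat mult.assoc)
  finally show ?thesis unfolding C_def g_def .
qed

text \<open>The normalization \<open>\<kappa>\<close> collects the factor in the wavelet system and the one in the definition of
  the interpolant.\<close>

definition \<kappa> :: "int \<Rightarrow> real" where "\<kappa> j = (a powi j) powr (r + CARD('d) / 2)"

definition wavelet_multiplier :: "int \<Rightarrow> real^'d \<Rightarrow> complex" where "wavelet_multiplier j \<omega> = of_real (\<kappa> j / S j \<omega>)"

lemma wavelet_multiplier_measurable[measurable]: "wavelet_multiplier j \<in> borel_measurable lebesgue"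
  unfolding wavelet_multiplier_def by measurable

lemma wavelet_multiplier_periodic: "tor.periodic j (wavelet_multiplier j)"
  using tor.periodicD[OF S_periodic] by (simp add: tor.periodic_def wavelet_multiplier_def)

lemma \<kappa>_square: "(\<kappa> j)\<^sup>2 = (a powi j) powr (2 * r) * (a powi j) ^ CARD('d)"
proof -
  define h where "h = a powi j"
  have h: "h > 0" using a by (simp add: h_def)
  have "(\<kappa> j)\<^sup>2 = h powr (2 * r + real CARD('d))"
    using h unfolding \<kappa>_def h_def[symmetric] by (simp add: powr_power algebra_simps)
  also have "\<dots> = h powr (2 * r) * h ^ CARD('d)" using h by (simp add: powr_add powr_realpow)
  finally show ?thesis by (simp add: h_def)
qed

lemma vol_bounds:
  "\<exists>v V. v > 0 \<and> V > 0 \<and> (\<forall>j. v \<le> (a powi j) ^ CARD('d) * tor.vol j \<and> (a powi j) ^ CARD('d) * tor.vol j \<le> V)"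
proof (rule exI[of _ "unit_ball_vol CARD('d) * pi ^ CARD('d)"],
    rule exI[of _ "unit_ball_vol CARD('d) * (pi * CARD('d)) ^ CARD('d)"], intro conjI allI)
  fix j
  define h where "h = a powi j"
  have h: "h > 0" using a by (simp add: h_def)
  have "unit_ball_vol CARD('d) * (pi / h) ^ CARD('d) \<le> tor.vol j"
    by (rule tor.vol_ge) (use h in \<open>auto simp: norm_Mj h_def\<close>)
  from mult_left_mono[OF this, of "h ^ CARD('d)"]
  show "unit_ball_vol CARD('d) * pi ^ CARD('d) \<le> (a powi j) ^ CARD('d) * tor.vol j"
    using h by (simp add: power_divide h_def[symmetric])
  have "tor.vol j \<le> unit_ball_vol CARD('d) * (pi * CARD('d) / h) ^ CARD('d)"
    by (rule tor.vol_le) (use h in \<open>auto simp: norm_Mj h_def\<close>)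
  from mult_left_mono[OF this, of "h ^ CARD('d)"]
  show "(a powi j) ^ CARD('d) * tor.vol j \<le> unit_ball_vol CARD('d) * (pi * CARD('d)) ^ CARD('d)"
    using h by (simp add: power_divide h_def[symmetric])
qed auto

text \<open>The weight is \<kappa>^2 / S_j. The factor a^(2rj) in \<kappa>^2 cancels against the
  order of S_j, and the remaining a^(dj) compensates the volume of the cell.\<close>

lemma wavelet_multiplier_bound:
  "\<exists>B>0. \<forall>j. fine_scale j \<longrightarrow> (AE \<omega> in lebesgue. (cmod (wavelet_multiplier j \<omega>))\<^sup>2 * S j \<omega> \<le> B * (a powi j) ^ CARD('d))"
proof -
  obtain c where c: "c > 0" "\<And>j. fine_scale j \<Longrightarrow> AE \<omega> in lebesgue. c * (a powi j) powr (2 * r) \<le> S j \<omega>"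
    using S_lower by blast
  show ?thesis
  proof (rule exI[of _ "1 / c"], intro conjI allI impI)
    fix j assume j: "fine_scale j"
    define h where "h = a powi j"
    have h: "h > 0" using a by (simp add: h_def)
    show "AE \<omega> in lebesgue. (cmod (wavelet_multiplier j \<omega>))\<^sup>2 * S j \<omega> \<le> 1 / c * (a powi j) ^ CARD('d)"
      using c(2)[OF j]
    proof eventually_elim
      case (elim \<omega>)
      have ch: "c * h powr (2 * r) > 0" using c h by simp
      then have S: "S j \<omega> > 0" using elim unfolding h_def by linarith
      have "(cmod (wavelet_multiplier j \<omega>))\<^sup>2 * S j \<omega> = (\<kappa> j)\<^sup>2 / S j \<omega>"
        using S by (simp add: wavelet_multiplier_def norm_divide power_divide power2_eq_square)
      also have "\<dots> \<le> (\<kappa> j)\<^sup>2 / (c * h powr (2 * r))"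
        using elim ch unfolding h_def by (intro divide_left_mono) (auto intro: mult_pos_pos S)
      also have "\<dots> = 1 / c * h ^ CARD('d)" unfolding \<kappa>_square h_def[symmetric] using h c by simp
      finally show ?case by (simp add: h_def)
    qed
  qed (use c in simp)
qed

text \<open>The upper bound on S_j is available only away from the dual lattice;
  \<open>char_sum_concentration\<close> makes up for this restriction.\<close>

lemma wavelet_multiplier_lower:
  "\<exists>A>0. \<forall>j. fine_scale j \<longrightarrow> (AE \<omega> in lebesgue. \<omega> \<in> - near_dual j \<longrightarrow> A * (a powi j) ^ CARD('d) \<le> (cmod (wavelet_multiplier j \<omega>))\<^sup>2 * S j \<omega>)"
proof -
  obtain K where K: "K > 0" "\<And>j. fine_scale j \<Longrightarrow> AE \<omega> in lebesgue.
     (\<forall>k. norm (Mj j *v \<omega> + (2 * pi) *\<^sub>R of_int_vec k) \<ge> pi / a) \<longrightarrow> S j \<omega> \<le> K * (a powi j) powr (2 * r)"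
    using S_upper by blast
  show ?thesis
  proof (rule exI[of _ "1 / K"], intro conjI allI impI)
    fix j assume j: "fine_scale j"
    define h where "h = a powi j"
    have h: "h > 0" using a by (simp add: h_def)
    show "AE \<omega> in lebesgue. \<omega> \<in> - near_dual j \<longrightarrow> 1 / K * (a powi j) ^ CARD('d) \<le> (cmod (wavelet_multiplier j \<omega>))\<^sup>2 * S j \<omega>"
      using K(2)[OF j] AE_S[of j]
    proof eventually_elim
      case (elim \<omega>)
      show ?case
      proof
        assume "\<omega> \<in> - near_dual j"
        then have le: "S j \<omega> \<le> K * h powr (2 * r)" using elim by (auto simp: near_dual_def h_def not_less)
        have S: "S j \<omega> > 0" using elim by simp
        have "1 / K * h ^ CARD('d) = (\<kappa> j)\<^sup>2 / (K * h powr (2 * r))"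
          unfolding \<kappa>_square h_def[symmetric] using h K by simp
        also have "\<dots> \<le> (\<kappa> j)\<^sup>2 / S j \<omega>"
          using le S K h by (intro divide_left_mono) auto
        also have "\<dots> = (cmod (wavelet_multiplier j \<omega>))\<^sup>2 * S j \<omega>"
          using S by (simp add: wavelet_multiplier_def norm_divide power_divide power2_eq_square)
        finally show "1 / K * (a powi j) ^ CARD('d) \<le> (cmod (wavelet_multiplier j \<omega>))\<^sup>2 * S j \<omega>" by (simp add: h_def)
      qed
    qed
  qed (use K in simp)
qed

text \<open>At a single scale the bounds come straight from the localization condition, whose
  constants enclose the weight |Ld|^2 S_j. They may depend on \<open>j\<close>, since the system
  contains B-splines of one scale only.\<close>

lemma base_block:
  "\<exists>A B. A > 0 \<and> (\<forall>F (pt :: 'i \<Rightarrow> real^'d) c. finite F \<longrightarrow> inj_on pt F \<longrightarrow> pt ` F \<subseteq> dilated_lattice D j \<longrightarrow>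
      sq_int lebesgue (\<lambda>\<omega>. char_sum F pt c \<omega> * Ld j \<omega> / L \<omega>) \<and>
      A * (\<Sum>i\<in>F. (cmod (c i))\<^sup>2) \<le> sq_norm lebesgue (\<lambda>\<omega>. char_sum F pt c \<omega> * Ld j \<omega> / L \<omega>) \<and>
      sq_norm lebesgue (\<lambda>\<omega>. char_sum F pt c \<omega> * Ld j \<omega> / L \<omega>) \<le> B * (\<Sum>i\<in>F. (cmod (c i))\<^sup>2))"
proof (rule AE_localizes[of j])
  fix A B assume A: "A > 0" and AE0: "AE \<omega> in lebesgue. good A B j \<omega>"
  note AE = AE0[unfolded good_def]
  have up: "AE \<omega> in lebesgue. (cmod (Ld j \<omega>))\<^sup>2 * S j \<omega> \<le> max B 0"
    using AE by eventually_elim auto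
  have lo: "AE \<omega> in lebesgue. \<omega> \<in> UNIV \<longrightarrow> A \<le> (cmod (Ld j \<omega>))\<^sup>2 * S j \<omega>"
    using AE by eventually_elim auto
  show ?thesis
  proof (rule exI[of _ "A * tor.vol j"], rule exI[of _ "max B 0 * tor.vol j"], intro conjI[of "_ > _"] allI impI)
    show "A * tor.vol j > 0" using A tor.vol_pos by simp
    fix F and pt :: "'i \<Rightarrow> real^'d" and c assume F: "finite F" "inj_on pt F" "pt ` F \<subseteq> dilated_lattice D j"
    have C: "char_sum F pt c \<in> borel_measurable lebesgue" "tor.periodic j (char_sum F pt c)" "sq_int (tor.T j) (char_sum F pt c)"
      using F by (auto intro: char_sum_periodic char_sum_norm)
    have n: "sq_norm (tor.T j) (char_sum F pt c) = tor.vol j * (\<Sum>i\<in>F. (cmod (c i))\<^sup>2)"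
      using F by (intro char_sum_norm) auto
    note u = block_upper[OF C Ld_measurable Ld_periodic _ up]
    have "A * sq_norm (tor.T j) (char_sum F pt c) \<le> 1 * sq_norm lebesgue (\<lambda>\<omega>. char_sum F pt c \<omega> * Ld j \<omega> / L \<omega>)"
      by (rule block_lower[OF C Ld_measurable Ld_periodic u(1) _ lo]) (use A C in \<open>auto simp: sq_norm_eq_nn_integral\<close>)
    then show "sq_int lebesgue (\<lambda>\<omega>. char_sum F pt c \<omega> * Ld j \<omega> / L \<omega>) \<and>
      A * tor.vol j * (\<Sum>i\<in>F. (cmod (c i))\<^sup>2) \<le> sq_norm lebesgue (\<lambda>\<omega>. char_sum F pt c \<omega> * Ld j \<omega> / L \<omega>) \<and>
      sq_norm lebesgue (\<lambda>\<omega>. char_sum F pt c \<omega> * Ld j \<omega> / L \<omega>) \<le> max B 0 * tor.vol j * (\<Sum>i\<in>F. (cmod (c i))\<^sup>2)"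
      using u unfolding n by (simp add: mult.assoc)
  qed
qed

text \<open>The constants precede the quantifier over \<open>j\<close> because the system contains
  all scales up to \<open>j0\<close>; hence the restriction to fine scales and to frequencies
  outside the coarser lattice.\<close>

lemma wavelet_block:
  "\<exists>A B. A > 0 \<and> (\<forall>j F (pt :: 'i \<Rightarrow> real^'d) c. fine_scale j \<longrightarrow> finite F \<longrightarrow> inj_on pt F \<longrightarrow>
      pt ` F \<subseteq> dilated_lattice D j - dilated_lattice D (j + 1) \<longrightarrow>
      sq_int lebesgue (\<lambda>\<omega>. char_sum F pt c \<omega> * wavelet_multiplier j \<omega> / L \<omega>) \<and>
      A * (\<Sum>i\<in>F. (cmod (c i))\<^sup>2) \<le> sq_norm lebesgue (\<lambda>\<omega>. char_sum F pt c \<omega> * wavelet_multiplier j \<omega> / L \<omega>) \<and>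
      sq_norm lebesgue (\<lambda>\<omega>. char_sum F pt c \<omega> * wavelet_multiplier j \<omega> / L \<omega>) \<le> B * (\<Sum>i\<in>F. (cmod (c i))\<^sup>2))"
proof -
  obtain B where B: "B > 0" "\<And>j. fine_scale j \<Longrightarrow> AE \<omega> in lebesgue. (cmod (wavelet_multiplier j \<omega>))\<^sup>2 * S j \<omega> \<le> B * (a powi j) ^ CARD('d)"
    using wavelet_multiplier_bound by blast
  obtain A where A: "A > 0" "\<And>j. fine_scale j \<Longrightarrow> AE \<omega> in lebesgue. \<omega> \<in> - near_dual j \<longrightarrow> A * (a powi j) ^ CARD('d) \<le> (cmod (wavelet_multiplier j \<omega>))\<^sup>2 * S j \<omega>"
    using wavelet_multiplier_lower by blast
  obtain v V where v: "v > 0" "V > 0" "\<And>j. v \<le> (a powi j) ^ CARD('d) * tor.vol j" "\<And>j. (a powi j) ^ CARD('d) * tor.vol j \<le> V"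
    using vol_bounds by blast
  define K where "K = 1 + real (card coset_box) * real (card coset_box)"
  have K: "K > 0" by (simp add: K_def add_pos_nonneg)
  show ?thesis
  proof (rule exI[of _ "A * v / K"], rule exI[of _ "B * V"], intro conjI[of "_ > _"] allI impI)
    show "A * v / K > 0" using A v K by simp
    fix j F and pt :: "'i \<Rightarrow> real^'d" and c
    assume j: "fine_scale j" and F: "finite F" "inj_on pt F" "pt ` F \<subseteq> dilated_lattice D j - dilated_lattice D (j + 1)"
    define h where "h = (a powi j) ^ CARD('d)"
    have h: "h > 0" using a by (simp add: h_def)
    define \<Sigma> where "\<Sigma> = (\<Sum>i\<in>F. (cmod (c i))\<^sup>2)"
    have \<Sigma>: "\<Sigma> \<ge> 0" unfolding \<Sigma>_def by (intro sum_nonneg) simp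
    have C: "char_sum F pt c \<in> borel_measurable lebesgue" "tor.periodic j (char_sum F pt c)" "sq_int (tor.T j) (char_sum F pt c)"
      using F by (auto intro!: char_sum_periodic char_sum_norm)
    have n: "sq_norm (tor.T j) (char_sum F pt c) = tor.vol j * \<Sigma>"
      unfolding \<Sigma>_def using F by (intro char_sum_norm) auto
    have hB: "0 \<le> B * h" "0 \<le> A * h" using A B h by auto
    note u = block_upper[OF C wavelet_multiplier_measurable wavelet_multiplier_periodic hB(1) B(2)[OF j, folded h_def]]
    have conc: "ennreal (sq_norm (tor.T j) (char_sum F pt c)) \<le> ennreal K *
     (\<integral>\<^sup>+\<omega>. ennreal ((cmod (char_sum F pt c \<omega>))\<^sup>2) * indicator (- near_dual j) \<omega> \<partial>tor.T j)"
      unfolding K_def by (rule char_sum_concentration[OF F(1) _ C(3)]) (use F in auto)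
    have "- near_dual j \<in> sets lebesgue" using near_dual_sets by (simp add: Compl_in_sets_lebesgue)
    from block_lower[OF C wavelet_multiplier_measurable wavelet_multiplier_periodic u(1) hB(2) A(2)[OF j, folded h_def] this _ conc]
    have l: "A * h * (tor.vol j * \<Sigma>) \<le> K * sq_norm lebesgue (\<lambda>\<omega>. char_sum F pt c \<omega> * wavelet_multiplier j \<omega> / L \<omega>)"
      using K unfolding n by simp
    have "A * \<Sigma> * v \<le> A * \<Sigma> * (h * tor.vol j)" using A \<Sigma> v(3)[of j] unfolding h_def by (intro mult_left_mono) auto
    then have l': "A * v / K * \<Sigma> \<le> sq_norm lebesgue (\<lambda>\<omega>. char_sum F pt c \<omega> * wavelet_multiplier j \<omega> / L \<omega>)"
      using l K by (simp add: field_simps)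
    have "B * \<Sigma> * (h * tor.vol j) \<le> B * \<Sigma> * V" using B \<Sigma> v(4)[of j] unfolding h_def by (intro mult_left_mono) auto
    then have "sq_norm lebesgue (\<lambda>\<omega>. char_sum F pt c \<omega> * wavelet_multiplier j \<omega> / L \<omega>) \<le> B * V * \<Sigma>"
      using u(2) unfolding n by (simp add: mult_ac)
    then show "sq_int lebesgue (\<lambda>\<omega>. char_sum F pt c \<omega> * wavelet_multiplier j \<omega> / L \<omega>) \<and>
      A * v / K * (\<Sum>i\<in>F. (cmod (c i))\<^sup>2) \<le> sq_norm lebesgue (\<lambda>\<omega>. char_sum F pt c \<omega> * wavelet_multiplier j \<omega> / L \<omega>) \<and>
      sq_norm lebesgue (\<lambda>\<omega>. char_sum F pt c \<omega> * wavelet_multiplier j \<omega> / L \<omega>) \<le> B * V * (\<Sum>i\<in>F. (cmod (c i))\<^sup>2)"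
      using u(1) l' unfolding \<Sigma>_def by blast
  qed
qed

section \<open>Orthogonality of different scales\<close>

text \<open>The Fourier transform of the translate by \<beta> of the function with transform m /
  L.\<close>

definition elem :: "(real^'d \<Rightarrow> complex) \<Rightarrow> real^'d \<Rightarrow> real^'d \<Rightarrow> complex" where
  "elem m \<beta> \<omega> = cis (- (\<omega> \<bullet> \<beta>)) * m \<omega> / L \<omega>"

lemma cis_inner_measurable[measurable]: "(\<lambda>\<omega>. cis (- (\<omega> \<bullet> \<beta>))) \<in> borel_measurable (lebesgue :: (real^'d) measure)"
  using cis_measurable_lebesgue[of "-1" \<beta>] by simp

lemma fold_elem:
  assumes per: "tor.periodic j m" and \<beta>: "\<beta> \<in> dilated_lattice D j"
  shows "tor.fold j (\<lambda>\<omega>. elem m \<beta> \<omega> / cnj (L \<omega>)) \<omega> = cis (- (\<omega> \<bullet> \<beta>)) * m \<omega> * of_real (S j \<omega>)"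
proof -
  have per2: "tor.periodic j (\<lambda>\<omega>. cis (- (\<omega> \<bullet> \<beta>)) * m \<omega>)" by (intro periodic_mult cis_periodic \<beta> per)
  have inv: "z / (l * cnj l) = z * of_real (inverse ((cmod l)\<^sup>2))" for z l
    unfolding complex_norm_square[symmetric] by (simp add: divide_inverse)
  have eq: "elem m \<beta> (\<omega> + tor.dual_pt j k) / cnj (L (\<omega> + tor.dual_pt j k))
      = (cis (- (\<omega> \<bullet> \<beta>)) * m \<omega>) * of_real (inverse ((cmod (L (\<omega> + tor.dual_pt j k)))\<^sup>2))" for k
    unfolding elem_def tor.periodicD[OF per2] divide_divide_eq_left inv ..
  show ?thesis
    unfolding S_fold[symmetric] unfolding tor.fold_def eq by (rule integral_mult_right_zero)
qed

text \<open>Pairing with the wavelet multiplier cancels the weight \<open>S j\<close> and leaves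
  \<open>m\<close> times a product of characters. Some shift by a dual point of scale j + 1 fixes
  \<open>m\<close> and the character of \<gamma> but multiplies that of \<beta> by a number other
  than 1, so the integral vanishes.\<close>

lemma levels_orthogonal:
  assumes jl: "j < l"
    and \<beta>: "\<beta> \<in> dilated_lattice D j - dilated_lattice D (j + 1)" and \<gamma>: "\<gamma> \<in> dilated_lattice D l"
    and m[measurable]: "m \<in> borel_measurable lebesgue" and mper: "tor.periodic l m"
    and q: "sq_int lebesgue (elem m \<gamma>)" "sq_int lebesgue (elem (wavelet_multiplier j) \<beta>)"
  shows "ip lebesgue (elem m \<gamma>) (elem (wavelet_multiplier j) \<beta>) = 0"
proof -
  have \<gamma>j: "\<gamma> \<in> dilated_lattice D j" "\<gamma> \<in> dilated_lattice D (j + 1)"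
    using \<gamma> dilated_lattice_mono[of j l] dilated_lattice_mono[of "j + 1" l] jl by auto
  have mj: "tor.periodic j m" "tor.periodic (j + 1) m"
    using mper periodic_mono[of j l m] periodic_mono[of "j + 1" l m] jl by auto
  obtain k where k: "\<beta> = lattice_pt D j k" "lattice_pt D j k \<notin> dilated_lattice D (j + 1)"
    using \<beta> by (auto simp: dilated_lattice_def)
  define n where "n \<omega> = cis (- (\<omega> \<bullet> \<beta>)) * wavelet_multiplier j \<omega>" for \<omega>
  have nper: "tor.periodic j n" unfolding n_def by (intro periodic_mult cis_periodic wavelet_multiplier_periodic) (use \<beta> in auto)
  have nq: "sq_int lebesgue (\<lambda>\<omega>. n \<omega> / L \<omega>)" using q(2) by (simp add: elem_def[abs_def] n_def)
  define h where "h \<omega> = of_real (\<kappa> j) * (cis (- (\<omega> \<bullet> \<gamma>)) * cnj (cis (- (\<omega> \<bullet> \<beta>))) * m \<omega>)" for \<omega>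
  have hm[measurable]: "h \<in> borel_measurable lebesgue" unfolding h_def by measurable
  have hper: "tor.periodic j h"
    using tor.periodicD[OF cis_periodic[OF \<gamma>j(1)]] tor.periodicD[OF cis_periodic[of \<beta> j]] \<beta> tor.periodicD[OF mj(1)]
    by (simp add: tor.periodic_def h_def)
  have AE: "AE \<omega> in tor.T j. tor.fold j (\<lambda>\<omega>. elem m \<gamma> \<omega> / cnj (L \<omega>)) \<omega> * cnj (n \<omega>) = h \<omega>"
    using tor.AE_T[OF AE_S[of j], of j]
  proof eventually_elim
    case (elim \<omega>)
    then have "S j \<omega> \<noteq> 0" by auto
    then show ?case unfolding fold_elem[OF mj(1) \<gamma>j(1)] n_def h_def wavelet_multiplier_def by (simp add: mult_ac)
  qed
  have fm: "(\<lambda>\<omega>. tor.fold j (\<lambda>\<omega>. elem m \<gamma> \<omega> / cnj (L \<omega>)) \<omega> * cnj (n \<omega>)) \<in> borel_measurable (tor.T j)"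
    using ip_quotient(2)[OF q(1) nq nper] by (rule borel_measurable_integrable)
  have hT: "h \<in> borel_measurable (tor.T j)" by (intro tor.measurable_T hm)
  have hint: "integrable (tor.T j) h"
    using ip_quotient(2)[OF q(1) nq nper] integrable_cong_AE[OF fm hT AE] by simp
  have "ip lebesgue (elem m \<gamma>) (elem (wavelet_multiplier j) \<beta>) = (\<integral>\<omega>. h \<omega> \<partial>tor.T j)"
  proof -
    have "elem (wavelet_multiplier j) \<beta> = (\<lambda>\<omega>. n \<omega> / L \<omega>)" by (simp add: elem_def[abs_def] n_def)
    then show ?thesis using ip_quotient(1)[OF q(1) nq nper] integral_cong_AE[OF fm hT AE] by simp
  qed
  moreover have "(\<integral>\<omega>. h \<omega> \<partial>tor.T j) = 0"
  proof -
    obtain s where s: "cis (- (tor.dual_pt (j + 1) s \<bullet> \<beta>)) \<noteq> 1" using dual_pt_Suc_separates[OF k(2)] k(1) by blast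
    define e where "e = tor.dual_pt (j + 1) s"
    have g1: "cis (- (e \<bullet> \<gamma>)) = 1"
      using tor.periodicD[OF cis_periodic[OF \<gamma>j(2)], of 0 s] by (simp add: e_def)
    have me: "m (\<omega> + e) = m \<omega>" for \<omega> unfolding e_def by (rule tor.periodicD[OF mj(2)])
    have cs: "cis (- ((\<omega> + e) \<bullet> x)) = cis (- (\<omega> \<bullet> x)) * cis (- (e \<bullet> x))" for \<omega> x
      by (simp add: inner_add_left cis_mult)
    have "h (\<omega> + e) = h \<omega> * cnj (cis (- (e \<bullet> \<beta>)))" for \<omega>
      unfolding h_def cs me g1 by simp
    then have "(\<integral>\<omega>. h \<omega> \<partial>tor.T j) * cnj (cis (- (e \<bullet> \<beta>))) = (\<integral>\<omega>. h \<omega> \<partial>tor.T j)"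
      using tor.integral_periodic_translation[OF hm hper hint, of e] by simp
    then have "(\<integral>\<omega>. h \<omega> \<partial>tor.T j) * (cnj (cis (- (e \<bullet> \<beta>))) - 1) = 0" by (simp add: algebra_simps)
    moreover have "cnj (cis (- (e \<bullet> \<beta>))) \<noteq> 1" using s unfolding e_def by (metis complex_cnj_cancel_iff complex_cnj_one)
    ultimately show ?thesis by simp
  qed
  ultimately show ?thesis by simp
qed

end

context spline
begin

section \<open>Completeness\<close>

abbreviation periodized :: "(real^'d \<Rightarrow> complex) \<Rightarrow> int \<Rightarrow> real^'d \<Rightarrow> complex" where
  "periodized g j \<equiv> tor.fold j (\<lambda>\<omega>. g \<omega> / cnj (L \<omega>))"

lemma periodized_measurable: "sq_int lebesgue g \<Longrightarrow> periodized g j \<in> borel_measurable lebesgue"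
proof (rule tor.fold_measurable)
  assume "sq_int lebesgue g"
  then have [measurable]: "g \<in> borel_measurable lebesgue" by (simp add: sq_int_def)
  show "(\<lambda>\<omega>. g \<omega> / cnj (L \<omega>)) \<in> borel_measurable lebesgue" by measurable
qed

lemma elem_char_sum: "elem m \<beta> = (\<lambda>\<omega>. char_sum {\<beta>} id (\<lambda>_. 1) \<omega> * m \<omega> / L \<omega>)"
  by (simp add: elem_def char_sum_def fun_eq_iff)

lemma sq_int_elem_base: "\<beta> \<in> dilated_lattice D j \<Longrightarrow> sq_int lebesgue (elem (Ld j) \<beta>)"
  unfolding elem_char_sum using base_block[where j=j and 'i="real^'d"] by (elim exE conjE) simp

lemma sq_int_elem_wavelet:
  "fine_scale j \<Longrightarrow> \<beta> \<in> dilated_lattice D j - dilated_lattice D (j + 1) \<Longrightarrow> sq_int lebesgue (elem (wavelet_multiplier j) \<beta>)"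
  unfolding elem_char_sum using wavelet_block[where 'i="real^'d"] by (elim exE conjE) simp

text \<open>The minus sign makes the pairings exactly the Fourier coefficients of the periodization
  times the conjugate multiplier.\<close>

lemma ip_elem:
  assumes g: "sq_int lebesgue g" and q: "sq_int lebesgue (elem m (lattice_pt D j (- k)))" and per: "tor.periodic j m"
  shows "ip lebesgue g (elem m (lattice_pt D j (- k))) = (\<integral>\<omega>. periodized g j \<omega> * cnj (m \<omega>) * cnj (tor.chr j k \<omega>) \<partial>tor.T j)"
proof -
  have eq: "elem m (lattice_pt D j (- k)) = (\<lambda>\<omega>. (tor.chr j k \<omega> * m \<omega>) / L \<omega>)"
    by (simp add: elem_def cis_lattice_pt fun_eq_iff)
  have "tor.periodic j (\<lambda>\<omega>. tor.chr j k \<omega> * m \<omega>)" by (intro periodic_mult tor.chr_periodic per)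
  from ip_quotient(1)[OF g q[unfolded eq] this] show ?thesis unfolding eq by (simp add: mult_ac)
qed

text \<open>By Cauchy-Schwarz and the upper localization bound, the periodization times the
  conjugate of \<open>Ld j\<close> is square-integrable on the cell. All its Fourier coefficients
  vanish, and \<open>Ld j\<close> is nonzero almost everywhere.\<close>

lemma periodized_base_zero:
  assumes g: "sq_int lebesgue g"
    and orth: "\<And>\<beta>. \<beta> \<in> dilated_lattice D j \<Longrightarrow> ip lebesgue g (elem (Ld j) \<beta>) = 0"
  shows "AE \<omega> in lebesgue. periodized g j \<omega> = 0"
proof (rule AE_localizes[of j])
  fix A B assume A: "A > 0" and AE0: "AE \<omega> in lebesgue. good A B j \<omega>"
  note AE = AE0[unfolded good_def]
  have [measurable]: "periodized g j \<in> borel_measurable lebesgue" by (rule periodized_measurable[OF g])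
  define v where "v \<omega> = periodized g j \<omega> * cnj (Ld j \<omega>)" for \<omega>
  have vm: "v \<in> borel_measurable (tor.T j)" unfolding v_def by (rule tor.measurable_T) measurable
  have vq: "sq_int (tor.T j) v"
    unfolding sq_int_def
  proof (intro conjI vm, rule Bochner_Integration.integrable_bound)
    show "integrable (tor.T j) (\<lambda>\<omega>. B * tor.energy j g \<omega>)" using tor.integrable_energy[OF g, of j] by simp
    have "AE \<omega> in lebesgue. norm ((cmod (v \<omega>))\<^sup>2) \<le> norm (B * tor.energy j g \<omega>)"
      using AE fold_cauchy_schwarz[OF g, of j]
    proof eventually_elim
      case (elim \<omega>)
      have "(cmod (v \<omega>))\<^sup>2 = (cmod (periodized g j \<omega>))\<^sup>2 * (cmod (Ld j \<omega>))\<^sup>2" by (simp add: v_def norm_mult power_mult_distrib)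
      also have "\<dots> \<le> (tor.energy j g \<omega> * S j \<omega>) * (cmod (Ld j \<omega>))\<^sup>2" using elim by (intro mult_right_mono) auto
      also have "\<dots> = tor.energy j g \<omega> * ((cmod (Ld j \<omega>))\<^sup>2 * S j \<omega>)" by simp
      also have "\<dots> \<le> tor.energy j g \<omega> * B" using elim by (intro mult_left_mono) auto
      finally show ?case by (simp add: mult.commute abs_le_iff)
    qed
    then show "AE \<omega> in tor.T j. norm ((cmod (v \<omega>))\<^sup>2) \<le> norm (B * tor.energy j g \<omega>)" by (rule tor.AE_T)
  qed (use vm in measurable)
  have "ip (tor.T j) v (tor.chr j k) = 0" for k
  proof -
    have \<beta>: "lattice_pt D j (- k) \<in> dilated_lattice D j" by (simp add: dilated_lattice_def)
    show ?thesis
      using ip_elem[OF g sq_int_elem_base[OF \<beta>] Ld_periodic] orth[OF \<beta>] by (simp add: ip_def v_def)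
  qed
  then have "AE \<omega> in tor.T j. v \<omega> = 0" by (rule tor.AE_zero_if_coeffs_zero[OF vq])
  then have "AE \<omega> in tor.T j. periodized g j \<omega> = 0"
    using tor.AE_T[OF AE, of j] by eventually_elim (auto simp: v_def)
  then show ?thesis
    by (rule tor.AE_periodic) (simp add: tor.periodic_def tor.periodicD[OF tor.fold_periodic])
qed

text \<open>Orthogonality to the wavelets of scale \<open>j\<close> makes \<open>periodized g j / S j\<close> periodic with respect to the
  finer dual lattice; tested against the corresponding spline, \<open>g\<close> sees only \<open>periodized g (j + 1) = 0\<close>.\<close>

lemma periodized_step_zero:
  assumes g: "sq_int lebesgue g" and j: "fine_scale j"
    and zero: "AE \<omega> in lebesgue. periodized g (j + 1) \<omega> = 0"
    and orth: "\<And>\<beta>. \<beta> \<in> dilated_lattice D j - dilated_lattice D (j + 1) \<Longrightarrow> ip lebesgue g (elem (wavelet_multiplier j) \<beta>) = 0"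
  shows "AE \<omega> in lebesgue. periodized g j \<omega> = 0"
proof -
  have [measurable]: "periodized g j \<in> borel_measurable lebesgue" by (rule periodized_measurable[OF g])
  \<comment> \<open>u / L is the orthogonal projection of \<open>g\<close> onto the quotients m / L
    with \<open>m\<close> periodic at scale \<open>j\<close>; proving <g, u / L> = 0 therefore
    forces it to vanish.\<close>
  define u where "u \<omega> = periodized g j \<omega> / of_real (S j \<omega>)" for \<omega>
  have um[measurable]: "u \<in> borel_measurable lebesgue" unfolding u_def by measurable
  have uper: "tor.periodic j u"
    by (simp add: tor.periodic_def u_def tor.periodicD[OF tor.fold_periodic] tor.periodicD[OF S_periodic])
  have uS: "AE \<omega> in lebesgue. (cmod (u \<omega>))\<^sup>2 * S j \<omega> \<le> tor.energy j g \<omega>"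
    using fold_cauchy_schwarz[OF g, of j] AE_S[of j]
  proof eventually_elim
    case (elim \<omega>)
    then have "(cmod (u \<omega>))\<^sup>2 * S j \<omega> = (cmod (periodized g j \<omega>))\<^sup>2 / S j \<omega>"
      by (simp add: u_def norm_divide power_divide power2_eq_square)
    also have "\<dots> \<le> tor.energy j g \<omega>" using elim by (simp add: divide_le_eq)
    finally show ?case .
  qed
  have uq: "sq_int (tor.T j) u"
  proof -
    obtain c where c: "c > 0" "AE \<omega> in lebesgue. c * (a powi j) powr (2 * r) \<le> S j \<omega>"
      using S_lower j by blast
    define s where "s = c * (a powi j) powr (2 * r)"
    have s: "s > 0" using c a by (simp add: s_def)
    show ?thesis
      unfolding sq_int_def
    proof (intro conjI tor.measurable_T um, rule Bochner_Integration.integrable_bound)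
      show "integrable (tor.T j) (\<lambda>\<omega>. 1 / s * tor.energy j g \<omega>)" using tor.integrable_energy[OF g, of j] by simp
      have "AE \<omega> in lebesgue. norm ((cmod (u \<omega>))\<^sup>2) \<le> norm (1 / s * tor.energy j g \<omega>)"
        using uS c(2)
      proof eventually_elim
        case (elim \<omega>)
        have "(cmod (u \<omega>))\<^sup>2 * s \<le> (cmod (u \<omega>))\<^sup>2 * S j \<omega>" using elim unfolding s_def by (intro mult_left_mono) auto
        then have "(cmod (u \<omega>))\<^sup>2 * s \<le> tor.energy j g \<omega>" using elim by linarith
        then show ?case using s by (simp add: field_simps)
      qed
      then show "AE \<omega> in tor.T j. norm ((cmod (u \<omega>))\<^sup>2) \<le> norm (1 / s * tor.energy j g \<omega>)" by (rule tor.AE_T)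
      show "(\<lambda>\<omega>. (cmod (u \<omega>))\<^sup>2) \<in> borel_measurable (tor.T j)" by (rule tor.measurable_T) measurable
    qed
  qed
  have \<kappa>: "\<kappa> j > 0" using a by (simp add: \<kappa>_def)
  have coeff: "ip (tor.T j) u (tor.chr j k) = 0" if k: "lattice_pt D j (- k) \<notin> dilated_lattice D (j + 1)" for k
  proof -
    have \<beta>: "lattice_pt D j (- k) \<in> dilated_lattice D j - dilated_lattice D (j + 1)" using k by (simp add: dilated_lattice_def)
    have "0 = (\<integral>\<omega>. of_real (\<kappa> j) * (u \<omega> * cnj (tor.chr j k \<omega>)) \<partial>tor.T j)"
      using ip_elem[OF g sq_int_elem_wavelet[OF j \<beta>] wavelet_multiplier_periodic] orth[OF \<beta>]
      by (simp add: u_def wavelet_multiplier_def mult_ac)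
    also have "\<dots> = of_real (\<kappa> j) * ip (tor.T j) u (tor.chr j k)" unfolding ip_def by (rule integral_mult_right_zero)
    finally show ?thesis using \<kappa> by simp
  qed
  \<comment> \<open>Only frequencies in the coarser lattice survive in \<open>u\<close>, and their
    characters are invariant under this shift; the two sides have the same Fourier
    coefficients.\<close>
  have "AE \<omega> in lebesgue. u (\<omega> + tor.dual_pt (j + 1) q) = u \<omega>" for q
  proof -
    define e where "e = tor.dual_pt (j + 1) q"
    have uem: "(\<lambda>\<omega>. u (\<omega> + e)) \<in> borel_measurable lebesgue" by (rule borel_measurable_translation[OF um])
    have uep: "tor.periodic j (\<lambda>\<omega>. u (\<omega> + e))"
      unfolding tor.periodic_def
    proof (intro allI)
      fix x k show "u (x + tor.dual_pt j k + e) = u (x + e)"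
        using tor.periodicD[OF uper, of "x + e" k] by (simp add: add_ac)
    qed
    have ueq: "sq_int (tor.T j) (\<lambda>\<omega>. u (\<omega> + e))"
    proof (rule sq_int_if_nn_integral[OF tor.measurable_T[OF uem]])
      have "(\<integral>\<^sup>+\<omega>. ennreal ((cmod (u (\<omega> + e)))\<^sup>2) \<partial>tor.T j) = (\<integral>\<^sup>+\<omega>. ennreal ((cmod (u \<omega>))\<^sup>2) \<partial>tor.T j)"
        by (rule tor.nn_integral_periodic_translation[of "\<lambda>\<omega>. ennreal ((cmod (u \<omega>))\<^sup>2)"])
          (use um uper in \<open>auto simp: tor.periodic_def\<close>)
      also have "\<dots> < \<infinity>" unfolding sq_norm_eq_nn_integral[OF uq, symmetric] by simp
      finally show "(\<integral>\<^sup>+\<omega>. ennreal ((cmod (u (\<omega> + e)))\<^sup>2) \<partial>tor.T j) < \<infinity>" .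
    qed
    have ipe: "ip (tor.T j) (\<lambda>\<omega>. u (\<omega> + e)) (tor.chr j k) = tor.chr j k e * ip (tor.T j) u (tor.chr j k)" for k
    proof -
      define h where "h \<omega> = u \<omega> * cnj (tor.chr j k \<omega>)" for \<omega>
      have hm: "h \<in> borel_measurable lebesgue" unfolding h_def by measurable
      have hp: "tor.periodic j h"
        by (simp add: tor.periodic_def h_def tor.periodicD[OF uper] tor.periodicD[OF tor.chr_periodic])
      have hi: "integrable (tor.T j) h" unfolding h_def by (rule integrable_mult_cnj[OF uq tor.sq_int_chr])
      have one: "tor.chr j k e * cnj (tor.chr j k e) = 1" by (simp flip: complex_norm_square)
      have "u (\<omega> + e) * cnj (tor.chr j k \<omega>) = tor.chr j k e * h (\<omega> + e)" for \<omega>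
      proof -
        have "tor.chr j k e * h (\<omega> + e) = u (\<omega> + e) * cnj (tor.chr j k \<omega>) * (tor.chr j k e * cnj (tor.chr j k e))"
          by (simp add: h_def tor.chr_shift mult_ac)
        then show ?thesis by (simp only: one mult_1_right)
      qed
      then have "ip (tor.T j) (\<lambda>\<omega>. u (\<omega> + e)) (tor.chr j k) = tor.chr j k e * (\<integral>\<omega>. h (\<omega> + e) \<partial>tor.T j)"
        by (simp add: ip_def)
      also have "(\<integral>\<omega>. h (\<omega> + e) \<partial>tor.T j) = ip (tor.T j) u (tor.chr j k)"
        using tor.integral_periodic_translation[OF hm hp hi] by (simp add: ip_def h_def)
      finally show ?thesis .
    qed
    have "AE \<omega> in tor.T j. u (\<omega> + e) - u \<omega> = 0"
    proof (rule tor.AE_zero_if_coeffs_zero[OF sq_int_diff[OF ueq uq]])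
      fix k
      show "ip (tor.T j) (\<lambda>\<omega>. u (\<omega> + e) - u \<omega>) (tor.chr j k) = 0"
      proof (cases "lattice_pt D j (- k) \<in> dilated_lattice D (j + 1)")
        case True
        have "tor.chr j k e = 1"
          using tor.periodicD[OF cis_periodic[OF True], of 0 q] by (simp add: e_def cis_lattice_pt)
        then show ?thesis using ipe[of k] by (simp add: ip_diff_left ueq uq)
      next
        case False
        then show ?thesis using ipe[of k] coeff[of k] by (simp add: ip_diff_left ueq uq)
      qed
    qed
    then have "AE \<omega> in tor.T j. u (\<omega> + e) = u \<omega>" by simp
    then have "AE \<omega> in lebesgue. u (\<omega> + e) = u \<omega>"
      by (rule tor.AE_periodic) (simp add: tor.periodic_def tor.periodicD[OF uper] tor.periodicD[OF uep])
    then show ?thesis by (simp add: e_def)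
  qed
  then have uinv: "AE \<omega> in lebesgue. \<forall>q. u (\<omega> + tor.dual_pt (j + 1) q) = u \<omega>" by (simp add: AE_all_countable)
  have uLq: "sq_int lebesgue (\<lambda>\<omega>. u \<omega> / L \<omega>)"
    by (rule sq_int_quotient[OF um uper tor.AE_T[OF uS] tor.integrable_energy[OF g]])
  define f where "f \<omega> = g \<omega> * cnj (u \<omega> / L \<omega>)" for \<omega>
  have fi: "integrable lebesgue f" unfolding f_def by (rule integrable_mult_cnj[OF g uLq])
  have "ip lebesgue g (\<lambda>\<omega>. u \<omega> / L \<omega>) = (\<integral>\<omega>. tor.fold (j + 1) f \<omega> \<partial>tor.T (j + 1))"
    unfolding tor.integral_fold[OF fi] by (simp add: ip_def f_def[abs_def])
  also have "\<dots> = (\<integral>\<omega>. 0 \<partial>tor.T (j + 1))"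
  proof (rule integral_cong_AE)
    show "tor.fold (j + 1) f \<in> borel_measurable (tor.T (j + 1))"
      using tor.integrable_fold[OF fi] by (rule borel_measurable_integrable)
    have "AE \<omega> in lebesgue. tor.fold (j + 1) f \<omega> = 0"
      using uinv zero
    proof eventually_elim
      case (elim \<omega>)
      have "f (\<omega> + tor.dual_pt (j + 1) q) = (g (\<omega> + tor.dual_pt (j + 1) q) / cnj (L (\<omega> + tor.dual_pt (j + 1) q))) * cnj (u \<omega>)" for q
        using elim by (simp add: f_def)
      then have "tor.fold (j + 1) f \<omega> = periodized g (j + 1) \<omega> * cnj (u \<omega>)"
        unfolding tor.fold_def by (simp only: integral_mult_left_zero)
      then show ?case using elim by simp
    qed
    then show "AE \<omega> in tor.T (j + 1). tor.fold (j + 1) f \<omega> = 0" by (rule tor.AE_T)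
  qed simp
  finally have I0: "ip lebesgue g (\<lambda>\<omega>. u \<omega> / L \<omega>) = 0" by simp
  \<comment> \<open>The integrand of <g, u / L> over the cell is nonnegative, so the vanishing
    integral makes it vanish almost everywhere.\<close>
  define w where "w \<omega> = (cmod (periodized g j \<omega>))\<^sup>2 / S j \<omega>" for \<omega>
  have w: "periodized g j \<omega> * cnj (u \<omega>) = of_real (w \<omega>)" for \<omega>
    using complex_norm_square[of "periodized g j \<omega>"] by (simp add: u_def w_def)
  have wi: "integrable (tor.T j) w"
    using integrable_Re[OF ip_quotient(2)[OF g uLq uper]] by (simp add: w)
  have "complex_of_real (\<integral>\<omega>. w \<omega> \<partial>tor.T j) = 0"
    using ip_quotient(1)[OF g uLq uper] unfolding I0 w by (simp add: integral_complex_of_real)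
  then have "(\<integral>\<omega>. w \<omega> \<partial>tor.T j) = 0" by simp
  then have "AE \<omega> in tor.T j. w \<omega> = 0"
    by (subst (asm) integral_nonneg_eq_0_iff_AE[OF wi]) (auto simp: w_def)
  then have "AE \<omega> in tor.T j. periodized g j \<omega> = 0"
    using tor.AE_T[OF AE_S[of j], of j] by eventually_elim (auto simp: w_def)
  then show ?thesis
    by (rule tor.AE_periodic) (simp add: tor.periodic_def tor.periodicD[OF tor.fold_periodic])
qed

lemma norm_of_int_vec_ge_1: "k \<noteq> 0 \<Longrightarrow> norm (of_int_vec k :: real^'d) \<ge> 1"
proof -
  assume "k \<noteq> 0"
  then obtain i where "k $ i \<noteq> 0" by (auto simp: vec_eq_iff)
  then have "1 \<le> \<bar>of_int (k $ i) :: real\<bar>" by linarith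
  also have "\<dots> \<le> norm (of_int_vec k :: real^'d)" using component_le_norm_cart[of "of_int_vec k :: real^'d" i] by simp
  finally show ?thesis .
qed

text \<open>If \<open>periodized g j\<close> vanishes, then at points well inside the cell the value of \<open>g\<close> is determined by its
  translates, which are damped by the growth of the symbol.\<close>

lemma periodized_zero_pointwise:
  "\<exists>K>0. \<forall>g j. sq_int lebesgue g \<longrightarrow> fine_scale j \<longrightarrow> (AE \<omega> in lebesgue. periodized g j \<omega> = 0) \<longrightarrow>
     (AE \<omega> in lebesgue. norm (Mj j *v \<omega>) \<le> pi \<longrightarrow>
        (cmod (g \<omega>))\<^sup>2 \<le> (cmod (L \<omega>))\<^sup>2 * (K * (a powi j) powr (2 * r)) * tor.energy j g \<omega>)"
proof -
  obtain K where K: "K > 0" "\<And>j \<omega> F. fine_scale j \<Longrightarrow> finite F \<Longrightarrow>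
      (\<forall>k\<in>F. norm (Mj j *v \<omega> + (2 * pi) *\<^sub>R of_int_vec k) \<ge> pi / a) \<Longrightarrow>
      (\<Sum>k\<in>F. inverse ((cmod (L (\<omega> + tor.dual_pt j k)))\<^sup>2)) \<le> K * (a powi j) powr (2 * r)"
    using partial_S_upper by blast
  show ?thesis
  proof (rule exI[of _ K], intro conjI allI impI K(1))
    fix g j assume g: "sq_int lebesgue g" and j: "fine_scale j" and zero: "AE \<omega> in lebesgue. periodized g j \<omega> = 0"
    show "AE \<omega> in lebesgue. norm (Mj j *v \<omega>) \<le> pi \<longrightarrow>
        (cmod (g \<omega>))\<^sup>2 \<le> (cmod (L \<omega>))\<^sup>2 * (K * (a powi j) powr (2 * r)) * tor.energy j g \<omega>"
      using zero tor.AE_energy[OF g, of j] AE_S[of j] L_nz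
    proof eventually_elim
      case (elim \<omega>)
      show ?case
      proof
        assume small: "norm (Mj j *v \<omega>) \<le> pi"
        define H where "H = K * (a powi j) powr (2 * r)"
        have H0: "H \<ge> 0" using K by (simp add: H_def)
        let ?K = "count_space (UNIV :: (int^'d) set)"
        define u where "u k = g (\<omega> + tor.dual_pt j k)" for k
        \<comment> \<open>The central term is omitted: it carries the value of \<open>g\<close> to
          be estimated, and the symbol is not controlled at \<omega> itself.\<close>
        define v where "v k = (if k = 0 then 0 else inverse (L (\<omega> + tor.dual_pt j k)))" for k
        have uq: "sq_int ?K u" using elim by (simp add: u_def[abs_def])
        have Lq: "sq_int ?K (\<lambda>k. inverse (L (\<omega> + tor.dual_pt j k)))" using elim by (simp add: sq_int_def norm_inverse power_inverse)
        have vq: "sq_int ?K v"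
          by (rule sq_int_bound[OF _ Lq, of _ 1]) (auto simp: v_def)
        \<comment> \<open>Every other translate has rescaled length at least 2 pi - pi.\<close>
        have far: "norm (Mj j *v \<omega> + (2 * pi) *\<^sub>R of_int_vec k) \<ge> pi / a" if "k \<noteq> 0" for k
        proof -
          have "2 * pi * 1 \<le> norm ((2 * pi) *\<^sub>R of_int_vec k :: real^'d)"
            using norm_of_int_vec_ge_1[OF that] by simp
          also have "\<dots> \<le> norm (Mj j *v \<omega> + (2 * pi) *\<^sub>R of_int_vec k) + norm (Mj j *v \<omega>)"
            using norm_triangle_ineq4[of "Mj j *v \<omega> + (2 * pi) *\<^sub>R of_int_vec k" "Mj j *v \<omega>"] by simp
          finally have "pi \<le> norm (Mj j *v \<omega> + (2 * pi) *\<^sub>R of_int_vec k)" using small by linarith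
          moreover have "pi / a \<le> pi" using a by (simp add: field_simps)
          ultimately show ?thesis by linarith
        qed
        have vH: "sq_norm ?K v \<le> H"
          unfolding sq_norm_def
        proof (rule integral_count_space_le)
          show "integrable ?K (\<lambda>k. (cmod (v k))\<^sup>2)" using vq by (simp add: sq_int_def)
          fix F :: "(int^'d) set" assume F: "finite F"
          have "(\<Sum>k\<in>F. (cmod (v k))\<^sup>2) = (\<Sum>k\<in>F - {0}. inverse ((cmod (L (\<omega> + tor.dual_pt j k)))\<^sup>2))"
            using F by (intro sum.mono_neutral_cong_right) (auto simp: v_def norm_inverse power_inverse)
          also have "\<dots> \<le> H" unfolding H_def by (rule K(2)[OF j]) (use F far in auto)
          finally show "(\<Sum>k\<in>F. (cmod (v k))\<^sup>2) \<le> H" .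
        qed auto
        have split: "u k * cnj (inverse (L (\<omega> + tor.dual_pt j k))) = indicator {0} k *\<^sub>R (g \<omega> / cnj (L \<omega>)) + u k * cnj (v k)" for k
          by (simp add: v_def u_def divide_inverse)
        have "0 = (\<integral>k. u k * cnj (inverse (L (\<omega> + tor.dual_pt j k))) \<partial>?K)"
          using elim by (simp add: tor.fold_def u_def divide_inverse)
        also have "\<dots> = g \<omega> / cnj (L \<omega>) + ip ?K u v"
          unfolding split ip_def using integrable_mult_cnj[OF uq vq]
          by (subst Bochner_Integration.integral_add) auto
        finally have "g \<omega> / cnj (L \<omega>) = - ip ?K u v" by (simp add: eq_neg_iff_add_eq_0)
        then have "cmod (g \<omega> / cnj (L \<omega>)) = cmod (ip ?K u v)" by simp
        then have "(cmod (g \<omega>))\<^sup>2 / (cmod (L \<omega>))\<^sup>2 = (cmod (ip ?K u v))\<^sup>2"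
          by (simp add: norm_divide power_divide[symmetric])
        also have "\<dots> \<le> sq_norm ?K u * sq_norm ?K v" by (rule ip_cauchy_schwarz[OF uq vq])
        also have "\<dots> \<le> sq_norm ?K u * H" by (intro mult_left_mono vH) simp
        also have "sq_norm ?K u = tor.energy j g \<omega>" by (simp add: tor.energy_def u_def[abs_def])
        finally show "(cmod (g \<omega>))\<^sup>2 \<le> (cmod (L \<omega>))\<^sup>2 * (K * (a powi j) powr (2 * r)) * tor.energy j g \<omega>"
          using elim unfolding H_def by (simp add: divide_le_eq mult_ac)
      qed
    qed
  qed
qed

text \<open>For fixed \<open>M\<close> the ball of radius \<open>M\<close> lies in the cell of every
  sufficiently fine scale. Integrating the pointwise estimate over that cell bounds the squared norm
  of \<open>gM M\<close> by a constant times M^2 a^(2rj) |g|^2, which tends to 0 as \<open>j\<close>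
  decreases.\<close>

lemma zero_if_all_periodized_zero:
  assumes g: "sq_int lebesgue g" and j0: "fine_scale j0"
    and zero: "\<And>j. j \<le> j0 \<Longrightarrow> AE \<omega> in lebesgue. periodized g j \<omega> = 0"
  shows "AE \<omega> in lebesgue. g \<omega> = 0"
proof -
  obtain K where K: "K > 0" "\<And>j. fine_scale j \<Longrightarrow> (AE \<omega> in lebesgue. periodized g j \<omega> = 0) \<Longrightarrow>
     (AE \<omega> in lebesgue. norm (Mj j *v \<omega>) \<le> pi \<longrightarrow>
        (cmod (g \<omega>))\<^sup>2 \<le> (cmod (L \<omega>))\<^sup>2 * (K * (a powi j) powr (2 * r)) * tor.energy j g \<omega>)"
    using periodized_zero_pointwise g by blast
  have [measurable]: "g \<in> borel_measurable lebesgue" using g by (simp add: sq_int_def)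
  have norm_meas[measurable]: "(\<lambda>\<omega>. norm \<omega>) \<in> borel_measurable (lebesgue :: (real^'d) measure)"
    by (rule measurable_completion) simp
  \<comment> \<open>The symbol is bounded here as well, since it may be unbounded on bounded
    sets.\<close>
  define gM where "gM M \<omega> = (if norm \<omega> \<le> real M \<and> cmod (L \<omega>) \<le> real M then g \<omega> else 0)" for M \<omega>
  have gM[measurable]: "gM M \<in> borel_measurable lebesgue" for M
    unfolding gM_def by measurable
  have gMq: "sq_int lebesgue (gM M)" for M
    by (rule sq_int_bound[OF gM g, of _ 1]) (auto simp: gM_def)
  have "sq_norm lebesgue (gM M) = 0" for M
  proof -
    define \<rho> where "\<rho> = a powr (- 2 * r)"
    have \<rho>: "0 \<le> \<rho>" "\<rho> < 1" using a r by (auto simp: \<rho>_def powr_less_one)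
    have bound: "sq_norm lebesgue (gM M) \<le> (real M)\<^sup>2 * K * sq_norm lebesgue g * \<rho> ^ n"
      if n: "- int n \<le> j0" "real M * a powi (- int n) < pi" for n
    proof -
      define j where "j = - int n"
      have jf: "fine_scale j" using fine_scale_mono[OF _ j0, of j] n by (simp add: j_def)
      have pw: "(a powi j) powr (2 * r) = \<rho> ^ n"
      proof -
        have "a powi j = a powr (- real n)" using a by (simp add: j_def power_int_minus powr_minus powr_realpow)
        then have "(a powi j) powr (2 * r) = a powr ((- 2 * r) * real n)" by (simp add: powr_powr mult_ac)
        also have "\<dots> = \<rho> ^ n" 
          by (subst powr_powr[symmetric]) (use a in \<open>simp add: \<rho>_def powr_realpow\<close>)
        finally show ?thesis .
      qed
      define B where "B = (real M)\<^sup>2 * (K * \<rho> ^ n)"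
      have B: "B \<ge> 0" using K \<rho> by (simp add: B_def)
      have Mnorm: "norm (Mj j *v \<omega>) < pi" if "norm \<omega> \<le> real M" for \<omega>
      proof -
        have "norm (Mj j *v \<omega>) = a powi j * norm \<omega>" by (rule norm_Mj)
        also have "\<dots> \<le> a powi j * real M" using that a by (intro mult_left_mono) auto
        finally show ?thesis using n(2) by (simp add: j_def mult.commute)
      qed
      have incell: "\<omega> \<in> tor.cell j" if "norm \<omega> \<le> real M" for \<omega>
      proof -
        have "\<bar>(Mj j *v \<omega>) $ i\<bar> < pi" for i
          using component_le_norm_cart[of "Mj j *v \<omega>" i] Mnorm[OF that] by linarith
        then show ?thesis using tor.cell_subsets(1)[of j] by (auto simp: tor.icell_def)
      qed
      have "ennreal (sq_norm lebesgue (gM M)) = (\<integral>\<^sup>+\<omega>. ennreal ((cmod (gM M \<omega>))\<^sup>2) \<partial>lebesgue)"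
        by (rule sq_norm_eq_nn_integral[OF gMq])
      also have "\<dots> = (\<integral>\<^sup>+\<omega>. ennreal ((cmod (gM M \<omega>))\<^sup>2) * indicator (tor.cell j) \<omega> \<partial>lebesgue)"
        by (intro nn_integral_cong) (use incell in \<open>auto simp: gM_def split: split_indicator\<close>)
      also have "\<dots> = (\<integral>\<^sup>+\<omega>. ennreal ((cmod (gM M \<omega>))\<^sup>2) \<partial>tor.T j)" by (simp add: nn_integral_restrict_space)
      also have "\<dots> \<le> (\<integral>\<^sup>+\<omega>. ennreal (B * tor.energy j g \<omega>) \<partial>tor.T j)"
      proof (rule nn_integral_mono_AE)
        have "AE \<omega> in lebesgue. ennreal ((cmod (gM M \<omega>))\<^sup>2) \<le> ennreal (B * tor.energy j g \<omega>)"
          using K(2)[OF jf zero[OF n(1)[folded j_def]]]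
        proof eventually_elim
          case le: (elim \<omega>)
          show ?case
          proof (cases "norm \<omega> \<le> real M \<and> cmod (L \<omega>) \<le> real M")
            case True
            then have "(cmod (g \<omega>))\<^sup>2 \<le> (cmod (L \<omega>))\<^sup>2 * ((K * \<rho> ^ n) * tor.energy j g \<omega>)"
              using le Mnorm[of \<omega>] by (simp add: pw mult.assoc)
            also have "\<dots> \<le> (real M)\<^sup>2 * ((K * \<rho> ^ n) * tor.energy j g \<omega>)"
              using True K \<rho> by (intro mult_right_mono power_mono) auto
            finally show ?thesis using True by (intro ennreal_leI) (simp add: gM_def B_def mult.assoc)
          next
            case False
            then have "gM M \<omega> = 0" by (auto simp: gM_def)
            then show ?thesis by simp
          qed
        qed
        then show "AE \<omega> in tor.T j. ennreal ((cmod (gM M \<omega>))\<^sup>2) \<le> ennreal (B * tor.energy j g \<omega>)" by (rule tor.AE_T)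
      qed
      also have "\<dots> = ennreal (\<integral>\<omega>. B * tor.energy j g \<omega> \<partial>tor.T j)"
        using tor.integrable_energy[OF g, of j] B by (intro nn_integral_eq_integral) auto
      also have "(\<integral>\<omega>. B * tor.energy j g \<omega> \<partial>tor.T j) = B * sq_norm lebesgue g"
        by (simp add: tor.integral_energy[OF g])
      finally have "sq_norm lebesgue (gM M) \<le> B * sq_norm lebesgue g" using B by (subst (asm) ennreal_le_iff) auto
      then show ?thesis by (simp add: B_def mult_ac)
    qed
    have ev: "\<forall>\<^sub>F n in sequentially. sq_norm lebesgue (gM M) \<le> (real M)\<^sup>2 * K * sq_norm lebesgue g * \<rho> ^ n"
    proof -
      have "(\<lambda>n. real M * inverse a ^ n) \<longlonglongrightarrow> real M * 0"
        using a by (intro tendsto_mult tendsto_const LIMSEQ_realpow_zero) (auto simp: inverse_less_1_iff)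
      then have "\<forall>\<^sub>F n in sequentially. real M * inverse a ^ n < pi"
        by (rule order_tendstoD(2)) simp
      moreover have "\<forall>\<^sub>F n in sequentially. - int n \<le> j0"
        by (rule eventually_sequentiallyI[of "nat (- j0)"]) linarith
      ultimately show ?thesis
        by eventually_elim (rule bound, auto simp: power_int_minus power_inverse)
    qed
    have "(\<lambda>n. (real M)\<^sup>2 * K * sq_norm lebesgue g * \<rho> ^ n) \<longlonglongrightarrow> (real M)\<^sup>2 * K * sq_norm lebesgue g * 0"
      using \<rho> by (intro tendsto_mult tendsto_const LIMSEQ_realpow_zero) auto
    from tendsto_lowerbound[OF this ev] have "sq_norm lebesgue (gM M) \<le> 0" by simp
    then show ?thesis using sq_norm_nonneg[of lebesgue "gM M"] by linarith
  qed
  then have "AE \<omega> in lebesgue. gM M \<omega> = 0" for M using sq_norm_eq_0_iff[OF gMq] by simp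
  then have "AE \<omega> in lebesgue. \<forall>M. gM M \<omega> = 0" by (simp add: AE_all_countable)
  then show ?thesis
  proof eventually_elim
    case (elim \<omega>)
    obtain M :: nat where "max (norm \<omega>) (cmod (L \<omega>)) \<le> real M" using real_arch_simple by blast
    then show ?case using elim[rule_format, of M] by (simp add: gM_def)
  qed
qed

lemma completeness:
  assumes g: "sq_int lebesgue g" and j0: "fine_scale j0"
    and base: "\<And>\<beta>. \<beta> \<in> dilated_lattice D (j0 + 1) \<Longrightarrow> ip lebesgue g (elem (Ld (j0 + 1)) \<beta>) = 0"
    and wav: "\<And>j \<beta>. j \<le> j0 \<Longrightarrow> \<beta> \<in> dilated_lattice D j - dilated_lattice D (j + 1) \<Longrightarrow> ip lebesgue g (elem (wavelet_multiplier j) \<beta>) = 0"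
  shows "AE \<omega> in lebesgue. g \<omega> = 0"
proof -
  have "AE \<omega> in lebesgue. periodized g j \<omega> = 0" if "j \<le> j0 + 1" for j
    using that
  proof (induction j rule: int_le_induct)
    case base
    show ?case by (rule periodized_base_zero[OF g assms(3)])
  next
    case (step i)
    have "i - 1 \<le> j0" using step by simp
    then show ?case
      using periodized_step_zero[OF g fine_scale_mono[OF _ j0], of "i - 1"] step wav by simp
  qed
  then show ?thesis by (intro zero_if_all_periodized_zero[OF g j0]) simp
qed

end

context spline
begin

section \<open>The Riesz basis\<close>

definition fourier_system :: "int \<Rightarrow> (real^'d) + int \<times> (real^'d) \<Rightarrow> real^'d \<Rightarrow> complex" where
  "fourier_system j0 = case_sum (\<lambda>\<beta>. elem (Ld (j0 + 1)) \<beta>) (\<lambda>(j, \<beta>). elem (wavelet_multiplier j) \<beta>)"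

definition index_scale :: "int \<Rightarrow> (real^'d) + int \<times> (real^'d) \<Rightarrow> int" where
  "index_scale j0 = case_sum (\<lambda>_. j0 + 1) fst"

definition index_point :: "(real^'d) + int \<times> (real^'d) \<Rightarrow> real^'d" where
  "index_point = case_sum id snd"

text \<open>Treats the B-splines as the block of scale j0 + 1, so that orthogonality and bounds are
  stated once for all scales.\<close>

definition scale_multiplier :: "int \<Rightarrow> int \<Rightarrow> real^'d \<Rightarrow> complex" where
  "scale_multiplier j0 l = (if l = j0 + 1 then Ld l else wavelet_multiplier l)"

lemma index_cases:
  assumes "i \<in> wavelet_index D j0"
  shows "fourier_system j0 i = elem (scale_multiplier j0 (index_scale j0 i)) (index_point i)" "index_scale j0 i \<le> j0 + 1"
    "index_point i \<in> dilated_lattice D (index_scale j0 i)"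
    "index_scale j0 i \<le> j0 \<Longrightarrow> index_point i \<notin> dilated_lattice D (index_scale j0 i + 1)"
  using assms by (auto simp: wavelet_index_def fourier_system_def index_scale_def index_point_def scale_multiplier_def)

lemma index_inj: "i \<in> wavelet_index D j0 \<Longrightarrow> i' \<in> wavelet_index D j0 \<Longrightarrow> index_scale j0 i = index_scale j0 i' \<Longrightarrow> index_point i = index_point i' \<Longrightarrow> i = i'"
  by (auto simp: wavelet_index_def index_scale_def index_point_def)

lemma scale_multiplier_measurable[measurable]: "scale_multiplier j0 l \<in> borel_measurable lebesgue"
  by (simp add: scale_multiplier_def)

lemma scale_multiplier_periodic: "tor.periodic l (scale_multiplier j0 l)"
  by (simp add: scale_multiplier_def Ld_periodic wavelet_multiplier_periodic)

lemma sq_int_fourier_system: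
  assumes j0: "fine_scale j0" and i: "i \<in> wavelet_index D j0" shows "sq_int lebesgue (fourier_system j0 i)"
proof (cases "index_scale j0 i = j0 + 1")
  case True
  then show ?thesis using index_cases[OF i] sq_int_elem_base by (simp add: scale_multiplier_def)
next
  case False
  then have le: "index_scale j0 i \<le> j0" using index_cases(2)[OF i] by simp
  have "index_point i \<in> dilated_lattice D (index_scale j0 i) - dilated_lattice D (index_scale j0 i + 1)"
    using index_cases(3,4)[OF i] le by blast
  then show ?thesis
    using sq_int_elem_wavelet[OF fine_scale_mono[OF le j0]] False by (simp add: index_cases(1)[OF i] scale_multiplier_def)
qed

lemma fourier_system_orthogonal:
  assumes j0: "fine_scale j0" and i: "i \<in> wavelet_index D j0" and i': "i' \<in> wavelet_index D j0"
    and less: "index_scale j0 i < index_scale j0 i'"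
  shows "ip lebesgue (fourier_system j0 i') (fourier_system j0 i) = 0"
proof -
  have le: "index_scale j0 i \<le> j0" "index_scale j0 i \<noteq> j0 + 1" using less index_cases(2)[OF i'] by auto
  then have mli: "scale_multiplier j0 (index_scale j0 i) = wavelet_multiplier (index_scale j0 i)" by (simp add: scale_multiplier_def)
  have \<beta>: "index_point i \<in> dilated_lattice D (index_scale j0 i) - dilated_lattice D (index_scale j0 i + 1)"
    using index_cases(3,4)[OF i] le by blast
  show ?thesis
    unfolding index_cases(1)[OF i] index_cases(1)[OF i'] mli
    by (rule levels_orthogonal[OF less \<beta> index_cases(3)[OF i'] scale_multiplier_measurable scale_multiplier_periodic])
      (use sq_int_fourier_system[OF j0 i] sq_int_fourier_system[OF j0 i'] in \<open>simp_all add: index_cases(1)[OF i] index_cases(1)[OF i'] mli\<close>)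
qed

lemma level_block:
  assumes j0: "fine_scale j0"
  shows "\<exists>A B. A > 0 \<and> (\<forall>l F c. finite F \<longrightarrow> F \<subseteq> wavelet_index D j0 \<longrightarrow> (\<forall>i\<in>F. index_scale j0 i = l) \<longrightarrow>
     A * (\<Sum>i\<in>F. (cmod (c i))\<^sup>2) \<le> sq_norm lebesgue (\<lambda>\<omega>. \<Sum>i\<in>F. c i * fourier_system j0 i \<omega>) \<and>
     sq_norm lebesgue (\<lambda>\<omega>. \<Sum>i\<in>F. c i * fourier_system j0 i \<omega>) \<le> B * (\<Sum>i\<in>F. (cmod (c i))\<^sup>2))"
proof -
  obtain A1 B1 where b: "A1 > 0 \<and> (\<forall>F (q :: (real^'d) + int \<times> (real^'d) \<Rightarrow> real^'d) c. finite F \<longrightarrow> inj_on q F \<longrightarrow> q ` F \<subseteq> dilated_lattice D (j0 + 1) \<longrightarrow>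
      sq_int lebesgue (\<lambda>\<omega>. char_sum F q c \<omega> * Ld (j0 + 1) \<omega> / L \<omega>) \<and>
      A1 * (\<Sum>i\<in>F. (cmod (c i))\<^sup>2) \<le> sq_norm lebesgue (\<lambda>\<omega>. char_sum F q c \<omega> * Ld (j0 + 1) \<omega> / L \<omega>) \<and>
      sq_norm lebesgue (\<lambda>\<omega>. char_sum F q c \<omega> * Ld (j0 + 1) \<omega> / L \<omega>) \<le> B1 * (\<Sum>i\<in>F. (cmod (c i))\<^sup>2))"
    using base_block[of "j0 + 1"] by (elim exE)
  obtain A2 B2 where w: "A2 > 0 \<and> (\<forall>j F (q :: (real^'d) + int \<times> (real^'d) \<Rightarrow> real^'d) c. fine_scale j \<longrightarrow> finite F \<longrightarrow> inj_on q F \<longrightarrow>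
      q ` F \<subseteq> dilated_lattice D j - dilated_lattice D (j + 1) \<longrightarrow>
      sq_int lebesgue (\<lambda>\<omega>. char_sum F q c \<omega> * wavelet_multiplier j \<omega> / L \<omega>) \<and>
      A2 * (\<Sum>i\<in>F. (cmod (c i))\<^sup>2) \<le> sq_norm lebesgue (\<lambda>\<omega>. char_sum F q c \<omega> * wavelet_multiplier j \<omega> / L \<omega>) \<and>
      sq_norm lebesgue (\<lambda>\<omega>. char_sum F q c \<omega> * wavelet_multiplier j \<omega> / L \<omega>) \<le> B2 * (\<Sum>i\<in>F. (cmod (c i))\<^sup>2))"
    using wavelet_block by (elim exE)
  show ?thesis
  proof (rule exI[of _ "min A1 A2"], rule exI[of _ "max B1 B2"], intro conjI[of "_ > _"] allI impI)
    show "min A1 A2 > 0" using b w by simp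
    fix l F and c :: "(real^'d) + int \<times> (real^'d) \<Rightarrow> complex"
    assume F: "finite F" "F \<subseteq> wavelet_index D j0" "\<forall>i\<in>F. index_scale j0 i = l"
    define \<Sigma> where "\<Sigma> = (\<Sum>i\<in>F. (cmod (c i))\<^sup>2)"
    have \<Sigma>: "\<Sigma> \<ge> 0" unfolding \<Sigma>_def by (intro sum_nonneg) simp
    have eq: "(\<lambda>\<omega>. \<Sum>i\<in>F. c i * fourier_system j0 i \<omega>) = (\<lambda>\<omega>. char_sum F index_point c \<omega> * scale_multiplier j0 l \<omega> / L \<omega>)"
    proof
      fix \<omega>
      have "(\<Sum>i\<in>F. c i * fourier_system j0 i \<omega>) = (\<Sum>i\<in>F. c i * cis (- (\<omega> \<bullet> index_point i)) * (scale_multiplier j0 l \<omega> / L \<omega>))"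
        by (rule sum.cong[OF refl]) (use F index_cases(1) in \<open>auto simp: elem_def\<close>)
      then show "(\<Sum>i\<in>F. c i * fourier_system j0 i \<omega>) = char_sum F index_point c \<omega> * scale_multiplier j0 l \<omega> / L \<omega>"
        unfolding sum_distrib_right[symmetric] by (simp add: char_sum_def)
    qed
    have inj: "inj_on index_point F"
    proof (rule inj_onI)
      fix i i' assume i: "i \<in> F" "i' \<in> F" "index_point i = index_point i'"
      have "index_scale j0 i = index_scale j0 i'" using i F(3) by simp
      then show "i = i'" using i F(2) by (intro index_inj[of i j0 i']) auto
    qed
    \<comment> \<open>An empty \<open>F\<close> gives no information on \<open>l\<close>, which may
      then exceed j0 + 1, and is treated apart.\<close>
    have both: "(\<exists>A B. min A1 A2 \<le> A \<and> B \<le> max B1 B2 \<and>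
      A * \<Sigma> \<le> sq_norm lebesgue (\<lambda>\<omega>. char_sum F index_point c \<omega> * scale_multiplier j0 l \<omega> / L \<omega>) \<and>
      sq_norm lebesgue (\<lambda>\<omega>. char_sum F index_point c \<omega> * scale_multiplier j0 l \<omega> / L \<omega>) \<le> B * \<Sigma>)"
    proof (cases "F = {} \<or> l = j0 + 1")
      case True
      then consider "F = {}" | "F \<noteq> {}" "l = j0 + 1" by blast
      then show ?thesis
      proof cases
        case 1
        then show ?thesis by (intro exI[of _ "min A1 A2"] exI[of _ "max B1 B2"]) (auto simp: \<Sigma>_def char_sum_def sq_norm_def)
      next
        case 2
        have "index_point ` F \<subseteq> dilated_lattice D (j0 + 1)"
          by (rule image_subsetI) (use F 2 index_cases(3)[of _ j0] in force)
        from b[THEN conjunct2, rule_format, OF F(1) inj this, of c]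
        show ?thesis
          unfolding \<Sigma>_def by - (rule exI[of _ A1], rule exI[of _ B1], simp add: scale_multiplier_def 2)
      qed
    next
      case False
      then obtain i where i: "i \<in> F" by blast
      then have le: "l \<le> j0" using F index_cases(2)[of i j0] False by force
      have "index_point ` F \<subseteq> dilated_lattice D l - dilated_lattice D (l + 1)"
      proof (rule image_subsetI)
        fix k assume "k \<in> F"
        then have k: "k \<in> wavelet_index D j0" "index_scale j0 k = l" using F by auto
        then show "index_point k \<in> dilated_lattice D l - dilated_lattice D (l + 1)"
          using index_cases(3,4)[OF k(1)] le by simp
      qed
      from w[THEN conjunct2, rule_format, OF fine_scale_mono[OF le j0] F(1) inj this, of c]
      show ?thesis
        unfolding \<Sigma>_def using False by - (rule exI[of _ A2], rule exI[of _ B2], simp add: scale_multiplier_def)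
    qed
    then obtain A B where AB: "min A1 A2 \<le> A" "B \<le> max B1 B2"
      "A * \<Sigma> \<le> sq_norm lebesgue (\<lambda>\<omega>. char_sum F index_point c \<omega> * scale_multiplier j0 l \<omega> / L \<omega>)"
      "sq_norm lebesgue (\<lambda>\<omega>. char_sum F index_point c \<omega> * scale_multiplier j0 l \<omega> / L \<omega>) \<le> B * \<Sigma>" by (elim exE conjE)
    have "min A1 A2 * \<Sigma> \<le> A * \<Sigma>" "B * \<Sigma> \<le> max B1 B2 * \<Sigma>" using AB \<Sigma> by (auto intro: mult_right_mono)
    then show "min A1 A2 * (\<Sum>i\<in>F. (cmod (c i))\<^sup>2) \<le> sq_norm lebesgue (\<lambda>\<omega>. \<Sum>i\<in>F. c i * fourier_system j0 i \<omega>) \<and>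
     sq_norm lebesgue (\<lambda>\<omega>. \<Sum>i\<in>F. c i * fourier_system j0 i \<omega>) \<le> max B1 B2 * (\<Sum>i\<in>F. (cmod (c i))\<^sup>2)"
      using AB unfolding eq \<Sigma>_def[symmetric] by linarith
  qed
qed

text \<open>Blocks of different scales are orthogonal, so by Pythagoras the constants of the single
  blocks serve for the whole system.\<close>

lemma riesz_basis_fourier_system:
  assumes j0: "fine_scale j0"
  shows "riesz_basis_L2 (fourier_system j0) (wavelet_index D j0)"
proof -
  let ?W = "wavelet_index D j0"
  obtain A B where AB: "A > 0 \<and> (\<forall>l F c. finite F \<longrightarrow> F \<subseteq> ?W \<longrightarrow> (\<forall>i\<in>F. index_scale j0 i = l) \<longrightarrow>
     A * (\<Sum>i\<in>F. (cmod (c i))\<^sup>2) \<le> sq_norm lebesgue (\<lambda>\<omega>. \<Sum>i\<in>F. c i * fourier_system j0 i \<omega>) \<and>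
     sq_norm lebesgue (\<lambda>\<omega>. \<Sum>i\<in>F. c i * fourier_system j0 i \<omega>) \<le> B * (\<Sum>i\<in>F. (cmod (c i))\<^sup>2))"
    using level_block[OF j0] by (elim exE)
  show ?thesis
  proof (rule riesz_basis_L2I)
    show "sq_int lebesgue (fourier_system j0 i)" if "i \<in> ?W" for i by (rule sq_int_fourier_system[OF j0 that])
    show "A > 0" using AB by simp
    show "AE x in lebesgue. g x = 0"
      if g: "sq_int lebesgue g" and orth: "\<And>i. i \<in> ?W \<Longrightarrow> ip lebesgue g (fourier_system j0 i) = 0" for g
    proof (rule completeness[OF g j0])
      show "ip lebesgue g (elem (Ld (j0 + 1)) \<beta>) = 0" if "\<beta> \<in> dilated_lattice D (j0 + 1)" for \<beta>
        using orth[of "Inl \<beta>"] that by (simp add: wavelet_index_def fourier_system_def InlI)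
      show "ip lebesgue g (elem (wavelet_multiplier j) \<beta>) = 0"
        if "j \<le> j0" "\<beta> \<in> dilated_lattice D j - dilated_lattice D (j + 1)" for j \<beta>
        using orth[of "Inr (j, \<beta>)"] that by (simp add: wavelet_index_def fourier_system_def InrI)
    qed
    fix F and c :: "(real^'d) + int \<times> (real^'d) \<Rightarrow> complex" assume F: "finite F" "F \<subseteq> ?W"
    define Fl where "Fl l = {i \<in> F. index_scale j0 i = l}" for l
    have Fl: "finite (Fl l)" "Fl l \<subseteq> ?W" "\<forall>i\<in>Fl l. index_scale j0 i = l" for l using F by (auto simp: Fl_def)
    define blk where "blk l \<omega> = (\<Sum>i\<in>Fl l. c i * fourier_system j0 i \<omega>)" for l \<omega>
    have q: "sq_int lebesgue (\<lambda>\<omega>. c i * fourier_system j0 i \<omega>)" if "i \<in> Fl l" for i l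
      by (intro sq_int_scale sq_int_fourier_system[OF j0]) (use that F in \<open>auto simp: Fl_def\<close>)
    have bq: "sq_int lebesgue (blk l)" for l unfolding blk_def by (rule sq_int_sum[OF q])
    have orth1: "ip lebesgue (blk l') (blk l) = 0" if "l < l'" for l l'
    proof -
      have "ip lebesgue (\<lambda>\<omega>. \<Sum>i\<in>Fl l'. c i * fourier_system j0 i \<omega>) (blk l) = (\<Sum>i\<in>Fl l'. ip lebesgue (\<lambda>\<omega>. c i * fourier_system j0 i \<omega>) (blk l))"
        by (rule ip_sum_left[OF bq q])
      also have "\<dots> = (\<Sum>i\<in>Fl l'. \<Sum>k\<in>Fl l. ip lebesgue (\<lambda>\<omega>. c i * fourier_system j0 i \<omega>) (\<lambda>\<omega>. c k * fourier_system j0 k \<omega>))"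
        unfolding blk_def by (rule sum.cong[OF refl]) (rule ip_sum_right[OF q q])
      also have "\<dots> = 0"
        unfolding ip_scale_left ip_scale_right
        by (intro sum.neutral ballI) (use fourier_system_orthogonal[OF j0] F that in \<open>auto simp: Fl_def subset_iff\<close>)
      finally show ?thesis by (simp add: blk_def[abs_def])
    qed
    have orth: "ip lebesgue (blk l) (blk l') = 0" if "l \<noteq> l'" for l l'
    proof (cases "l' < l")
      case True then show ?thesis by (rule orth1)
    next
      case False
      then have "ip lebesgue (blk l') (blk l) = 0" using that by (intro orth1) simp
      then show ?thesis using ip_commute[of lebesgue "blk l" "blk l'"] by simp
    qed
    define \<Lambda> where "\<Lambda> = index_scale j0 ` F"
    have \<Lambda>: "finite \<Lambda>" using F by (simp add: \<Lambda>_def)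
    have "(\<lambda>\<omega>. \<Sum>i\<in>F. c i * fourier_system j0 i \<omega>) = (\<lambda>\<omega>. \<Sum>l\<in>\<Lambda>. blk l \<omega>)"
      unfolding \<Lambda>_def blk_def Fl_def by (rule ext) (rule sum.image_gen[OF F(1)])
    then have tot: "sq_norm lebesgue (\<lambda>\<omega>. \<Sum>i\<in>F. c i * fourier_system j0 i \<omega>) = (\<Sum>l\<in>\<Lambda>. sq_norm lebesgue (blk l))"
      using sq_norm_sum_orthogonal[OF \<Lambda> bq orth] by simp
    have cs: "(\<Sum>i\<in>F. (cmod (c i))\<^sup>2) = (\<Sum>l\<in>\<Lambda>. \<Sum>i\<in>Fl l. (cmod (c i))\<^sup>2)"
      unfolding \<Lambda>_def Fl_def by (rule sum.image_gen[OF F(1)])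
    have bl: "A * (\<Sum>i\<in>Fl l. (cmod (c i))\<^sup>2) \<le> sq_norm lebesgue (blk l)"
      "sq_norm lebesgue (blk l) \<le> B * (\<Sum>i\<in>Fl l. (cmod (c i))\<^sup>2)" for l
      using AB[THEN conjunct2, rule_format, OF Fl(1) Fl(2), of l l c] Fl(3) unfolding blk_def[abs_def] by auto
    show "A * (\<Sum>i\<in>F. (cmod (c i))\<^sup>2) \<le> sq_norm lebesgue (\<lambda>\<omega>. \<Sum>i\<in>F. c i * fourier_system j0 i \<omega>) \<and>
        sq_norm lebesgue (\<lambda>\<omega>. \<Sum>i\<in>F. c i * fourier_system j0 i \<omega>) \<le> B * (\<Sum>i\<in>F. (cmod (c i))\<^sup>2)"
      unfolding tot cs sum_distrib_left[of _ _ \<Lambda>] by (intro conjI sum_mono bl)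
  qed
qed

section \<open>The Fourier transforms of the splines and the wavelets\<close>

lemma is_fourier_L2_bspline:
  "is_fourier_L2 1 (elem (Ld j) \<beta>) (\<lambda>x. of_real (two_pi_dim TYPE('d)) * bspline L D p j (x - \<beta>))"
proof -
  have "0 = lattice_pt D j 0" by (simp add: lattice_pt_def)
  then have "0 \<in> dilated_lattice D j" by (simp add: dilated_lattice_def)
  then have "sq_int lebesgue (elem (Ld j) 0)" by (rule sq_int_elem_base)
  moreover have "elem (Ld j) 0 = bspline_hat L D j (p j)" by (simp add: elem_def bspline_hat_eq fun_eq_iff)
  ultimately have "sq_int lebesgue (bspline_hat L D j (p j))" by simp
  from is_fourier_L2_modulate[OF _ is_fourier_L2_inverse_fourier_L2[OF this], of \<beta>]
  show ?thesis by (simp add: elem_def[abs_def] bspline_hat_eq bspline_def mult.commute)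
qed

text \<open>The untranslated wavelet is not a member of the system, because 0 lies in every lattice,
  and so it needs its own argument.\<close>

lemma sq_int_wavelet_multiplier: assumes j: "fine_scale j" shows "sq_int lebesgue (\<lambda>\<omega>. wavelet_multiplier j \<omega> / L \<omega>)"
proof -
  obtain B where B: "AE \<omega> in lebesgue. (cmod (wavelet_multiplier j \<omega>))\<^sup>2 * S j \<omega> \<le> B * (a powi j) ^ CARD('d)"
    using wavelet_multiplier_bound j by blast
  show ?thesis
  proof (rule sq_int_quotient[OF wavelet_multiplier_measurable wavelet_multiplier_periodic tor.AE_T[OF B]])
    show "integrable (tor.T j) (\<lambda>_. B * (a powi j) ^ CARD('d))"
      by (rule tor.integrable_T_bounded[where B="\<bar>B * (a powi j) ^ CARD('d)\<bar>"]) auto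
  qed
qed

text \<open>With |det D| = a^d the exponents add up to d ((r/d - 1/2) + 1) = r + d/2 per unit of
  \<open>j\<close>.\<close>

lemma \<kappa>_eq: "\<kappa> j = \<bar>det D\<bar> powr ((r / real CARD('d) - 1 / 2) * of_int j) * \<bar>det D\<bar> powi j"
proof -
  have ap: "a > 0" using a by simp
  define n where "n = real CARD('d)"
  have n: "n > 0" by (simp add: n_def)
  have d: "\<bar>det D\<bar> = a powr n" using ap by (simp add: abs_det_D n_def powr_realpow)
  have pi: "x powi j = x powr of_int j" if "x > 0" for x :: real using that by (simp add: powr_real_of_int')
  have "\<bar>det D\<bar> powr ((r / n - 1 / 2) * of_int j) * \<bar>det D\<bar> powi j
      = a powr (n * ((r / n - 1 / 2) * of_int j)) * a powr (n * of_int j)"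
    using ap by (simp add: d pi powr_powr)
  also have "\<dots> = a powr (n * ((r / n - 1 / 2) * of_int j) + n * of_int j)" by (simp add: powr_add)
  also have "n * ((r / n - 1 / 2) * of_int j) + n * of_int j = of_int j * (r + n / 2)"
    using n by (simp add: field_simps)
  also have "a powr (of_int j * (r + n / 2)) = \<kappa> j" using ap by (simp add: \<kappa>_def pi powr_powr n_def)
  finally show ?thesis by (simp add: n_def)
qed

text \<open>In the interpolant |Ld|^2 occurs above and below and cancels almost everywhere, leaving
  |det D|^j / (|L|^2 S_j); the conjugate symbol then removes one factor of |L|^2.\<close>

lemma is_fourier_L2_wavelet:
  assumes j: "fine_scale j"
  shows "is_fourier_L2 1 (elem (wavelet_multiplier j) \<beta>) (\<lambda>x. of_real (two_pi_dim TYPE('d)) *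
     (of_real (\<bar>det D\<bar> powr ((r / real CARD('d) - 1 / 2) * of_int j)) * wavelet L D p (j + 1) (x - \<beta>)))"
proof -
  define k0 where "k0 = \<bar>det D\<bar> powi j"
  define k1 where "k1 = \<bar>det D\<bar> powr ((r / real CARD('d) - 1 / 2) * of_int j)"
  have dpos: "\<bar>det D\<bar> > 0" using a by (simp add: abs_det_D)
  have k: "k0 > 0" "k1 > 0" "\<kappa> j = k1 * k0" using dpos by (auto simp: k0_def k1_def \<kappa>_eq)
  define J where "J \<omega> = complex_of_real (k0 * (cmod (Ld j \<omega> / L \<omega>))\<^sup>2 / ((cmod (Ld j \<omega>))\<^sup>2 * S j \<omega>))" for \<omega>
  have Jm[measurable]: "J \<in> borel_measurable lebesgue" unfolding J_def by measurable
  have interp: "interpolant L D p j = inverse_fourier_L2 J"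
    by (simp add: interpolant_def bspline_hat_eq bspline_period_eq J_def[abs_def] k0_def)
  have Jq: "sq_int lebesgue J"
  proof (rule AE_localizes[of j])
    fix A B assume A: "A > 0" and AE0: "AE \<omega> in lebesgue. good A B j \<omega>"
    note AE = AE0[unfolded good_def]
    have bq: "sq_int lebesgue (\<lambda>\<omega>. Ld j \<omega> / L \<omega>)"
    proof -
      have "0 = lattice_pt D j 0" by (simp add: lattice_pt_def)
      then have "0 \<in> dilated_lattice D j" by (simp add: dilated_lattice_def)
      from sq_int_elem_base[OF this] show ?thesis by (simp add: elem_def[abs_def])
    qed
    show ?thesis
    proof (rule sq_int_bound[OF Jm bq])
      \<comment> \<open>x^2 is one term of the sum \<open>P\<close>, and A \<le> P. Multiplying x
        \<le> sqrt P by sqrt A \<le> sqrt P gives x^2 / P \<le> x / sqrt A, so \<open>J\<close> is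
        dominated by the transform of the B-spline.\<close>
      show "AE \<omega> in lebesgue. cmod (J \<omega>) \<le> (k0 / sqrt A) * cmod (Ld j \<omega> / L \<omega>)"
        using AE
      proof eventually_elim
        case (elim \<omega>)
        define x where "x = cmod (Ld j \<omega> / L \<omega>)"
        define P where "P = (cmod (Ld j \<omega>))\<^sup>2 * S j \<omega>"
        have P: "A \<le> P" "P > 0" using elim A by (auto simp: P_def)
        have "inverse ((cmod (L \<omega>))\<^sup>2) \<le> S j \<omega>"
          using sum_le_integral_count_space[of "\<lambda>k. inverse ((cmod (L (\<omega> + tor.dual_pt j k)))\<^sup>2)" "{0}"] elim
          by (simp add: S_def)
        then have "(cmod (Ld j \<omega>))\<^sup>2 * inverse ((cmod (L \<omega>))\<^sup>2) \<le> P" unfolding P_def by (intro mult_left_mono) auto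
        then have "x\<^sup>2 \<le> P" by (simp add: x_def divide_inverse norm_mult norm_inverse power_mult_distrib power_inverse)
        then have "x \<le> sqrt P" by (rule real_le_rsqrt)
        moreover have "sqrt A \<le> sqrt P" using P by simp
        ultimately have "x * sqrt A \<le> sqrt P * sqrt P" using A by (intro mult_mono) (auto simp: x_def)
        then have "x * sqrt A \<le> P" using P by simp
        then have "x * (x * sqrt A) \<le> x * P" by (intro mult_left_mono) (auto simp: x_def)
        then have "x\<^sup>2 / P \<le> x / sqrt A" using P A by (simp add: field_simps power2_eq_square)
        then have "k0 * (x\<^sup>2 / P) \<le> k0 * (x / sqrt A)" using k by (intro mult_left_mono) auto
        moreover have "cmod (J \<omega>) = k0 * x\<^sup>2 / P"
          unfolding J_def x_def[symmetric] P_def[symmetric] norm_of_real using k P by (simp add: abs_of_nonneg)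
        ultimately show ?case by (simp add: x_def)
      qed
    qed
  qed
  define G where "G = fourier_L2 (interpolant L D p j)"
  have GJ: "AE \<omega> in lebesgue. G \<omega> = J \<omega>"
    unfolding G_def interp by (rule fourier_inverse_fourier_L2(2)[OF Jq])
  have "sq_int lebesgue G"
    using is_fourier_L2_fourier_L2[OF fourier_inverse_fourier_L2(1)[OF Jq]] by (simp add: is_fourier_L2_def G_def interp)
  then have [measurable]: "G \<in> borel_measurable lebesgue" by (simp add: sq_int_def)
  define W where "W \<omega> = of_real (k0 / \<kappa> j) * (wavelet_multiplier j \<omega> / L \<omega>)" for \<omega>
  have Wq: "sq_int lebesgue W" unfolding W_def by (intro sq_int_scale sq_int_wavelet_multiplier j)
  then have [measurable]: "W \<in> borel_measurable lebesgue" by (simp add: sq_int_def)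
  have "AE \<omega> in lebesgue. cnj (L \<omega>) * G \<omega> = W \<omega>"
  proof (rule AE_localizes[of j])
    fix A B assume AE0: "AE \<omega> in lebesgue. good A B j \<omega>"
    note AE = AE0[unfolded good_def]
    show "AE \<omega> in lebesgue. cnj (L \<omega>) * G \<omega> = W \<omega>"
      using GJ AE L_nz
    proof eventually_elim
      case (elim \<omega>)
      have "k0 * (cmod (Ld j \<omega> / L \<omega>))\<^sup>2 / ((cmod (Ld j \<omega>))\<^sup>2 * S j \<omega>) = k0 / ((cmod (L \<omega>))\<^sup>2 * S j \<omega>)"
        using elim by (simp add: norm_divide power_divide)
      then have "cnj (L \<omega>) * G \<omega> = cnj (L \<omega>) * of_real k0 / (of_real ((cmod (L \<omega>))\<^sup>2) * of_real (S j \<omega>))"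
        using elim by (simp add: J_def)
      also have "of_real ((cmod (L \<omega>))\<^sup>2) = L \<omega> * cnj (L \<omega>)" by (rule complex_norm_square)
      finally show ?case using elim k by (simp add: W_def wavelet_multiplier_def field_simps)
    qed
  qed
  then have "wavelet L D p (j + 1) = inverse_fourier_L2 W"
    unfolding wavelet_def fourier_multiplier_def adjoint_symbol_def G_def[symmetric]
    by (simp add: G_def[symmetric]) (intro inverse_fourier_L2_cong; measurable)
  then have "is_fourier_L2 1 W (\<lambda>x. of_real (two_pi_dim TYPE('d)) * wavelet L D p (j + 1) x)"
    using is_fourier_L2_inverse_fourier_L2[OF Wq] by simp
  from is_fourier_L2_scale[OF _ is_fourier_L2_modulate[OF _ this, of \<beta>], of "of_real k1"]
  have "is_fourier_L2 1 (\<lambda>\<omega>. of_real k1 * (W \<omega> * cis (- (\<omega> \<bullet> \<beta>))))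
      (\<lambda>x. of_real k1 * (of_real (two_pi_dim TYPE('d)) * wavelet L D p (j + 1) (x - \<beta>)))" by simp
  moreover have "of_real k1 * (W \<omega> * cis (- (\<omega> \<bullet> \<beta>))) = elem (wavelet_multiplier j) \<beta> \<omega>" for \<omega>
    using k by (simp add: W_def elem_def)
  ultimately show ?thesis by (simp add: k1_def mult.left_commute)
qed

lemma riesz_basis_wavelet_system:
  assumes j0: "fine_scale j0"
  shows "riesz_basis_L2 (wavelet_system L D r p j0) (wavelet_index D j0)"
proof (rule riesz_basis_L2_transfer[OF riesz_basis_fourier_system[OF j0]])
  fix i assume i: "i \<in> wavelet_index D j0"
  show "is_fourier_L2 1 (fourier_system j0 i) (\<lambda>x. of_real (two_pi_dim TYPE('d)) * wavelet_system L D r p j0 i x)"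
  proof (cases i)
    case (Inl \<beta>)
    then show ?thesis using is_fourier_L2_bspline by (simp add: fourier_system_def wavelet_system_def)
  next
    case (Inr q)
    then obtain j \<beta> where q: "i = Inr (j, \<beta>)" by (cases q) auto
    then have "j \<le> j0" using i by (auto simp: wavelet_index_def)
    then show ?thesis using is_fourier_L2_wavelet[OF fine_scale_mono[OF _ j0]] q by (simp add: fourier_system_def wavelet_system_def)
  qed
qed

end

theorem theorem3:
  fixes L :: "real^'d \<Rightarrow> complex" and D :: "real^'d^'d" and r :: real
    and p :: "int \<Rightarrow> int^'d \<Rightarrow> complex" and \<omega>\<^sub>0 C\<^sub>1 C\<^sub>2 :: real
  assumes "spline_admissible_pair L D r"
    and "\<And>j. localizes L D j (p j)"
    and "\<omega>\<^sub>0 > 0" and "C\<^sub>1 > 0" and "C\<^sub>2 > 0"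
    and "\<And>\<omega>. norm \<omega> \<ge> \<omega>\<^sub>0 \<Longrightarrow>
           C\<^sub>1 * norm \<omega> powr r \<le> cmod (L \<omega>) \<and> cmod (L \<omega>) \<le> C\<^sub>2 * norm \<omega> powr r"
  shows "\<exists>j\<^sub>0 :: int. riesz_basis_L2 (wavelet_system L D r p j\<^sub>0) (wavelet_index D j\<^sub>0)"
proof -
  have sap: "r > real CARD('d) / 2" "\<And>i j. D $ i $ j \<in> \<int>" "admissible_symbol L"
    "\<exists>a R. a > 1 \<and> orthogonal_matrix R \<and> D = a *\<^sub>R R"
    using assms(1) unfolding spline_admissible_pair_def by auto
  obtain a R where aR: "a > 1" "orthogonal_matrix R" "D = a *\<^sub>R R" using sap(4) by blast
  obtain f g where fg: "{\<omega>. f \<omega> * g \<omega> = 0} \<in> null_sets lebesgue" "AE \<omega> in lebesgue. L \<omega> = f \<omega> / g \<omega>"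
    using sap(3) unfolding admissible_symbol_def by blast
  \<comment> \<open>Admissibility provides a symbol that is nonzero almost everywhere, so that
    dividing by it is harmless.\<close>
  have "AE \<omega> in lebesgue. \<not> (f \<omega> * g \<omega> = 0)" using AE_not_in[OF fg(1)] by simp
  then have nz: "AE \<omega> in lebesgue. L \<omega> \<noteq> 0" using fg(2) by eventually_elim auto
  have meas: "L \<in> borel_measurable lebesgue" using sap(3) by (simp add: admissible_symbol_def)
  have "0 \<le> real CARD('d) / 2" by simp
  then have r: "r > 0" using sap(1) by linarith
  interpret spline D a R L r p \<omega>\<^sub>0 C\<^sub>1 C\<^sub>2
    by (unfold_locales) (fact sap aR r meas nz assms)+
  show ?thesis using fine_scale_exists riesz_basis_wavelet_system by blast
qed

end
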